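(* Let $\kappa\in\{1,-1\}$, $n_1,n_2\in\mathbb N_0$, and let $K$ be a nonnegative integer. Put $\varphi(q)=\frac23q_1+\frac13q_2$ for $q=(q_1,q_2)$ and $n=(n_1,n_2)$. The coefficients $e(-\kappa;n_1,n_2)$ obtained from the continuation formula (see context) satisfy, as $m\to\infty$, $$\begin{aligned} e(-\kappa;n_1,n_2)={}&\Bigg[-\pi\,\frac{\Gamma(1+m)}{\Gamma(1+\mu(\kappa)+m)\,\Gamma(-\mu(-\kappa)-\varphi(n)+m)}(2\kappa s_0)^m\,b(\kappa;m,n_1,n_2)\\ &-\sum_{\substack{0\le q_1\le n_1,\ 0\le q_2\le n_2\\ (q_1,q_2)\ne(n_1,n_2)}}e(-\kappa;q_1,q_2)\,\frac{\Gamma(-\mu(-\kappa)-\varphi(q)+m)}{\Gamma(-\mu(-\kappa)-\varphi(n)+m)}\,R_q(m)\Bigg]\\ &\times\Bigg[1+\sum_{k=1}^K\frac{(1+\mu(-\kappa)+\varphi(n))_k}{(1+\mu(-\kappa)+\varphi(n)-m)_k}H(-\kappa;k,0,0;n_1,n_2)+O(m^{-K-1})\Bigg]^{-1}, \end{aligned}$$ where $$R_q(m)=\sum_{k=0}^K\ \sum_{\substack{0\le l_1\le\min(k,\,n_1-q_1)\\0\le l_2\le\min(k,\,n_2-q_2)}}\frac{(1+\mu(-\kappa)+\varphi(q))_k}{(1+\mu(-\kappa)+\varphi(q)-m)_k}H(-\kappa;k,l_1,l_2;q_1,q_2)\frac{(-2\kappa t_{10})^{n_1-q_1-l_1}}{(n_1-q_1-l_1)!}\frac{(-2\kappa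 t_{20})^{n_2-q_2-l_2}}{(n_2-q_2-l_2)!}+O(m^{-K-1})$$ and $$H(-\kappa;k,l_1,l_2;q_1,q_2)=\sum_{j=l_1+l_2}^k\frac{(\mu(\kappa))_{k-j}}{(k-j)!\,(1+\mu(-\kappa)+\varphi(q))_j}(-2\kappa s_0)^j\,b(-\kappa;j,l_1,l_2).$$ Here $(\alpha)_j=\Gamma(\alpha+j)/\Gamma(\alpha)$ is the Pochhammer symbol.
   Context: Setting. $D_1,\dots,D_6,B_1,\dots,B_6,L$ are real, $B_6>0$, $L\ge0$ (parameters of the equation $z^2f''+zf'-[\sum_{m=1}^6 D_mz^{-m}+L^2+\sum_{m=1}^6 B_mz^m]f=0$). Put $p_3=\frac13\sqrt{B_6}$, $p_2=\frac{B_5}{12p_3}$, $p_1=\frac{B_4-4p_2^2}{6p_3}$, $s_0=p_3$, $t_{10}=p_2$, $t_{20}=p_1$, and for $\kappa\in\{1,-1\}$ $$\tau(\kappa)=\tfrac32-\tfrac16\frac{B_3}{\kappa p_3}+\tfrac23\frac{p_1p_2}{\kappa p_3}.$$ Coefficients $b$. For $\kappa\in\{1,-1\}$ the numbers $b(\kappa;m,n_1,n_2)$ are given by $$\begin{aligned}&6\kappa s_0(3m-2n_1-n_2)b(\kappa;m,n_1,n_2)=[(3m-2n_1-n_2+\tau(\kappa)-3)^2-L^2]\,b(\kappa;m-1,n_1,n_2)\\&+[-4\kappa t_{10}(3m-2n_1-n_2+\tau(\kappa)-2)+t_{20}^2-B_2]\,b(\kappa;m-1,n_1-1,n_2)\\&+[-2\kappa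 t_{20}(3m-2n_1-n_2+\tau(\kappa)-\tfrac52)-B_1]\,b(\kappa;m-1,n_1,n_2-1)\\&-D_1b(\kappa;m-2,n_1-1,n_2)-D_2b(\kappa;m-2,n_1,n_2-1)-D_3b(\kappa;m-2,n_1,n_2)\\&-D_4b(\kappa;m-3,n_1-1,n_2)-D_5b(\kappa;m-3,n_1,n_2-1)-D_6b(\kappa;m-3,n_1,n_2),\end{aligned}$$ with $b(\kappa;0,0,0)=1$; $b(\kappa;m,n_1,n_2)=0$ if $3m-2n_1-n_2=0$ and $(m,n_1,n_2)\ne(0,0,0)$; and $b=0$ if any index is negative. Coefficients $E$, $e$. Let $\lambda$ be an auxiliary parameter and $\nu_1,\nu_2$ positive integers (preferentially $1$), $\mu(\kappa)=\frac13[2\nu_1+\nu_2+\lambda+\tau(\kappa)]-2$, with $\lambda$ chosen so that no $\mu(\kappa)+\varphi(r)$ is an integer, where $\varphi(r)=\frac23r_1+\frac13r_2$ for $r=(r_1,r_2)\in\mathbb N_0^2$. Define $$\begin{aligned}W(\kappa;r_1,r_2)={}&\sum_{m\ge0}\sum_{n_1=0}^m\sum_{n_2=0}^m\Gamma(\nu_1+r_1+n_1)\Gamma(\nu_2+r_2+n_2)\Gamma(-\mu(\kappa)-\varphi(r)-m)\,b(\kappa;m,n_1,n_2)(-2\kappa s_0)^m\\&\times\Big(\tfrac12-\tfrac{s}{2\kappa s_0}\Big)^{\mu(\kappa)+\varphi(r)+m}(t_1-\kappa t_{10})^{-\nu_1-r_1-n_1}(t_2-\kappa t_{20})^{-\nu_2-r_2-n_2},\end{aligned}$$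 with powers of $\frac12\mp\frac{s}{2s_0}$ positive for $-s_0<s<s_0$, and $|t_1|,|t_2|$ sufficiently large. The coefficients $E(-\kappa;r_1,r_2;q_1,q_2)$ are those in the analytic continuation formula between the points $s=\kappa s_0$ and $s=-\kappa s_0$, $$W(\kappa;r_1,r_2)=\sum_{q_1\ge r_1}\sum_{q_2\ge r_2}E(-\kappa;r_1,r_2;q_1,q_2)\,W(-\kappa;q_1,q_2)+U(-\kappa;r_1,r_2),$$ where $U(-\kappa;r_1,r_2)$ is analytic in $s$ at $s=-\kappa s_0$. Put $e(-\kappa;q_1,q_2)=\sin(\pi\mu(\kappa))\,E(-\kappa;0,0;q_1,q_2)$ (independent of $\lambda$).
   Formalization: If all e(-κ;q) with q≤n vanish, an extra O(m^{-K-1}) term is allowed in the first bracket (the literal formula would force b(κ;m,n)=0 for large m, false in general); the continuation formula is read with absolute convergence and U jointly continuous, analytic on a fixed disc. *)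

theory Defs
  imports "HOL-Complex_Analysis.Complex_Analysis" "HOL-Library.Landau_Symbols"
begin

text \<open>
  The parameters of the equation
  $z^2 f'' + z f' - (\sum_{m=1}^6 D_m z^{-m} + L^2 + \sum_{m=1}^6 B_m z^m) f = 0$
  are real sequences \<open>D\<close>, \<open>B\<close>, of which only the entries 1 to 6 are used, and a real \<open>L\<close>.
  The sign \<open>\<kappa>\<close> is a real number, always 1 or -1. With $p_3, p_2, p_1$ the first three
  coefficients of the exponential factors at infinity, $s_0 = p_3$, $t_{10} = p_2$, $t_{20} = p_1$.
\<close>

definition s0 :: "(nat \<Rightarrow> real) \<Rightarrow> real" where
  "s0 B = sqrt (B 6) / 3"

definition t10 :: "(nat \<Rightarrow> real) \<Rightarrow> real" where
  "t10 B = B 5 / (12 * s0 B)"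

definition t20 :: "(nat \<Rightarrow> real) \<Rightarrow> real" where
  "t20 B = (B 4 - 4 * (t10 B)\<^sup>2) / (6 * s0 B)"

definition tau :: "(nat \<Rightarrow> real) \<Rightarrow> real \<Rightarrow> real" where
  "tau B \<kappa> = 3 / 2 - (1 / 6) * (B 3 / (\<kappa> * s0 B)) + (2 / 3) * (t20 B * t10 B / (\<kappa> * s0 B))"

text \<open>
  The recurrence is solved for its leading term; indices are integers, so that vanishing
  for negative indices can be stated literally.
\<close>

function coeff_b ::
  "(nat \<Rightarrow> real) \<Rightarrow> (nat \<Rightarrow> real) \<Rightarrow> real \<Rightarrow> real \<Rightarrow> int \<Rightarrow> int \<Rightarrow> int \<Rightarrow> real" where
  "coeff_b D B L \<kappa> m n1 n2 =
    (if m < 0 \<or> n1 < 0 \<or> n2 < 0 then 0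
     else if m = 0 \<and> n1 = 0 \<and> n2 = 0 then 1
     else if 3 * m - 2 * n1 - n2 = 0 then 0
     else
      (((real_of_int (3 * m - 2 * n1 - n2) + tau B \<kappa> - 3)\<^sup>2 - L\<^sup>2)
          * coeff_b D B L \<kappa> (m - 1) n1 n2
       + (- 4 * \<kappa> * t10 B * (real_of_int (3 * m - 2 * n1 - n2) + tau B \<kappa> - 2)
            + (t20 B)\<^sup>2 - B 2)
          * coeff_b D B L \<kappa> (m - 1) (n1 - 1) n2
       + (- 2 * \<kappa> * t20 B * (real_of_int (3 * m - 2 * n1 - n2) + tau B \<kappa> - 5 / 2) - B 1)
          * coeff_b D B L \<kappa> (m - 1) n1 (n2 - 1)
       - D 1 * coeff_b D B L \<kappa> (m - 2) (n1 - 1) n2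
       - D 2 * coeff_b D B L \<kappa> (m - 2) n1 (n2 - 1)
       - D 3 * coeff_b D B L \<kappa> (m - 2) n1 n2
       - D 4 * coeff_b D B L \<kappa> (m - 3) (n1 - 1) n2
       - D 5 * coeff_b D B L \<kappa> (m - 3) n1 (n2 - 1)
       - D 6 * coeff_b D B L \<kappa> (m - 3) n1 n2)
      / (6 * \<kappa> * s0 B * real_of_int (3 * m - 2 * n1 - n2)))"
  by pat_completeness auto
termination
  by (relation "Wellfounded.measure (\<lambda>(D, B, L, \<kappa>, m, n1, n2). nat (m + 1))") auto

declare coeff_b.simps [simp del]

definition mu :: "(nat \<Rightarrow> real) \<Rightarrow> nat \<Rightarrow> nat \<Rightarrow> complex \<Rightarrow> real \<Rightarrow> complex" where
  "mu B \<nu>1 \<nu>2 lam \<kappa> =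
    (2 * of_nat \<nu>1 + of_nat \<nu>2 + lam + complex_of_real (tau B \<kappa>)) / 3 - 2"

definition phi :: "nat \<Rightarrow> nat \<Rightarrow> complex" where
  "phi r1 r2 = (2 / 3) * of_nat r1 + (1 / 3) * of_nat r2"

text \<open>
  The general term of the series for \<open>W(\<kappa>; r1, r2)\<close>. The base of the complex power is a positive
  real for \<open>-s0 < s < s0\<close>, so \<open>powr\<close> is the power with argument zero. The arguments
  \<open>t1\<close>, \<open>t2\<close> are complex.
\<close>

definition W_term ::
  "(nat \<Rightarrow> real) \<Rightarrow> (nat \<Rightarrow> real) \<Rightarrow> real \<Rightarrow> nat \<Rightarrow> nat \<Rightarrow> complex \<Rightarrow> real \<Rightarrow> nat \<Rightarrow> nat
    \<Rightarrow> real \<Rightarrow> complex \<Rightarrow> complex \<Rightarrow> nat \<times> nat \<times> nat \<Rightarrow> complex" where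
  "W_term D B L \<nu>1 \<nu>2 lam \<kappa> r1 r2 s t1 t2 = (\<lambda>(m, n1, n2).
     Gamma (of_nat (\<nu>1 + r1 + n1)) * Gamma (of_nat (\<nu>2 + r2 + n2))
     * Gamma (- mu B \<nu>1 \<nu>2 lam \<kappa> - phi r1 r2 - of_nat m)
     * of_real (coeff_b D B L \<kappa> (int m) (int n1) (int n2))
     * of_real ((- 2 * \<kappa> * s0 B) ^ m)
     * of_real (1 / 2 - s / (2 * \<kappa> * s0 B)) powr (mu B \<nu>1 \<nu>2 lam \<kappa> + phi r1 r2 + of_nat m)
     / ((t1 - of_real (\<kappa> * t10 B)) ^ (\<nu>1 + r1 + n1)
        * (t2 - of_real (\<kappa> * t20 B)) ^ (\<nu>2 + r2 + n2)))"

definition W_index :: "(nat \<times> nat \<times> nat) set" where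
  "W_index = {(m, n1, n2). n1 \<le> m \<and> n2 \<le> m}"

definition W ::
  "(nat \<Rightarrow> real) \<Rightarrow> (nat \<Rightarrow> real) \<Rightarrow> real \<Rightarrow> nat \<Rightarrow> nat \<Rightarrow> complex \<Rightarrow> real \<Rightarrow> nat \<Rightarrow> nat
    \<Rightarrow> real \<Rightarrow> complex \<Rightarrow> complex \<Rightarrow> complex" where
  "W D B L \<nu>1 \<nu>2 lam \<kappa> r1 r2 s t1 t2 =
    (\<Sum>\<^sub>\<infinity>i\<in>W_index. W_term D B L \<nu>1 \<nu>2 lam \<kappa> r1 r2 s t1 t2 i)"

text \<open>
  \<open>E\<close> gives the coefficients \<open>E(-\<kappa>; r1, r2; q1, q2)\<close> of the continuation formula
  \<open>W(\<kappa>; r) = (\<Sum>q \<ge> r. E(-\<kappa>; r; q) W(-\<kappa>; q)) + U(-\<kappa>; r)\<close>, valid for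
  \<open>-s0 < s < s0\<close> and sufficiently large \<open>\<bar>t1\<bar>\<close>, \<open>\<bar>t2\<bar>\<close>, with \<open>U\<close> analytic in \<open>s\<close> at \<open>-\<kappa> s0\<close>.
  All series converge absolutely. The neighbourhood of \<open>-\<kappa> s0\<close> does not depend on
  \<open>t1\<close>, \<open>t2\<close>, and \<open>U\<close> is jointly continuous there.
\<close>

definition continuation_coeffs ::
  "(nat \<Rightarrow> real) \<Rightarrow> (nat \<Rightarrow> real) \<Rightarrow> real \<Rightarrow> nat \<Rightarrow> nat \<Rightarrow> complex \<Rightarrow> real \<Rightarrow> nat \<Rightarrow> nat
    \<Rightarrow> (nat \<Rightarrow> nat \<Rightarrow> complex) \<Rightarrow> bool" where
  "continuation_coeffs D B L \<nu>1 \<nu>2 lam \<kappa> r1 r2 E \<longleftrightarrow>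
    (\<exists>(T :: real) (\<delta> :: real) (U :: complex \<Rightarrow> complex \<Rightarrow> complex \<Rightarrow> complex).
      \<delta> > 0 \<and>
      (\<forall>s t1 t2. - s0 B < s \<and> s < s0 B \<and> norm t1 > T \<and> norm t2 > T \<longrightarrow>
        W_term D B L \<nu>1 \<nu>2 lam \<kappa> r1 r2 s t1 t2 summable_on W_index \<and>
        (\<lambda>((q1, q2), i). E q1 q2 * W_term D B L \<nu>1 \<nu>2 lam (- \<kappa>) q1 q2 s t1 t2 i)
          summable_on (({r1..} \<times> {r2..}) \<times> W_index) \<and>
        W D B L \<nu>1 \<nu>2 lam \<kappa> r1 r2 s t1 t2 =
          (\<Sum>\<^sub>\<infinity>(q1, q2)\<in>{r1..} \<times> {r2..}. E q1 q2 * W D B L \<nu>1 \<nu>2 lam (- \<kappa>) q1 q2 s t1 t2)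
          + U (of_real s) t1 t2) \<and>
      (\<forall>t1 t2. norm t1 > T \<and> norm t2 > T \<longrightarrow>
        (\<lambda>s. U s t1 t2) holomorphic_on ball (of_real (- \<kappa> * s0 B)) \<delta>) \<and>
      continuous_on (ball (of_real (- \<kappa> * s0 B)) \<delta> \<times> {t. norm t > T} \<times> {t. norm t > T})
        (\<lambda>(s, t1, t2). U s t1 t2))"

text \<open>
  \<open>coeff_e\<close> takes the whole family \<open>E\<close>, with arguments \<open>\<sigma> r1 r2 q1 q2\<close>; its sign argument, like that
  of \<open>coeff_H\<close>, is the sign \<open>\<sigma> = -\<kappa>\<close> of the point reached by the continuation, so that
  \<open>\<kappa> = -\<sigma>\<close> in the formulas.
\<close>

definition coeff_e ::
  "(nat \<Rightarrow> real) \<Rightarrow> nat \<Rightarrow> nat \<Rightarrow> complex \<Rightarrow> (real \<Rightarrow> nat \<Rightarrow> nat \<Rightarrow> nat \<Rightarrow> nat \<Rightarrow> complex)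
    \<Rightarrow> real \<Rightarrow> nat \<Rightarrow> nat \<Rightarrow> complex" where
  "coeff_e B \<nu>1 \<nu>2 lam E \<sigma> q1 q2 = sin (of_real pi * mu B \<nu>1 \<nu>2 lam (- \<sigma>)) * E \<sigma> 0 0 q1 q2"

definition coeff_H ::
  "(nat \<Rightarrow> real) \<Rightarrow> (nat \<Rightarrow> real) \<Rightarrow> real \<Rightarrow> nat \<Rightarrow> nat \<Rightarrow> complex \<Rightarrow> real
    \<Rightarrow> nat \<Rightarrow> nat \<Rightarrow> nat \<Rightarrow> nat \<Rightarrow> nat \<Rightarrow> complex" where
  "coeff_H D B L \<nu>1 \<nu>2 lam \<sigma> k l1 l2 q1 q2 =
    (\<Sum>j = l1 + l2..k.
      pochhammer (mu B \<nu>1 \<nu>2 lam (- \<sigma>)) (k - j)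
      / (fact (k - j) * pochhammer (1 + mu B \<nu>1 \<nu>2 lam \<sigma> + phi q1 q2) j)
      * of_real ((2 * \<sigma> * s0 B) ^ j)
      * of_real (coeff_b D B L \<sigma> (int j) (int l1) (int l2)))"

text \<open>The sum in \<open>R\<^sub>q(m)\<close> without its error term.\<close>

definition R_sum ::
  "(nat \<Rightarrow> real) \<Rightarrow> (nat \<Rightarrow> real) \<Rightarrow> real \<Rightarrow> nat \<Rightarrow> nat \<Rightarrow> complex \<Rightarrow> real
    \<Rightarrow> nat \<Rightarrow> nat \<Rightarrow> nat \<Rightarrow> nat \<Rightarrow> nat \<Rightarrow> nat \<Rightarrow> complex" where
  "R_sum D B L \<nu>1 \<nu>2 lam \<kappa> n1 n2 K q1 q2 m =
    (\<Sum>k = 0..K. \<Sum>l1 = 0..min k (n1 - q1). \<Sum>l2 = 0..min k (n2 - q2).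
      pochhammer (1 + mu B \<nu>1 \<nu>2 lam (- \<kappa>) + phi q1 q2) k
      / pochhammer (1 + mu B \<nu>1 \<nu>2 lam (- \<kappa>) + phi q1 q2 - of_nat m) k
      * coeff_H D B L \<nu>1 \<nu>2 lam (- \<kappa>) k l1 l2 q1 q2
      * (of_real ((- 2 * \<kappa> * t10 B) ^ (n1 - q1 - l1)) / fact (n1 - q1 - l1))
      * (of_real ((- 2 * \<kappa> * t20 B) ^ (n2 - q2 - l2)) / fact (n2 - q2 - l2)))"

end

theory Submission
  imports Defs "HOL-Real_Asymp.Real_Asymp" "HOL-Library.Real_Mod"
begin

text \<open>
  Put $x = \frac12 - \frac{s}{2\kappa s_0}$ and write $\mu$, $\mu'$ for $\mu(\kappa)$, $\mu(-\kappa)$.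
  Comparing Laurent coefficients in $t_1 - \kappa t_{10}$ and $t_2 - \kappa t_{20}$ on both sides of the
  continuation formula shows that
  $\sum_m \Gamma(-\mu-m) b(\kappa;m,n_1,n_2) (-2\kappa s_0)^m x^m$ is, near $x = 1$, a sum of terms
  $(1-x)^{\mu'+\varphi(q)}$ times analytic functions, plus an analytic function. The leading parts of
  these functions predict the asymptotics of the coefficients.

  That no other contributions arise is Darboux's method. Instead of continuing the generating function
  around the rest of the unit circle, one uses the recurrence for $b$: the difference $h$ between the
  coefficients and a truncated prediction has a generating function that is smooth to high order as
  $x \to 1$. The recurrence operator maps $h$ to a combination of binomial sequences, and Abel's theorem
  forces these to decay fast. The recurrence then gives $h_m \sim C m^{-\mu'-\varphi(n)-1}$, and again by
  Abel's theorem $C = 0$, so $h$ decays fast.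
\<close>

section \<open>Binomial coefficients and sequences with a regular generating function\<close>

text \<open>The continuation formula describes the generating function only near x = 1, so other
  singularities on the unit circle cannot be excluded directly. The shape of the recurrence replaces
  that knowledge: its leading part is m^4 (h_m - h_(m-1)), and every solution with a small
  right-hand side is a multiple of one binomial sequence up to lower order, whatever its initial
  values. The exponent of that sequence is \<mu>' + \<phi>(n) because \<tau>(\<kappa>) +
  \<tau>(-\<kappa>) = 3.

  All exponents lie in \<mu>' + Z/3 and are not integers. Distinct ones have distinct real parts, so
  a finite combination of binomial sequences has a single dominant term, which Abel's theorem can
  test.

  Each use of the recurrence costs a number of powers of m that depends on the exponent. Decay is
  therefore claimed to every order, for all sufficiently long truncations. The factors
  (\<mu>+m)(\<mu>+m-1)(\<mu>+m-2) clear the Gamma quotients caused by shifts of m by up to 3; the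
  operators then have polynomial coefficients and map binomial combinations to binomial
  combinations.\<close>

definition bc :: "complex \<Rightarrow> nat \<Rightarrow> complex" where
  "bc \<alpha> m = pochhammer (- \<alpha>) m / fact m"

text \<open>On generating functions this is multiplication by z.\<close>

definition seq_shift :: "(nat \<Rightarrow> 'a::zero) \<Rightarrow> nat \<Rightarrow> 'a" where
  "seq_shift a m = (case m of 0 \<Rightarrow> 0 | Suc k \<Rightarrow> a k)"

lemma seq_shift_simps [simp]: "seq_shift a 0 = 0" "seq_shift a (Suc m) = a m"
  by (simp_all add: seq_shift_def)

lemma bc_0 [simp]: "bc \<alpha> 0 = 1"
  by (simp add: bc_def)

lemma bc_Suc: "bc \<alpha> (Suc m) = bc \<alpha> m * (of_nat m - \<alpha>) / of_nat (Suc m)"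
  by (simp add: bc_def pochhammer_Suc field_simps del: of_nat_Suc)

lemma bc_gbinomial: "bc \<alpha> m = (-1) ^ m * (\<alpha> gchoose m)"
proof -
  have "(-1) ^ m * ((-1) ^ m * pochhammer (- \<alpha>) m) = pochhammer (- \<alpha>) m"
    by (simp flip: power_mult_distrib mult.assoc)
  thus ?thesis
    by (simp add: bc_def gbinomial_pochhammer)
qed

lemma bc_sums: "norm z < 1 \<Longrightarrow> (\<lambda>m. bc \<alpha> m * z ^ m) sums (1 - z) powr \<alpha>"
  using gen_binomial_complex[of "- z" \<alpha>]
  by (simp add: bc_gbinomial power_minus[of z] mult_ac)

text \<open>Coefficient form of z d/dz (1-z)^\<alpha>, with the factor z written as 1 - (1-z).
  Together with the companion identity for z (1-z)^\<alpha>, it makes combinations of binomial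
  sequences whose exponents differ by integers stable under the operations of a recurrence.\<close>

lemma mult_bc: "of_nat m * bc \<alpha> m = \<alpha> * bc \<alpha> m - \<alpha> * bc (\<alpha> - 1) m"
proof (induction m)
  case (Suc m)
  have "of_nat (Suc m) * bc \<alpha> (Suc m) = bc \<alpha> m * (of_nat m - \<alpha>)"
    by (simp add: bc_Suc field_simps del: of_nat_Suc)
  moreover have "of_nat (Suc m) * (\<alpha> * bc \<alpha> (Suc m) - \<alpha> * bc (\<alpha> - 1) (Suc m))
      = \<alpha> * bc \<alpha> m * (of_nat m - \<alpha>) - \<alpha> * bc (\<alpha> - 1) m * (of_nat m - \<alpha> + 1)"
    by (simp add: bc_Suc field_simps del: of_nat_Suc)
  moreover have "\<dots> = of_nat (Suc m) * (bc \<alpha> m * (of_nat m - \<alpha>))"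
    using Suc by (simp add: algebra_simps) algebra
  ultimately show ?case
    by (metis mult_cancel_left of_nat_neq_0)
qed simp

lemma seq_shift_bc: "seq_shift (bc \<alpha>) m = bc \<alpha> m - bc (\<alpha> + 1) m"
proof (cases m)
  case (Suc k)
  have "of_nat (Suc k) * (bc \<alpha> (Suc k) - bc (\<alpha> + 1) (Suc k))
      = bc \<alpha> k * (of_nat k - \<alpha>) - bc (\<alpha> + 1) k * (of_nat k - (\<alpha> + 1))"
    unfolding right_diff_distrib bc_Suc by (simp del: of_nat_Suc)
  also have "\<dots> = of_nat (Suc k) * bc \<alpha> k"
    using mult_bc[of k "\<alpha> + 1"] by (simp add: algebra_simps)
  finally have "of_nat (Suc k) * (bc \<alpha> (Suc k) - bc (\<alpha> + 1) (Suc k)) = of_nat (Suc k) * bc \<alpha> k" .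
  thus ?thesis
    using Suc by (metis mult_cancel_left of_nat_neq_0 seq_shift_simps(2))
qed simp

lemma bc_nonzero:
  assumes "\<alpha> \<notin> \<int>"
  shows "bc \<alpha> m \<noteq> 0"
proof -
  have "\<alpha> \<noteq> of_nat k" for k
    using assms by auto
  thus ?thesis
    by (auto simp: bc_def pochhammer_eq_0_iff eq_neg_iff_add_eq_0)
qed

text \<open>With \<open>rGamma\<close> the limit is also correct for nonnegative integers \<alpha>,
  where the sequence is eventually zero.\<close>

lemma bc_asymp: "(\<lambda>m. bc \<alpha> m / of_nat m powr (- \<alpha> - 1)) \<longlonglongrightarrow> rGamma (- \<alpha>)"
proof (rule Lim_transform_eventually)
  show "(\<lambda>m. (\<alpha> gchoose m) / ((-1) ^ m / exp ((\<alpha> + 1) * of_real (ln (real m))))) \<longlonglongrightarrow> rGamma (- \<alpha>)"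
    using gbinomial_asymptotic[of \<alpha>] by (simp add: rGamma_inverse_Gamma)
  show "\<forall>\<^sub>F m in sequentially. (\<alpha> gchoose m) / ((-1) ^ m / exp ((\<alpha> + 1) * of_real (ln (real m))))
      = bc \<alpha> m / of_nat m powr (- \<alpha> - 1)"
    using eventually_gt_at_top[of 0]
  proof eventually_elim
    case (elim m)
    have *: "complex_of_nat m powr (- \<alpha> - 1) = inverse (exp ((\<alpha> + 1) * of_real (ln (real m))))"
      using elim Ln_of_real[of "real m"] by (simp add: powr_def exp_minus [symmetric] ring_distribs)
    show ?case
      unfolding bc_gbinomial * by (cases "even m") (simp_all add: divide_inverse)
  qed
qed

lemma rGamma_minus_nonzero: "\<alpha> \<notin> \<int> \<Longrightarrow> rGamma (- \<alpha> :: complex) \<noteq> 0"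
  by (auto simp: rGamma_eq_zero_iff elim!: nonpos_Ints_cases)
    (metis Ints_minus Ints_of_int add.inverse_inverse)
   
lemma bc_ratio_to_0:
  assumes "\<alpha> \<notin> \<int>" "\<beta> \<notin> \<int>" "Re \<alpha> < Re \<beta>"
  shows "(\<lambda>m. bc \<beta> m / bc \<alpha> m) \<longlonglongrightarrow> 0"
proof (rule Lim_transform_eventually)
  have "(\<lambda>m. complex_of_nat m powr (\<alpha> - \<beta>)) \<longlonglongrightarrow> 0"
  proof (rule tendsto_norm_zero_cancel, rule Lim_transform_eventually)
    show "(\<lambda>m. real m powr (Re \<alpha> - Re \<beta>)) \<longlonglongrightarrow> 0"
      using assms(3) by (intro tendsto_neg_powr filterlim_real_sequentially) auto
    show "\<forall>\<^sub>F m in sequentially. real m powr (Re \<alpha> - Re \<beta>) = norm (complex_of_nat m powr (\<alpha> - \<beta>))"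
      using eventually_gt_at_top[of 0] by eventually_elim (simp add: norm_powr_real_powr)
  qed
  hence "(\<lambda>m. (bc \<beta> m / of_nat m powr (- \<beta> - 1)) / (bc \<alpha> m / of_nat m powr (- \<alpha> - 1))
      * of_nat m powr (\<alpha> - \<beta>)) \<longlonglongrightarrow> rGamma (- \<beta>) / rGamma (- \<alpha>) * 0"
    using assms rGamma_minus_nonzero by (intro tendsto_intros bc_asymp) auto
  thus "(\<lambda>m. (bc \<beta> m / of_nat m powr (- \<beta> - 1)) / (bc \<alpha> m / of_nat m powr (- \<alpha> - 1))
      * of_nat m powr (\<alpha> - \<beta>)) \<longlonglongrightarrow> 0" by simp
  show "\<forall>\<^sub>F m in sequentially. (bc \<beta> m / of_nat m powr (- \<beta> - 1)) / (bc \<alpha> m / of_nat m powr (- \<alpha> - 1))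
      * of_nat m powr (\<alpha> - \<beta>) = bc \<beta> m / bc \<alpha> m"
    using eventually_gt_at_top[of 0]
  proof eventually_elim
    case (elim m)
    have "complex_of_nat m powr (- \<alpha> - 1) = of_nat m powr (- \<beta> - 1) * of_nat m powr (\<beta> - \<alpha>)"
      by (simp add: algebra_simps flip: powr_add)
    moreover have "complex_of_nat m powr (\<alpha> - \<beta>) * of_nat m powr (\<beta> - \<alpha>) = 1"
      using elim by (simp flip: powr_add)
    moreover have "complex_of_nat m powr (- \<beta> - 1) \<noteq> 0" using elim by simp
    ultimately show ?case using bc_nonzero[OF assms(1), of m]
      by (simp add: field_simps)
  qed
qed

lemma bc_bigo_powr: "(\<lambda>m. bc \<alpha> m) \<in> O(\<lambda>m. of_nat m powr (- \<alpha> - 1))"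
  by (rule bigoI_tendsto[OF bc_asymp]) (use eventually_gt_at_top[of 0] in \<open>eventually_elim, simp\<close>)

lemma powr_bigo_bc:
  assumes "\<alpha> \<notin> \<int>"
  shows "(\<lambda>m. of_nat m powr (- \<alpha> - 1)) \<in> O(bc \<alpha>)"
proof (rule bigoI_tendsto)
  show "(\<lambda>m. of_nat m powr (- \<alpha> - 1) / bc \<alpha> m) \<longlonglongrightarrow> inverse (rGamma (- \<alpha>))"
    using tendsto_inverse[OF bc_asymp rGamma_minus_nonzero[OF assms]] by simp
qed (use bc_nonzero[OF assms] in auto)


text \<open>
  The bound is required on discs around the points of the interval, not only on the interval itself, so that
  Cauchy's inequality turns it into a bound for the derivative.
\<close>

definition regular_upto :: "nat \<Rightarrow> (nat \<Rightarrow> complex) \<Rightarrow> bool" where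
  "regular_upto b a \<longleftrightarrow> (\<forall>z. norm z < 1 \<longrightarrow> summable (\<lambda>m. a m * z ^ m)) \<and>
     (\<exists>u \<delta> c C. 0 < \<delta> \<and> \<delta> \<le> 1 \<and> 0 < c \<and> c \<le> 1 \<and> u holomorphic_on ball 1 \<delta> \<and>
       (\<forall>x z. 1 - \<delta> / 2 < x \<and> x < 1 \<and> norm (z - of_real x) < c * (1 - x) \<longrightarrow>
          norm ((\<Sum>m. a m * z ^ m) - u z) \<le> C * (1 - x) ^ b))"

lemma regular_uptoD_summable: "regular_upto b a \<Longrightarrow> norm z < 1 \<Longrightarrow> summable (\<lambda>m. a m * z ^ m)"
  by (simp add: regular_upto_def)

lemma regular_uptoI:
  assumes "\<And>z. norm z < 1 \<Longrightarrow> summable (\<lambda>m. a m * z ^ m)"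
    and "0 < \<delta>" "\<delta> \<le> 1" "0 < c" "c \<le> 1" "u holomorphic_on ball 1 \<delta>"
    and "\<And>x z. 1 - \<delta> / 2 < x \<Longrightarrow> x < 1 \<Longrightarrow> norm (z - of_real x) < c * (1 - x) \<Longrightarrow>
          norm ((\<Sum>m. a m * z ^ m) - u z) \<le> C * (1 - x) ^ b"
  shows "regular_upto b a"
proof -
  have "\<forall>x z. 1 - \<delta> / 2 < x \<and> x < 1 \<and> norm (z - of_real x) < c * (1 - x) \<longrightarrow>
          norm ((\<Sum>m. a m * z ^ m) - u z) \<le> C * (1 - x) ^ b"
    using assms(7) by simp
  hence "\<exists>C. \<forall>x z. 1 - \<delta> / 2 < x \<and> x < 1 \<and> norm (z - of_real x) < c * (1 - x) \<longrightarrow>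
          norm ((\<Sum>m. a m * z ^ m) - u z) \<le> C * (1 - x) ^ b"
    by (rule exI)
  with assms(2-6) have "\<exists>u \<delta> c C. 0 < \<delta> \<and> \<delta> \<le> 1 \<and> 0 < c \<and> c \<le> 1 \<and> u holomorphic_on ball 1 \<delta> \<and>
      (\<forall>x z. 1 - \<delta> / 2 < x \<and> x < 1 \<and> norm (z - of_real x) < c * (1 - x) \<longrightarrow>
          norm ((\<Sum>m. a m * z ^ m) - u z) \<le> C * (1 - x) ^ b)"
    by blast
  thus ?thesis unfolding regular_upto_def using assms(1) by simp
qed

lemma regular_uptoE:
  assumes "regular_upto b a"
  obtains u \<delta> c C where "0 < \<delta>" "\<delta> \<le> 1" "0 < c" "c \<le> 1" "u holomorphic_on ball 1 \<delta>" "0 \<le> C"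
    "\<And>x z. 1 - \<delta> / 2 < x \<Longrightarrow> x < 1 \<Longrightarrow> norm (z - of_real x) < c * (1 - x) \<Longrightarrow>
          norm ((\<Sum>m. a m * z ^ m) - u z) \<le> C * (1 - x) ^ b"
proof -
  obtain u \<delta> c C where *: "0 < \<delta>" "\<delta> \<le> 1" "0 < c" "c \<le> 1" "u holomorphic_on ball 1 \<delta>"
    "\<And>x z. 1 - \<delta> / 2 < x \<Longrightarrow> x < 1 \<Longrightarrow> norm (z - of_real x) < c * (1 - x) \<Longrightarrow>
          norm ((\<Sum>m. a m * z ^ m) - u z) \<le> C * (1 - x) ^ b"
    using assms unfolding regular_upto_def by blast
  have "norm ((\<Sum>m. a m * z ^ m) - u z) \<le> \<bar>C\<bar> * (1 - x) ^ b"
    if "1 - \<delta> / 2 < x" "x < 1" "norm (z - of_real x) < c * (1 - x)" for x z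
    using *(6)[OF that] that by (meson abs_ge_self diff_ge_0_iff_ge less_eq_real_def mult_right_mono order_trans zero_le_power)
  thus ?thesis using that[of \<delta> c u "\<bar>C\<bar>"] * by auto
qed

text \<open>The radius is at most the distance from x to 1, so every disc of the cone stays inside
  the unit disc and close to 1. The last bound turns estimates in powers of 1 - z into estimates in
  powers of 1 - x.\<close>

lemma cone_bounds:
  fixes x \<delta> c :: real and z :: complex
  assumes "\<delta> \<le> 1" "c \<le> 1" "1 - \<delta> / 2 < x" "x < 1" "norm (z - of_real x) < c * (1 - x)"
  shows "norm z < 1" "norm (z - 1) < \<delta>" "norm (1 - z) < \<delta>" "norm (1 - z) \<le> 2 * (1 - x)"
proof -
  have c: "c * (1 - x) \<le> 1 - x" using assms by (simp add: mult_left_le_one_le)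
  have "norm z \<le> norm (z - of_real x) + norm (of_real x :: complex)"
    by (metis add.commute norm_triangle_sub)
  also have "\<dots> < (1 - x) + x"
  proof -
    have "0 < x" using assms by linarith
    hence "norm (of_real x :: complex) = x" by simp
    thus ?thesis using c assms(5) by linarith
  qed
  finally show "norm z < 1" by simp
  have "norm (z - 1) \<le> norm (z - of_real x) + norm (of_real x - 1 :: complex)"
    by (metis diff_add_cancel diff_diff_eq2 norm_triangle_ineq add_diff_eq)
  also have "norm (of_real x - 1 :: complex) = 1 - x"
    using assms by (metis abs_minus_commute abs_of_pos diff_gt_0_iff_gt norm_of_real of_real_1 of_real_diff)
  finally have *: "norm (z - 1) \<le> norm (z - of_real x) + (1 - x)" .
  thus "norm (z - 1) < \<delta>" using c assms by linarith
  thus "norm (1 - z) < \<delta>" by (simp add: norm_minus_commute)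
  have "norm (z - 1) \<le> (1 - x) + (1 - x)"
    using assms(5) c by (intro order_trans[OF *] add_mono) auto
  hence "norm (z - 1) \<le> 2 * (1 - x)" by (simp only: mult_2)
  thus "norm (1 - z) \<le> 2 * (1 - x)" by (simp only: norm_minus_commute)
qed

text \<open>An entire multiplier is bounded on the closed unit disc, so multiplying the generating
  function and its holomorphic approximation by it only changes the constant. Scaling and index
  shifts are the multipliers k and z.\<close>

lemma regular_upto_lift:
  assumes a: "regular_upto b a"
    and summ: "\<And>z. norm z < 1 \<Longrightarrow> summable (\<lambda>m. a' m * z ^ m)"
    and eq: "\<And>z. norm z < 1 \<Longrightarrow> (\<Sum>m. a' m * z ^ m) = v z * (\<Sum>m. a m * z ^ m)"
    and v: "v holomorphic_on UNIV"
  shows "regular_upto b a'"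
proof -
  obtain u \<delta> c C where *: "0 < \<delta>" "\<delta> \<le> 1" "0 < c" "c \<le> 1" "u holomorphic_on ball 1 \<delta>" "0 \<le> C"
    "\<And>x z. 1 - \<delta> / 2 < x \<Longrightarrow> x < 1 \<Longrightarrow> norm (z - of_real x) < c * (1 - x) \<Longrightarrow>
          norm ((\<Sum>m. a m * z ^ m) - u z) \<le> C * (1 - x) ^ b"
    by (rule regular_uptoE[OF a]) (rule that)
  have "compact (v ` cball 0 1)"
    by (intro compact_continuous_image holomorphic_on_imp_continuous_on[OF holomorphic_on_subset[OF v]]) auto
  then obtain V where V: "\<And>z. norm z \<le> 1 \<Longrightarrow> norm (v z) \<le> V"
    by (metis bounded_iff compact_imp_bounded image_eqI mem_cball_0)
  have hol: "(\<lambda>z. v z * u z) holomorphic_on ball 1 \<delta>"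
    using *(5) v by (intro holomorphic_intros) (auto intro: holomorphic_on_subset)
  have "norm ((\<Sum>m. a' m * z ^ m) - v z * u z) \<le> (V * C) * (1 - x) ^ b"
    if x: "1 - \<delta> / 2 < x" "x < 1" "norm (z - of_real x) < c * (1 - x)" for x z
  proof -
    have z: "norm z < 1" using cone_bounds[OF *(2,4) x] by simp
    have "(\<Sum>m. a' m * z ^ m) - v z * u z = v z * ((\<Sum>m. a m * z ^ m) - u z)"
      by (simp add: eq[OF z] algebra_simps)
    also have "norm \<dots> \<le> V * (C * (1 - x) ^ b)"
      unfolding norm_mult using *(7)[OF x] V[of z] z norm_ge_zero[of "v z"]
      by (intro mult_mono) (auto intro: order_trans[OF norm_ge_zero])
    finally show ?thesis by (simp add: mult_ac)
  qed
  thus ?thesis unfolding regular_upto_def using summ hol *(1-4) by blast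
qed

lemma regular_upto_scale: "regular_upto b a \<Longrightarrow> regular_upto b (\<lambda>m. k * a m)"
  by (rule regular_upto_lift[where v = "\<lambda>_. k"])
     (auto simp: mult.assoc suminf_mult regular_uptoD_summable intro!: summable_mult)

lemma regular_upto_zero: "regular_upto b (\<lambda>_. 0)"
  unfolding regular_upto_def
  by (intro conjI allI impI exI[of _ "\<lambda>_. 0"] exI[of _ "1::real"] exI[of _ "0::real"]) auto

lemma regular_upto_shift:
  assumes "regular_upto b a" shows "regular_upto b (seq_shift a)"
proof (rule regular_upto_lift[OF assms, where v = "\<lambda>z. z"])
  fix z :: complex assume z: "norm z < 1"
  have "(\<lambda>m. a m * z ^ m) sums (\<Sum>m. a m * z ^ m)"
    using regular_uptoD_summable[OF assms z] by blast
  hence "(\<lambda>m. z * (a m * z ^ m)) sums (z * (\<Sum>m. a m * z ^ m))"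
    by (rule sums_mult)
  hence "(\<lambda>m. seq_shift a (Suc m) * z ^ Suc m) sums (z * (\<Sum>m. a m * z ^ m))"
    by (simp add: mult_ac)
  hence "(\<lambda>m. seq_shift a m * z ^ m) sums (z * (\<Sum>m. a m * z ^ m))"
    by (subst (asm) sums_Suc_iff) simp
  thus "summable (\<lambda>m. seq_shift a m * z ^ m)"
    "(\<Sum>m. seq_shift a m * z ^ m) = z * (\<Sum>m. a m * z ^ m)"
    by (simp_all add: sums_iff)
qed auto

lemma regular_upto_add:
  assumes a: "regular_upto b a1" and b: "regular_upto b a2"
  shows "regular_upto b (\<lambda>m. a1 m + a2 m)"
proof -
  obtain u \<delta> c C where 1: "0 < \<delta>" "\<delta> \<le> 1" "0 < c" "c \<le> 1" "u holomorphic_on ball 1 \<delta>" "0 \<le> C"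
    "\<And>x z. 1 - \<delta> / 2 < x \<Longrightarrow> x < 1 \<Longrightarrow> norm (z - of_real x) < c * (1 - x) \<Longrightarrow>
          norm ((\<Sum>m. a1 m * z ^ m) - u z) \<le> C * (1 - x) ^ b"
    by (rule regular_uptoE[OF a]) (rule that)
  obtain u' \<delta>' c' C' where 2: "0 < \<delta>'" "\<delta>' \<le> 1" "0 < c'" "c' \<le> 1" "u' holomorphic_on ball 1 \<delta>'" "0 \<le> C'"
    "\<And>x z. 1 - \<delta>' / 2 < x \<Longrightarrow> x < 1 \<Longrightarrow> norm (z - of_real x) < c' * (1 - x) \<Longrightarrow>
          norm ((\<Sum>m. a2 m * z ^ m) - u' z) \<le> C' * (1 - x) ^ b"
    by (rule regular_uptoE[OF b]) (rule that)
  define d where "d = min \<delta> \<delta>'"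
  define e where "e = min c c'"
  have hol: "(\<lambda>z. u z + u' z) holomorphic_on ball 1 d"
    using 1(5) 2(5) by (intro holomorphic_intros) (auto intro: holomorphic_on_subset simp: d_def)
  have "norm ((\<Sum>m. (a1 m + a2 m) * z ^ m) - (u z + u' z)) \<le> (C + C') * (1 - x) ^ b"
    if x: "1 - d / 2 < x" "x < 1" "norm (z - of_real x) < e * (1 - x)" for x z
  proof -
    have x1: "1 - \<delta> / 2 < x" "norm (z - of_real x) < c * (1 - x)"
      and x2: "1 - \<delta>' / 2 < x" "norm (z - of_real x) < c' * (1 - x)"
      using x order_less_le_trans[OF x(3) mult_right_mono[of e c "1 - x"]]
        order_less_le_trans[OF x(3) mult_right_mono[of e c' "1 - x"]]
      by (simp_all add: d_def e_def)
    have z: "norm z < 1" using cone_bounds[OF 1(2,4) x1(1) x(2) x1(2)] by simp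
    have "(\<Sum>m. (a1 m + a2 m) * z ^ m) = (\<Sum>m. a1 m * z ^ m) + (\<Sum>m. a2 m * z ^ m)"
      using suminf_add[OF regular_uptoD_summable[OF a z] regular_uptoD_summable[OF b z]]
      by (simp add: algebra_simps)
    hence "(\<Sum>m. (a1 m + a2 m) * z ^ m) - (u z + u' z)
        = ((\<Sum>m. a1 m * z ^ m) - u z) + ((\<Sum>m. a2 m * z ^ m) - u' z)" by simp
    also have "norm \<dots> \<le> C * (1 - x) ^ b + C' * (1 - x) ^ b"
      by (intro norm_triangle_mono 1(7) 2(7) x x1 x2)
    finally show ?thesis by (simp add: algebra_simps)
  qed
  moreover have "summable (\<lambda>m. (a1 m + a2 m) * z ^ m)" if "norm z < 1" for z
    using summable_add[OF regular_uptoD_summable[OF a that] regular_uptoD_summable[OF b that]]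
    by (simp add: algebra_simps)
  moreover have "0 < d" "d \<le> 1" "0 < e" "e \<le> 1" using 1 2 by (auto simp: d_def e_def)
  ultimately show ?thesis unfolding regular_upto_def using hol by blast
qed

lemma regular_upto_mono:
  assumes "regular_upto b a" "b' \<le> b" shows "regular_upto b' a"
proof -
  obtain u \<delta> c C where *: "0 < \<delta>" "\<delta> \<le> 1" "0 < c" "c \<le> 1" "u holomorphic_on ball 1 \<delta>" "0 \<le> C"
    "\<And>x z. 1 - \<delta> / 2 < x \<Longrightarrow> x < 1 \<Longrightarrow> norm (z - of_real x) < c * (1 - x) \<Longrightarrow>
          norm ((\<Sum>m. a m * z ^ m) - u z) \<le> C * (1 - x) ^ b"
    by (rule regular_uptoE[OF assms(1)]) (rule that)
  have "norm ((\<Sum>m. a m * z ^ m) - u z) \<le> C * (1 - x) ^ b'"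
    if x: "1 - \<delta> / 2 < x" "x < 1" "norm (z - of_real x) < c * (1 - x)" for x z
    using *(7)[OF x] mult_left_mono[OF power_decreasing[OF assms(2), of "1 - x"] *(6)] x * by force
  thus ?thesis unfolding regular_upto_def using regular_uptoD_summable[OF assms(1)] *(1-5) by blast
qed

section \<open>The Euler operator on generating functions\<close>

lemma powser_euler:
  fixes a :: "nat \<Rightarrow> complex"
  assumes "\<And>z. norm z < 1 \<Longrightarrow> summable (\<lambda>m. a m * z ^ m)"
  shows "norm z < 1 \<Longrightarrow> ((\<lambda>z. \<Sum>m. a m * z ^ m) has_field_derivative (\<Sum>m. diffs a m * z ^ m)) (at z)"
    and "norm z < 1 \<Longrightarrow> (\<lambda>m. of_nat m * a m * z ^ m) sums (z * deriv (\<lambda>z. \<Sum>m. a m * z ^ m) z)"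
proof -
  show der: "((\<lambda>z. \<Sum>m. a m * z ^ m) has_field_derivative (\<Sum>m. diffs a m * z ^ m)) (at z)"
    if "norm z < 1" for z
    using termdiffs_strong'[of 1 a z] assms that by auto
  assume z: "norm z < 1"
  have "summable (\<lambda>m. diffs a m * z ^ m)"
    by (rule termdiff_converges[of _ 1]) (use assms z in auto)
  hence "(\<lambda>m. z * (diffs a m * z ^ m)) sums (z * (\<Sum>m. diffs a m * z ^ m))"
    by (intro sums_mult summable_sums)
  hence "(\<lambda>m. of_nat (Suc m) * a (Suc m) * z ^ Suc m) sums (z * (\<Sum>m. diffs a m * z ^ m))"
    by (simp add: diffs_def mult_ac)
  hence "(\<lambda>m. of_nat m * a m * z ^ m) sums (z * (\<Sum>m. diffs a m * z ^ m))"
    by (subst (asm) sums_Suc_iff) simp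
  thus "(\<lambda>m. of_nat m * a m * z ^ m) sums (z * deriv (\<lambda>z. \<Sum>m. a m * z ^ m) z)"
    using DERIV_imp_deriv[OF der[OF z]] by simp
qed

text \<open>Multiplication by the index is z d/dz on the generating function. Cauchy's inequality
  for the difference to the holomorphic part, on a disc of radius proportional to 1 - x, costs one
  power of 1 - x and half of the aperture of the cone.\<close>

lemma regular_upto_mult_index:
  assumes "regular_upto (Suc b) a"
  shows "regular_upto b (\<lambda>m. of_nat m * a m)"
proof -
  obtain u \<delta> c C where *: "0 < \<delta>" "\<delta> \<le> 1" "0 < c" "c \<le> 1" "u holomorphic_on ball 1 \<delta>" "0 \<le> C"
    "\<And>x z. 1 - \<delta> / 2 < x \<Longrightarrow> x < 1 \<Longrightarrow> norm (z - of_real x) < c * (1 - x) \<Longrightarrow>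
          norm ((\<Sum>m. a m * z ^ m) - u z) \<le> C * (1 - x) ^ Suc b"
    by (rule regular_uptoE[OF assms(1)]) (rule that)
  note eul = powser_euler[OF regular_uptoD_summable[OF assms]]
  let ?f = "\<lambda>z. \<Sum>m. a m * z ^ m"
  have fhol: "?f holomorphic_on ball 0 1"
    by (rule holomorphic_onI)
      (use eul(1) field_differentiable_at_within field_differentiable_def in \<open>fastforce\<close>)
  have hol: "(\<lambda>z. z * deriv u z) holomorphic_on ball 1 \<delta>"
    using *(5) by (intro holomorphic_intros) auto
  have bound: "norm ((\<Sum>m. of_nat m * a m * z ^ m) - z * deriv u z) \<le> (4 * C / c) * (1 - x) ^ b"
    if x: "1 - \<delta> / 2 < x" "x < 1" "norm (z - of_real x) < c / 2 * (1 - x)" for x z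
  proof -
    \<comment> \<open>A quarter of the aperture added to half of it stays below the full aperture,
      so the whole closed disc lies where the hypothesis applies.\<close>
    define r where "r = c / 4 * (1 - x)"
    have r: "r > 0" using * x by (simp add: r_def)
    have in_cone: "norm (w - of_real x) < c * (1 - x)" if "norm (w - z) \<le> r" for w
    proof -
      have "norm (w - of_real x) \<le> norm (w - z) + norm (z - of_real x)"
        by (metis diff_add_cancel diff_add_eq norm_triangle_ineq add_diff_eq)
      also have "\<dots> < c * (1 - x)"
      proof -
        have "c * (1 - x) > 0" using x *(3) by simp
        thus ?thesis using that x(3) unfolding r_def by (simp add: mult.commute)
      qed
      finally show ?thesis .
    qed
    have sub: "cball z r \<subseteq> ball 0 1 \<inter> ball 1 \<delta>"
    proof
      fix w assume "w \<in> cball z r"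
      hence "norm (w - of_real x) < c * (1 - x)"
        by (intro in_cone) (simp add: dist_norm norm_minus_commute)
      from cone_bounds[OF *(2,4) x(1,2) this] show "w \<in> ball 0 1 \<inter> ball 1 \<delta>"
        by (simp add: dist_norm norm_minus_commute)
    qed
    have zin: "z \<in> ball 0 1" "z \<in> ball 1 \<delta>" using sub r by (auto dest!: subsetD[where c = z])
    have holE: "(\<lambda>w. ?f w - u w) holomorphic_on cball z r"
      by (intro holomorphic_on_diff holomorphic_on_subset[OF fhol] holomorphic_on_subset[OF *(5)])
        (use sub in auto)
    have "norm ((deriv ^^ 1) (\<lambda>w. ?f w - u w) z) \<le> fact 1 * (C * (1 - x) ^ Suc b) / r ^ 1"
    proof (rule Cauchy_inequality)
      show "(\<lambda>w. ?f w - u w) holomorphic_on ball z r"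
        by (rule holomorphic_on_subset[OF holE]) auto
      show "continuous_on (cball z r) (\<lambda>w. ?f w - u w)"
        by (rule holomorphic_on_imp_continuous_on[OF holE])
      show "norm (?f w - u w) \<le> C * (1 - x) ^ Suc b" if "norm (z - w) = r" for w
        by (intro *(7) x in_cone) (use that in \<open>simp add: norm_minus_commute\<close>)
    qed (use r in auto)
    also have "fact 1 * (C * (1 - x) ^ Suc b) / r ^ 1 = (4 * C / c) * (1 - x) ^ b"
      using * x by (simp add: r_def field_simps)
    finally have 1: "norm (deriv (\<lambda>w. ?f w - u w) z) \<le> (4 * C / c) * (1 - x) ^ b" by simp
    have 2: "deriv (\<lambda>w. ?f w - u w) z = deriv ?f z - deriv u z"
      by (rule deriv_diff) (use fhol *(5) zin holomorphic_on_imp_differentiable_at in auto)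
    have "(\<Sum>m. of_nat m * a m * z ^ m) - z * deriv u z = z * deriv (\<lambda>w. ?f w - u w) z"
      using eul(2)[of z] zin by (simp add: sums_iff 2 algebra_simps)
    also have "norm \<dots> \<le> 1 * ((4 * C / c) * (1 - x) ^ b)"
      unfolding norm_mult by (intro mult_mono 1) (use zin in auto)
    finally show ?thesis by simp
  qed
  show ?thesis
    unfolding regular_upto_def
    using hol bound *(1-4) sums_summable[OF eul(2)]
    by (intro conjI allI impI exI[of _ "\<lambda>z. z * deriv u z"] exI[of _ \<delta>] exI[of _ "c / 2"] exI[of _ "4 * C / c"])
      auto
qed

text \<open>As x tends to 1, the part C (1-x)^\<alpha> of the generating function has the unbounded
  size |C| (1-x)^(Re \<alpha>). The rest of the series has at most half this size up to a constant,
  so it cannot compensate.\<close>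

lemma abelian_leading_coeff_0:
  fixes a :: "nat \<Rightarrow> complex" and x0 B :: real
  assumes summ: "\<And>z. norm z < 1 \<Longrightarrow> summable (\<lambda>m. a m * z ^ m)"
    and bounded: "\<And>x. x0 < x \<Longrightarrow> x < 1 \<Longrightarrow> norm (\<Sum>m. a m * of_real x ^ m) \<le> B"
    and x0: "0 \<le> x0" "x0 < 1"
    and lim: "(\<lambda>m. a m / bc \<alpha> m) \<longlonglongrightarrow> C"
    and \<alpha>: "\<alpha> \<notin> \<int>" "Re \<alpha> < 0"
  shows "C = 0"
proof (rule ccontr)
  assume C: "C \<noteq> 0"
  \<comment> \<open>The binomial sequence of the real exponent Re \<alpha> < 0 is positive, bounds
    that of \<alpha> up to a constant factor for large m, and sums to (1-x)^(Re \<alpha>). It serves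
    as majorant.\<close>
  define d where "d = (\<lambda>m. pochhammer (- Re \<alpha>) m / fact m)"
  have d_bc: "of_real (d m) = bc (of_real (Re \<alpha>)) m" for m
    by (simp add: d_def bc_def pochhammer_of_real flip: of_real_minus)
  have d_pos: "d m > 0" for m
    using \<alpha> by (auto simp: d_def intro!: divide_pos_pos pochhammer_pos)
  have d_sums: "(\<lambda>m. d m * x ^ m) sums ((1 - x) powr Re \<alpha>)" if "0 \<le> x" "x < 1" for x
  proof -
    have "(\<lambda>m. complex_of_real (d m * x ^ m)) sums of_real ((1 - x) powr Re \<alpha>)"
      using bc_sums[of "of_real x" "of_real (Re \<alpha>)"] that
        powr_of_real[of "1 - x" "Re \<alpha>"] by (simp add: d_bc)
    thus ?thesis by (simp only: sums_of_real_iff)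
  qed
  obtain K where K: "K > 0" "\<forall>\<^sub>F m in sequentially. norm (bc \<alpha> m) \<le> K * d m"
  proof -
    have "(\<lambda>m. (bc \<alpha> m / of_nat m powr (- \<alpha> - 1))
        / (bc (of_real (Re \<alpha>)) m / of_nat m powr (- of_real (Re \<alpha>) - 1)))
        \<longlonglongrightarrow> rGamma (- \<alpha>) / rGamma (- of_real (Re \<alpha>))"
    proof (intro tendsto_divide bc_asymp)
      show "rGamma (- complex_of_real (Re \<alpha>)) \<noteq> 0"
      proof
        assume "rGamma (- complex_of_real (Re \<alpha>)) = 0"
        then obtain k where "k \<le> 0" "- complex_of_real (Re \<alpha>) = of_int k"
          by (auto simp: rGamma_eq_zero_iff elim!: nonpos_Ints_cases)
        hence "- Re \<alpha> = of_int k" by (metis Re_complex_of_real uminus_complex.sel(1) of_real_of_int_eq)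
        thus False using \<alpha>(2) \<open>k \<le> 0\<close> by (smt (verit) of_int_le_0_iff)
      qed
    qed
    hence "Bseq (\<lambda>m. (bc \<alpha> m / of_nat m powr (- \<alpha> - 1))
        / (bc (of_real (Re \<alpha>)) m / of_nat m powr (- of_real (Re \<alpha>) - 1)))"
      using convergent_def convergent_imp_Bseq by blast
    then obtain K where K: "K > 0" "\<And>m. norm ((bc \<alpha> m / of_nat m powr (- \<alpha> - 1))
        / (bc (of_real (Re \<alpha>)) m / of_nat m powr (- of_real (Re \<alpha>) - 1))) \<le> K"
      unfolding Bseq_def by blast
    have "\<forall>\<^sub>F m in sequentially. norm (bc \<alpha> m) \<le> K * d m"
      using eventually_gt_at_top[of 0]
    proof eventually_elim
      case (elim m)
      have "norm (complex_of_nat m powr (- \<alpha> - 1)) = norm (complex_of_nat m powr (- of_real (Re \<alpha>) - 1))"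
        "norm (complex_of_nat m powr (- \<alpha> - 1)) > 0"
        using elim by (simp_all add: norm_powr_real_powr)
      moreover have "norm (bc (of_real (Re \<alpha>)) m) = d m"
        using d_pos[of m] by (simp flip: d_bc)
      ultimately show ?case
        using K(2)[of m] d_pos[of m] by (simp add: norm_divide norm_mult field_simps)
    qed
    thus ?thesis by (rule that[OF K(1)])
  qed
  \<comment> \<open>Chosen so that \<epsilon> times the constant K of the majorant is half of
    |C|.\<close>
  define \<epsilon> where "\<epsilon> = norm C / (2 * K)"
  have \<epsilon>: "\<epsilon> > 0" using C K by (simp add: \<epsilon>_def)
  have "\<forall>\<^sub>F m in sequentially. norm (a m / bc \<alpha> m - C) < \<epsilon>"
    using tendstoD[OF lim \<epsilon>] by (simp add: dist_norm)
  hence "\<forall>\<^sub>F m in sequentially. norm (a m - C * bc \<alpha> m) \<le> norm C / 2 * d m"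
    using K(2)
  proof eventually_elim
    case (elim m)
    have "a m - C * bc \<alpha> m = (a m / bc \<alpha> m - C) * bc \<alpha> m"
      using bc_nonzero[OF \<alpha>(1), of m] by (simp add: field_simps)
    hence "norm (a m - C * bc \<alpha> m) = norm (a m / bc \<alpha> m - C) * norm (bc \<alpha> m)"
      by (simp add: norm_mult)
    also have "\<dots> \<le> \<epsilon> * (K * d m)"
      using elim \<epsilon> by (intro mult_mono) auto
    finally show ?case using K by (simp add: \<epsilon>_def)
  qed
  then obtain N where N: "\<And>m. m \<ge> N \<Longrightarrow> norm (a m - C * bc \<alpha> m) \<le> norm C / 2 * d m"
    by (auto simp: eventually_at_top_linorder)
  define S where "S = (\<Sum>m<N. norm (a m - C * bc \<alpha> m))"
  have key: "norm C / 2 * (1 - x) powr Re \<alpha> \<le> B + S" if x: "x0 < x" "x < 1" for x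
  proof -
    have x': "0 \<le> x" "norm (of_real x :: complex) < 1" using x x0 by auto
    have e: "(\<lambda>m. (a m - C * bc \<alpha> m) * of_real x ^ m) sums
        ((\<Sum>m. a m * of_real x ^ m) - C * (1 - of_real x) powr \<alpha>)"
      using sums_diff[OF summable_sums[OF summ[OF x'(2)]] sums_mult[OF bc_sums[OF x'(2)], of C]]
      by (simp add: algebra_simps)
    have f: "(\<lambda>m. (if m \<in> {..<N} then norm (a m - C * bc \<alpha> m) else 0) + norm C / 2 * (d m * x ^ m))
        sums (S + norm C / 2 * (1 - x) powr Re \<alpha>)"
      unfolding S_def by (intro sums_add sums_mult d_sums sums_If_finite_set) (use x x' in auto)
    have "norm ((\<Sum>m. a m * of_real x ^ m) - C * (1 - of_real x) powr \<alpha>)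
        = norm (\<Sum>m. (a m - C * bc \<alpha> m) * of_real x ^ m)"
      using e by (simp add: sums_iff)
    also have "\<dots> \<le> S + norm C / 2 * (1 - x) powr Re \<alpha>"
    proof (rule order_trans[OF norm_suminf_le[where g = "\<lambda>m.
        (if m \<in> {..<N} then norm (a m - C * bc \<alpha> m) else 0) + norm C / 2 * (d m * x ^ m)"]])
      show "norm ((a m - C * bc \<alpha> m) * of_real x ^ m) \<le>
        (if m \<in> {..<N} then norm (a m - C * bc \<alpha> m) else 0) + norm C / 2 * (d m * x ^ m)" for m
      proof (cases "m < N")
        case True
        have "norm ((a m - C * bc \<alpha> m) * of_real x ^ m) \<le> norm (a m - C * bc \<alpha> m) * 1"
          unfolding norm_mult using x x' by (intro mult_left_mono) (auto simp: norm_power power_le_one)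
        moreover have "0 \<le> norm C / 2 * (d m * x ^ m)" using d_pos[of m] x' by auto
        ultimately show ?thesis using True by simp
      next
        case False
        have "norm ((a m - C * bc \<alpha> m) * of_real x ^ m) \<le> (norm C / 2 * d m) * x ^ m"
          unfolding norm_mult using x x' False less_imp_le[OF d_pos[of m]]
          by (intro mult_mono N) (auto simp: norm_power)
        thus ?thesis using False by (simp add: mult_ac)
      qed
    qed (use f in \<open>simp_all add: sums_iff\<close>)
    finally have "norm ((\<Sum>m. a m * of_real x ^ m) - C * (1 - of_real x) powr \<alpha>)
        \<le> S + norm C / 2 * (1 - x) powr Re \<alpha>" .
    moreover have "norm (C * (1 - of_real x) powr \<alpha>) = norm C * (1 - x) powr Re \<alpha>"
      using x norm_powr_real_powr[of "complex_of_real (1 - x)" \<alpha>] by (simp add: norm_mult)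
    moreover have "norm (C * (1 - of_real x) powr \<alpha>) \<le> norm (\<Sum>m. a m * of_real x ^ m)
        + norm ((\<Sum>m. a m * of_real x ^ m) - C * (1 - of_real x) powr \<alpha>)"
      using norm_triangle_sub[of "C * (1 - of_real x) powr \<alpha>" "\<Sum>m. a m * of_real x ^ m"]
      by (simp only: norm_minus_commute)
    ultimately show ?thesis using bounded[OF x] by linarith
  qed
  have "filterlim (\<lambda>x::real. (1 - x) powr Re \<alpha>) at_top (at_left 1)"
    using \<alpha>(2) by real_asymp
  hence "filterlim (\<lambda>x::real. norm C / 2 * (1 - x) powr Re \<alpha>) at_top (at_left 1)"
    using C by (intro filterlim_tendsto_pos_mult_at_top[OF tendsto_const]) auto
  hence "\<forall>\<^sub>F x in at_left 1. norm C / 2 * (1 - x) powr Re \<alpha> > B + S"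
    unfolding filterlim_at_top_dense by blast
  moreover have "\<forall>\<^sub>F x in at_left 1. x \<in> {x0<..<1}"
    by (rule eventually_at_left_real[OF x0(2)])
  ultimately have "\<forall>\<^sub>F x in at_left (1::real). False"
  proof eventually_elim
    case (elim x)
    thus ?case using key[of x] by simp
  qed
  thus False by simp
qed

text \<open>Multiplying the sequence by the index lowers \<alpha> and b together by one and
  multiplies the limit by the nonzero number -\<alpha>. At b = 0 the exponent has negative real part
  while the generating function is bounded near 1.\<close>

lemma regular_upto_leading_coeff_0:
  assumes "regular_upto b a" "(\<lambda>m. a m / bc \<alpha> m) \<longlonglongrightarrow> C" "\<alpha> \<notin> \<int>" "Re \<alpha> < real b"
  shows "C = 0"
  using assms
proof (induction b arbitrary: a \<alpha> C)
  case 0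
  obtain u \<delta> c K where *: "0 < \<delta>" "\<delta> \<le> 1" "0 < c" "c \<le> 1" "u holomorphic_on ball 1 \<delta>" "0 \<le> K"
    "\<And>x z. 1 - \<delta> / 2 < x \<Longrightarrow> x < 1 \<Longrightarrow> norm (z - of_real x) < c * (1 - x) \<Longrightarrow>
          norm ((\<Sum>m. a m * z ^ m) - u z) \<le> K * (1 - x) ^ 0"
    by (rule regular_uptoE[OF 0(1)]) (rule that)
  have "compact (u ` cball 1 (\<delta> / 2))"
    using * by (intro compact_continuous_image holomorphic_on_imp_continuous_on[OF holomorphic_on_subset[OF *(5)]]) auto
  then obtain V where V: "\<And>z. norm (1 - z) \<le> \<delta> / 2 \<Longrightarrow> norm (u z) \<le> V"
    by (metis bounded_iff compact_imp_bounded image_eqI mem_cball dist_norm)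
  show ?case
  proof (rule abelian_leading_coeff_0[OF regular_uptoD_summable[OF 0(1)], of "1 - \<delta> / 2" "V + K"])
    fix x assume x: "1 - \<delta> / 2 < x" "x < 1"
    have "norm ((\<Sum>m. a m * of_real x ^ m) - u (of_real x)) \<le> K"
      using *(7)[OF x, of "of_real x"] x * by simp
    moreover have "norm (u (of_real x)) \<le> V"
    proof (rule V)
      have "norm (1 - complex_of_real x) = norm (complex_of_real (1 - x))" by simp
      also have "\<dots> = 1 - x" using x by (simp only: norm_of_real)
      finally show "norm (1 - complex_of_real x) \<le> \<delta> / 2" using x by simp
    qed
    ultimately show "norm (\<Sum>m. a m * of_real x ^ m) \<le> V + K"
      using norm_triangle_sub[of "\<Sum>m. a m * of_real x ^ m" "u (of_real x)"] by linarith
  qed (use 0 * in auto)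
next
  case (Suc b)
  have \<alpha>0: "\<alpha> \<noteq> 0" using Suc.prems by auto
  have \<alpha>1: "\<alpha> - 1 \<notin> \<int>" using Suc.prems(3) by (metis Ints_1 Ints_add diff_add_cancel)
  have "(\<lambda>m. of_nat m / (of_nat m - \<alpha>)) \<longlonglongrightarrow> 1"
  proof -
    have "(\<lambda>m. 1 / (1 - \<alpha> * inverse (of_nat m))) \<longlonglongrightarrow> 1 / (1 - \<alpha> * 0)"
      by (intro tendsto_intros lim_inverse_n) auto
    hence "(\<lambda>m. 1 / (1 - \<alpha> * inverse (of_nat m))) \<longlonglongrightarrow> 1" by simp
    thus ?thesis
    proof (rule Lim_transform_eventually)
      show "\<forall>\<^sub>F m in sequentially. 1 / (1 - \<alpha> * inverse (of_nat m)) = of_nat m / (of_nat m - \<alpha>)"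
        using eventually_gt_at_top[of 0] by eventually_elim (auto simp: field_simps)
    qed
  qed
  hence "(\<lambda>m. - \<alpha> * (a m / bc \<alpha> m) * (of_nat m / (of_nat m - \<alpha>))) \<longlonglongrightarrow> - \<alpha> * C * 1"
    by (intro tendsto_intros Suc.prems)
  moreover have "- \<alpha> * (a m / bc \<alpha> m) * (of_nat m / (of_nat m - \<alpha>)) = of_nat m * a m / bc (\<alpha> - 1) m" for m
  proof -
    have ne: "bc \<alpha> m \<noteq> 0" "bc (\<alpha> - 1) m \<noteq> 0" "of_nat m - \<alpha> \<noteq> 0"
      using bc_nonzero Suc.prems(3) \<alpha>1 by (auto simp: algebra_simps)
    have "- \<alpha> * bc (\<alpha> - 1) m = (of_nat m - \<alpha>) * bc \<alpha> m"
      using mult_bc[of m \<alpha>] by (simp add: algebra_simps)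
    with ne \<alpha>0 show ?thesis by (simp add: field_simps)
  qed
  ultimately have "(\<lambda>m. of_nat m * a m / bc (\<alpha> - 1) m) \<longlonglongrightarrow> - \<alpha> * C"
    by simp
  hence "- \<alpha> * C = 0"
    using Suc.prems \<alpha>1 Suc.IH[OF regular_upto_mult_index[OF Suc.prems(1)], of "\<alpha> - 1" "- \<alpha> * C"] by simp
  with \<alpha>0 show ?case by simp
qed

section \<open>Decay in integral powers of 1/n\<close>

abbreviation ipow :: "nat \<Rightarrow> nat \<Rightarrow> complex" where
  "ipow p \<equiv> (\<lambda>n. 1 / of_nat n ^ p)"

lemma ipow_mono: "p \<le> q \<Longrightarrow> ipow q \<in> O(ipow p)"
proof (rule bigoI[of _ 1])
  assume pq: "p \<le> q"
  show "\<forall>\<^sub>F n in sequentially. norm (ipow q n) \<le> 1 * norm (ipow p n)"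
    using eventually_gt_at_top[of 0]
    by eventually_elim (use pq in \<open>auto simp: norm_divide norm_power intro!: divide_left_mono power_increasing\<close>)
qed

lemma bigo_ipow_mono: "f \<in> O(ipow q) \<Longrightarrow> p \<le> q \<Longrightarrow> f \<in> O(ipow p)"
  by (rule landau_o.big_trans[OF _ ipow_mono])

lemma bigo_ipow_mult: "f \<in> O(ipow p) \<Longrightarrow> g \<in> O(ipow q) \<Longrightarrow> (\<lambda>n. f n * g n) \<in> O(ipow (p + q))"
  using landau_o.big.mult[of f sequentially "ipow p" g "ipow q"] by (simp add: power_add)

lemma ipow_shift: "(\<lambda>n. ipow p (n + k)) \<in> O(ipow p)"
  by (rule bigoI[of _ 1], rule eventually_mono[OF eventually_gt_at_top[of 0]])
    (auto simp: norm_divide norm_power simp del: of_nat_add intro!: divide_left_mono power_mono)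

lemma bigo_ipow_shift: "f \<in> O(ipow p) \<Longrightarrow> (\<lambda>n. f (n + k)) \<in> O(ipow p)"
  by (rule landau_o.big_trans[OF landau_o.big.compose[OF _ filterlim_add_const_nat_at_top[of k]] ipow_shift])

lemma bigo_ipow_unshift:
  assumes "(\<lambda>n. f (n + k)) \<in> O(ipow p)"
  shows "f \<in> O(ipow p)"
proof -
  have "(\<lambda>n. f (n - k + k)) \<in> O(\<lambda>n. ipow p (n - k))"
    by (rule landau_o.big.compose[OF assms filterlim_minus_const_nat_at_top])
  moreover have "(\<lambda>n. ipow p (n - k)) \<in> O(ipow p)"
  proof (rule bigoI[of _ "2 ^ p"], use eventually_gt_at_top[of "2 * k"] in eventually_elim)
    case (elim n)
    hence "real n \<le> 2 * real (n - k)" "real (n - k) > 0" by auto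
    hence "real n ^ p \<le> 2 ^ p * real (n - k) ^ p" "real (n - k) ^ p > 0" "real n ^ p > 0"
      using power_mono[of "real n" "2 * real (n - k)" p] elim
      by (auto simp: power_mult_distrib simp del: of_nat_diff)
    thus ?case by (simp add: norm_divide norm_power field_simps del: of_nat_diff)
  qed
  ultimately have 1: "(\<lambda>n. f (n - k + k)) \<in> O(ipow p)"
    by (rule landau_o.big_trans)
  have 2: "\<forall>\<^sub>F n in sequentially. f (n - k + k) = f n"
    using eventually_ge_at_top[of k] by eventually_elim simp
  show ?thesis
    by (rule iffD1[OF landau_o.big.in_cong[OF 2] 1])
qed

section \<open>Recurrences with slowly varying coefficients\<close>

lemma bc_bigo_ipow:
  assumes "real p \<le> Re \<alpha> + 1"
  shows "bc \<alpha> \<in> O(ipow p)"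
proof (rule landau_o.big_trans[OF bc_bigo_powr])
  show "(\<lambda>m. of_nat m powr (- \<alpha> - 1)) \<in> O(ipow p)"
  proof (rule bigoI[of _ 1], use eventually_gt_at_top[of 0] in eventually_elim)
    case (elim m)
    have "norm (complex_of_nat m powr (- \<alpha> - 1)) = real m powr (- Re \<alpha> - 1)"
      using elim by (simp add: norm_powr_real_powr)
    also have "\<dots> \<le> real m powr (- real p)"
      using elim assms by (intro powr_mono) auto
    also have "\<dots> = 1 / real m ^ p"
      using elim by (simp add: powr_minus_divide powr_realpow)
    finally show ?case by (simp add: norm_divide norm_power)
  qed
qed

text \<open>The exponent Re \<alpha> + 1 is rounded up to an integer k, so that all losses of order
  can be counted in natural numbers.\<close>

lemma bigo_ipow_div_bc:
  assumes "\<alpha> \<notin> \<int>" "f \<in> O(ipow N)" "Re \<alpha> + 1 \<le> real k" "k \<le> N"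
  shows "(\<lambda>m. f m / bc \<alpha> m) \<in> O(ipow (N - k))"
proof -
  have "(\<lambda>m. inverse (bc \<alpha> m)) \<in> O(\<lambda>m. inverse (of_nat m powr (- \<alpha> - 1)))"
    by (subst landau_o.big.inverse_cancel[symmetric])
      (use powr_bigo_bc[OF assms(1)] bc_nonzero[OF assms(1)] eventually_gt_at_top[of 0] in \<open>auto elim: eventually_mono\<close>)
  moreover have "(\<lambda>m. inverse (complex_of_nat m powr (- \<alpha> - 1))) \<in> O(\<lambda>m. of_nat m ^ k)"
  proof (rule bigoI[of _ 1], use eventually_gt_at_top[of 0] in eventually_elim)
    case (elim m)
    have "norm (inverse (complex_of_nat m powr (- \<alpha> - 1))) = real m powr (Re \<alpha> + 1)"
      using elim by (simp add: norm_powr_real_powr norm_inverse add.commute flip: powr_minus)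
    also have "\<dots> \<le> real m powr real k"
      using elim assms by (intro powr_mono) auto
    also have "\<dots> = real m ^ k"
      using elim by (simp add: powr_realpow)
    finally show ?case by (simp add: norm_power)
  qed
  ultimately have "(\<lambda>m. inverse (bc \<alpha> m)) \<in> O(\<lambda>m. of_nat m ^ k)"
    by (rule landau_o.big_trans)
  from landau_o.big.mult[OF assms(2) this]
  have "(\<lambda>m. f m * inverse (bc \<alpha> m)) \<in> O(\<lambda>m. ipow N m * of_nat m ^ k)" .
  also have "(\<lambda>m. ipow N m * of_nat m ^ k) \<in> O(ipow (N - k))"
  proof (rule bigoI[of _ 1], use eventually_gt_at_top[of 0] in eventually_elim)
    case (elim m)
    have "(of_nat m :: complex) ^ N = of_nat m ^ (N - k) * of_nat m ^ k"
      using assms by (simp flip: power_add)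
    thus ?case using elim by simp
  qed
  finally show ?thesis by (simp add: divide_inverse)
qed

lemma bigo_ipow_mult_bc:
  assumes "f \<in> O(ipow N)" "- Re \<alpha> - 1 \<le> real k" "k \<le> N"
  shows "(\<lambda>m. f m * bc \<alpha> m) \<in> O(ipow (N - k))"
proof (rule landau_o.big_trans[OF landau_o.big.mult[OF assms(1) bc_bigo_powr]])
  show "(\<lambda>m. ipow N m * of_nat m powr (- \<alpha> - 1)) \<in> O(ipow (N - k))"
  proof (rule bigoI[of _ 1], use eventually_gt_at_top[of 0] in eventually_elim)
    case (elim m)
    have "norm (ipow N m * complex_of_nat m powr (- \<alpha> - 1)) = 1 / real m ^ N * real m powr (- Re \<alpha> - 1)"
      using elim by (simp add: norm_powr_real_powr norm_mult norm_divide norm_power)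
    also have "\<dots> \<le> 1 / real m ^ N * real m powr real k"
      using elim assms by (intro mult_left_mono powr_mono) auto
    also have "\<dots> = 1 / real m ^ N * real m ^ k"
      using elim by (simp add: powr_realpow)
    also have "real m ^ N = real m ^ (N - k) * real m ^ k"
      using assms by (simp flip: power_add)
    finally show ?case using elim by (simp add: norm_divide norm_power)
  qed
qed

lemma inverse_linear_bigo: "(\<lambda>m. 1 / (of_nat m + c)) \<in> O(ipow 1)" for c :: complex
proof (rule bigoI[of _ 2])
  have "\<forall>\<^sub>F m in sequentially. real m > 2 * norm c"
    using filterlim_real_sequentially by (simp add: filterlim_at_top_dense)
  thus "\<forall>\<^sub>F m in sequentially. norm (1 / (of_nat m + c)) \<le> 2 * norm (ipow 1 m)"
  proof eventually_elim
    case (elim m)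
    have "real m \<le> norm (of_nat m + c) + norm c"
      by (metis norm_of_nat norm_diff_ineq norm_triangle_sub norm_minus_commute add.commute add_diff_cancel_left')
    hence "real m / 2 \<le> norm (of_nat m + c)" using elim by linarith
    moreover have m: "real m > 0" using elim norm_ge_zero[of c] by linarith
    moreover have "norm (of_nat m + c) > 0" using calculation by linarith
    ultimately show ?case by (simp add: norm_divide field_simps)
  qed
qed

lemma linear_bigo: "(\<lambda>m. (a * of_nat m + b) * ipow 1 m) \<in> O(ipow 0)" for a b :: complex
proof (rule bigoI[of _ "norm a + norm b"], use eventually_gt_at_top[of 0] in eventually_elim)
  case (elim m)
  have "norm (a * of_nat m + b) \<le> norm a * real m + norm b * real m"
    using elim by (intro norm_triangle_mono) (auto simp: norm_mult mult_le_cancel_left1)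
  thus ?case using elim by (simp add: norm_divide norm_mult field_simps)
qed

lemma bigo_ipow_linear:
  assumes "f \<in> O(ipow (Suc p))"
  shows "(\<lambda>m. (a * of_nat m + b) * f m) \<in> O(ipow p)"
proof -
  have "(\<lambda>m. (a * of_nat m + b) * f m) \<in> O(\<lambda>m. (a * of_nat m + b) * ipow (Suc p) m)"
    using assms by (intro landau_o.big.mult landau_o.big_refl)
  also have "(\<lambda>m. (a * of_nat m + b) * ipow (Suc p) m) = (\<lambda>m. ((a * of_nat m + b) * ipow 1 m) * ipow p m)"
    by (simp add: field_simps)
  also have "\<dots> \<in> O(ipow (0 + p))"
    by (intro bigo_ipow_mult linear_bigo landau_o.big_refl)
  finally show ?thesis by simp
qed

lemma bigo_ipow_div_linear:
  assumes "f \<in> O(ipow p)"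
  shows "(\<lambda>m. f m / (of_nat m + c)) \<in> O(ipow (Suc p))"
  using bigo_ipow_mult[OF assms inverse_linear_bigo[of c]] by simp

text \<open>With x = 1/n this reads (1-x)^p (1+x) \<le> 1, which for p \<ge> 1 follows from
  (1-x)(1+x) \<le> 1. It is the discrete form of comparing a sum with an integral.\<close>

lemma telescope_power_bound:
  assumes "n \<ge> 2" "p \<ge> (1::nat)"
  shows "1 / real n ^ Suc p \<le> 1 / real (n - 1) ^ p - 1 / real n ^ p"
proof -
  define x where "x = 1 / real n"
  have x: "0 < x" "x < 1" using assms by (auto simp: x_def)
  have "(1 - x) ^ p \<le> (1 - x) ^ 1" using x assms by (intro power_decreasing) auto
  hence "(1 - x) ^ p * (1 + x) \<le> (1 - x) * (1 + x)" using x by (intro mult_right_mono) auto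
  also have "\<dots> \<le> 1" using x by (simp add: algebra_simps)
  finally have le: "(1 - x) ^ p * (1 + x) \<le> 1" .
  have n1: "real (n - 1) = real n * (1 - x)" using assms by (simp add: x_def of_nat_diff field_simps)
  have "1 + x \<le> 1 / (1 - x) ^ p" using le x by (simp add: field_simps)
  hence "(1 / real n ^ p) * (1 + x) \<le> (1 / real n ^ p) * (1 / (1 - x) ^ p)"
    by (intro mult_left_mono) auto
  moreover have "1 / real n ^ Suc p + 1 / real n ^ p = (1 / real n ^ p) * (1 + x)"
    using assms by (simp add: x_def field_simps)
  moreover have "(1 / real n ^ p) * (1 / (1 - x) ^ p) = 1 / real (n - 1) ^ p"
    unfolding n1 by (simp add: power_mult_distrib)
  ultimately show ?thesis by linarith
qed

text \<open>H(n) is minus the sum of all later differences, and the bounds of these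
  telescope.\<close>

lemma bigo_of_differences:
  fixes H :: "nat \<Rightarrow> complex"
  assumes d: "(\<lambda>n. H (Suc n) - H n) \<in> O(ipow (Suc p))" and p: "p \<ge> 1" and lim: "H \<longlonglongrightarrow> 0"
  shows "H \<in> O(ipow p)"
proof -
  obtain K where "K > 0" "\<forall>\<^sub>F n in sequentially. norm (H (Suc n) - H n) \<le> K * norm (ipow (Suc p) n)"
    by (rule landau_o.bigE[OF d])
  then obtain n0 where n0: "\<And>n. n \<ge> n0 \<Longrightarrow> norm (H (Suc n) - H n) \<le> K * (1 / real n ^ Suc p)"
    unfolding eventually_at_top_linorder norm_divide norm_power norm_of_nat norm_one by blast
  have step: "norm (H N - H n) \<le> K * (1 / real (n - 1) ^ p - 1 / real (N - 1) ^ p)"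
    if "n0 \<le> n" "2 \<le> n" "n \<le> N" for n N
    using that(3)
  proof (induction N rule: dec_induct)
    case (step N)
    have "norm (H (Suc N) - H n) \<le> norm (H (Suc N) - H N) + norm (H N - H n)"
      using norm_triangle_ineq[of "H (Suc N) - H N" "H N - H n"] by simp
    also have "norm (H (Suc N) - H N) \<le> K * (1 / real N ^ Suc p)"
      using step that by (intro n0) auto
    also have "\<dots> \<le> K * (1 / real (N - 1) ^ p - 1 / real N ^ p)"
      using step that p \<open>K > 0\<close> by (intro mult_left_mono telescope_power_bound) auto
    also note step.IH
    finally show ?case by (simp add: algebra_simps)
  qed simp
  have bound: "norm (H n) \<le> K * (1 / real (n - 1) ^ p)" if n: "n0 \<le> n" "2 \<le> n" for n
  proof (rule LIMSEQ_le_const2)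
    show "(\<lambda>N. norm (H N - H n)) \<longlonglongrightarrow> norm (H n)"
      using tendsto_norm[OF tendsto_diff[OF lim tendsto_const[of "H n"]]] by simp
    show "\<exists>N. \<forall>m\<ge>N. norm (H m - H n) \<le> K * (1 / real (n - 1) ^ p)"
    proof (intro exI[of _ n] allI impI)
      fix m assume "n \<le> m"
      have "0 \<le> K * (1 / real (m - 1) ^ p)" using \<open>K > 0\<close> by simp
      thus "norm (H m - H n) \<le> K * (1 / real (n - 1) ^ p)"
        using step[OF n \<open>n \<le> m\<close>] unfolding right_diff_distrib by linarith
    qed
  qed
  have "(\<lambda>n. H (n + 1)) \<in> O(ipow p)"
  proof (rule bigoI[of _ K], use eventually_ge_at_top[of "n0 + 2"] in eventually_elim)
    case (elim n)
    thus ?case using bound[of "n + 1"] by (simp add: norm_divide norm_power)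
  qed
  thus ?thesis by (rule bigo_ipow_unshift)
qed

lemma summable_ipow:
  fixes f :: "nat \<Rightarrow> complex"
  assumes "f \<in> O(ipow 2)"
  shows "summable f"
proof (rule summable_norm_cancel, rule summable_comparison_test_bigo)
  show "summable (\<lambda>n. norm (1 / real n ^ 2))"
    using inverse_power_summable[of 2, where 'a = real] by (simp add: divide_inverse)
  have "(\<lambda>n. norm (f n)) \<in> O(\<lambda>n. norm (ipow 2 n))"
    using assms by (simp only: landau_o.big.norm_iff)
  thus "(\<lambda>n. norm (f n)) \<in> O(\<lambda>n. 1 / real n ^ 2)"
    by (simp only: norm_divide norm_power norm_of_nat norm_one)
qed

text \<open>Discrete Gronwall argument: a common bound for three consecutive values grows at most by
  the factor 1 + t n \<le> exp (t n) per step, and \<open>t\<close> is summable.\<close>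

lemma recurrence_bounded:
  fixes H :: "nat \<Rightarrow> complex" and s0 s1 s2 w :: "nat \<Rightarrow> complex"
  assumes rec: "\<forall>\<^sub>F n in sequentially. H (n + 3) - H (n + 2) = s0 n * H (n + 2) + s1 n * H (n + 1) + s2 n * H n + w n"
    and s: "s0 \<in> O(ipow 2)" "s1 \<in> O(ipow 2)" "s2 \<in> O(ipow 2)" and w: "w \<in> O(ipow 2)"
  shows "H \<in> O(ipow 0)"
proof -
  have ex: "\<exists>K>0. \<forall>\<^sub>F n in sequentially. norm (f n) \<le> K / real n ^ 2" if "f \<in> O(ipow 2)" for f :: "nat \<Rightarrow> complex"
    using landau_o.bigE[OF that] by (auto simp: norm_divide norm_power)
  obtain K0 K1 K2 K3 where K: "K0 > 0" "K1 > 0" "K2 > 0" "K3 > 0"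
    "\<forall>\<^sub>F n in sequentially. norm (s0 n) \<le> K0 / real n ^ 2" "\<forall>\<^sub>F n in sequentially. norm (s1 n) \<le> K1 / real n ^ 2"
    "\<forall>\<^sub>F n in sequentially. norm (s2 n) \<le> K2 / real n ^ 2" "\<forall>\<^sub>F n in sequentially. norm (w n) \<le> K3 / real n ^ 2"
    using ex[OF s(1)] ex[OF s(2)] ex[OF s(3)] ex[OF w] by blast
  define K where "K = K0 + K1 + K2 + K3"
  define t where "t = (\<lambda>n. K / real n ^ 2)"
  have t0: "t n \<ge> 0" for n using K by (simp add: t_def K_def)
  have sumt: "summable t"
    unfolding t_def using summable_mult[OF inverse_power_summable[of 2, where 'a = real]]
    by (simp add: divide_inverse)
  have "\<forall>\<^sub>F n in sequentially. norm (H (n + 3)) \<le> norm (H (n + 2))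
      + (K0 / real n ^ 2 * norm (H (n + 2)) + K1 / real n ^ 2 * norm (H (n + 1)) + K2 / real n ^ 2 * norm (H n) + K3 / real n ^ 2)"
    using rec K(5-8)
  proof eventually_elim
    case (elim n)
    have "H (n + 3) = H (n + 2) + (s0 n * H (n + 2) + s1 n * H (n + 1) + s2 n * H n + w n)"
      using elim(1) by (simp add: algebra_simps)
    hence "norm (H (n + 3)) \<le> norm (H (n + 2)) + (norm (s0 n * H (n + 2)) + norm (s1 n * H (n + 1)) + norm (s2 n * H n) + norm (w n))"
      by (simp only:) (intro norm_triangle_mono order_refl)
    also have "\<dots> \<le> norm (H (n + 2))
      + (K0 / real n ^ 2 * norm (H (n + 2)) + K1 / real n ^ 2 * norm (H (n + 1)) + K2 / real n ^ 2 * norm (H n) + K3 / real n ^ 2)"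
      unfolding norm_mult by (intro add_mono mult_right_mono elim order_refl norm_ge_zero)
    finally show ?case .
  qed
  then obtain n0 where n0: "\<And>n. n \<ge> n0 \<Longrightarrow> norm (H (n + 3)) \<le> norm (H (n + 2))
      + (K0 / real n ^ 2 * norm (H (n + 2)) + K1 / real n ^ 2 * norm (H (n + 1)) + K2 / real n ^ 2 * norm (H n) + K3 / real n ^ 2)"
    by (auto simp: eventually_at_top_linorder)
  \<comment> \<open>The summand 1 keeps the bound at least 1, so that the inhomogeneity
    \<open>w\<close> can be absorbed as a multiple of the bound itself.\<close>
  define M where "M = 1 + norm (H n0) + norm (H (n0 + 1)) + norm (H (n0 + 2))"
  define T where "T = (\<lambda>n. \<Sum>k\<in>{n0..<n}. t k)"
  have main: "norm (H n) \<le> M * exp (T n) \<and> norm (H (n + 1)) \<le> M * exp (T n) \<and> norm (H (n + 2)) \<le> M * exp (T n) \<and> 1 \<le> M * exp (T n)"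
    if "n0 \<le> n" for n
    using that
  proof (induction n rule: dec_induct)
    case (step n)
    define Y where "Y = M * exp (T n)"
    have Y: "norm (H n) \<le> Y" "norm (H (n + 1)) \<le> Y" "norm (H (n + 2)) \<le> Y" "1 \<le> Y"
      using step.IH by (auto simp: Y_def)
    have T: "T (Suc n) = T n + t n" using step.hyps by (simp add: T_def)
    have "norm (H (n + 3)) \<le> Y + (K0 / real n ^ 2 * Y + K1 / real n ^ 2 * Y + K2 / real n ^ 2 * Y + K3 / real n ^ 2 * Y)"
    proof (rule order_trans[OF n0[OF step.hyps(1)]], intro add_mono mult_left_mono Y)
      show "K3 / real n ^ 2 \<le> K3 / real n ^ 2 * Y"
        using mult_left_mono[OF Y(4), of "K3 / real n ^ 2"] K(4) by simp
    qed (use K in auto)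
    also have "\<dots> = Y * (1 + t n)" by (simp add: t_def K_def add_divide_distrib algebra_simps)
    also have "\<dots> \<le> Y * exp (t n)" using Y by (intro mult_left_mono exp_ge_add_one_self) auto
    finally have 3: "norm (H (n + 3)) \<le> M * exp (T (Suc n))" by (simp add: T exp_add Y_def mult_ac)
    have "Y * 1 \<le> Y * exp (t n)" using Y t0[of n] by (intro mult_left_mono) auto
    hence "Y \<le> M * exp (T (Suc n))" by (simp add: T exp_add Y_def mult_ac)
    thus ?case using 3 Y by (auto simp: numeral_3_eq_3)
  qed (auto simp: T_def M_def)
  have "T n \<le> suminf t" for n
    unfolding T_def by (intro sum_le_suminf sumt) (auto simp: t0)
  show ?thesis
  proof (rule bigoI[of _ "M * exp (suminf t)"], use eventually_ge_at_top[of n0] in eventually_elim)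
    case (elim n)
    have "norm (H n) \<le> M * exp (T n)" using main[OF elim] by simp
    also have "\<dots> \<le> M * exp (suminf t)"
      using \<open>T n \<le> suminf t\<close> by (intro mult_left_mono) (auto simp: M_def intro!: add_nonneg_nonneg)
    finally show ?case by simp
  qed
qed

text \<open>Bootstrap: a bound n^(-p) for H gives n^(-p-2) for its differences as long as
  \<open>w\<close> permits, and summing them back costs one power. Each round thus gains one power
  until the order of \<open>w\<close> stops it. The first round already makes the differences
  summable, whence the convergence.\<close>

lemma recurrence_asymptotics:
  fixes H :: "nat \<Rightarrow> complex" and s0 s1 s2 w :: "nat \<Rightarrow> complex"
  assumes rec: "\<forall>\<^sub>F n in sequentially. H (n + 3) - H (n + 2) = s0 n * H (n + 2) + s1 n * H (n + 1) + s2 n * H n + w n"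
    and s: "s0 \<in> O(ipow 2)" "s1 \<in> O(ipow 2)" "s2 \<in> O(ipow 2)" and w: "w \<in> O(ipow (Suc N))" "N \<ge> 1"
  shows "convergent H" and "H \<longlonglongrightarrow> 0 \<Longrightarrow> H \<in> O(ipow N)"
proof -
  have D: "(\<lambda>n. H (Suc n) - H n) \<in> O(ipow (min (Suc N) (p + 2)))" if H: "H \<in> O(ipow p)" for p
  proof -
    let ?q = "min (Suc N) (p + 2)"
    have "(\<lambda>n. s0 n * H (n + 2)) \<in> O(ipow (2 + p))" "(\<lambda>n. s1 n * H (n + 1)) \<in> O(ipow (2 + p))"
      "(\<lambda>n. s2 n * H n) \<in> O(ipow (2 + p))"
      by (intro bigo_ipow_mult s H bigo_ipow_shift)+
    hence "(\<lambda>n. s0 n * H (n + 2) + s1 n * H (n + 1) + s2 n * H n + w n) \<in> O(ipow ?q)"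
      using w(1) by (intro sum_in_bigo) (erule bigo_ipow_mono, simp)+
    hence "(\<lambda>n. H (n + 3) - H (n + 2)) \<in> O(ipow ?q)"
      by (rule iffD2[OF landau_o.big.in_cong[OF rec]])
    hence "(\<lambda>n. H (Suc (n + 2)) - H (n + 2)) \<in> O(ipow ?q)"
      by (simp add: numeral_3_eq_3)
    thus ?thesis by (rule bigo_ipow_unshift[where f = "\<lambda>n. H (Suc n) - H n"])
  qed
  have w2: "w \<in> O(ipow 2)" by (rule bigo_ipow_mono[OF w(1)]) (use w(2) in simp)
  have "(\<lambda>n. H (Suc n) - H n) \<in> O(ipow 2)"
    by (rule bigo_ipow_mono[OF D[OF recurrence_bounded[OF rec s w2]]]) (use w(2) in auto)
  hence "summable (\<lambda>n. H (Suc n) - H n)" by (rule summable_ipow)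
  hence "convergent (\<lambda>n. \<Sum>k<n. H (Suc k) - H k)" by (simp add: summable_iff_convergent)
  hence "convergent (\<lambda>n. (H n - H 0) + H 0)"
    unfolding sum_lessThan_telescope by (intro convergent_add convergent_const)
  thus "convergent H" by simp
  assume lim: "H \<longlonglongrightarrow> 0"
  have "p \<le> N \<Longrightarrow> H \<in> O(ipow p)" for p
  proof (induction p)
    case 0
    show ?case by (rule recurrence_bounded[OF rec s w2])
  next
    case (Suc p)
    have "(\<lambda>n. H (Suc n) - H n) \<in> O(ipow (Suc (Suc p)))"
      by (rule bigo_ipow_mono[OF D[OF Suc.IH]]) (use Suc.prems in auto)
    thus ?case by (rule bigo_of_differences) (use lim in auto)
  qed
  thus "H \<in> O(ipow N)" by simp
qed

section \<open>Spans of binomial sequences and the recurrence operators\<close>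

definition lin :: "complex \<Rightarrow> complex \<Rightarrow> (nat \<Rightarrow> complex) \<Rightarrow> nat \<Rightarrow> complex" where
  "lin a b f m = (a * of_nat m + b) * f m"

text \<open>Exponents move in steps of 1/3 because \<phi>(q) takes values in Z/3. Negative i are
  included since multiplication by m lowers exponents by one.\<close>

definition bc_span :: "complex \<Rightarrow> (nat \<Rightarrow> complex) set" where
  "bc_span \<beta> = {a. \<exists>A r. finite A \<and> a = (\<lambda>m. \<Sum>i\<in>A. r i * bc (\<beta> + of_int i / 3) m)}"

lemma bc_span_base: "(\<lambda>m. k * bc (\<beta> + of_int i / 3) m) \<in> bc_span \<beta>"
  unfolding bc_span_def by (intro CollectI exI[of _ "{i}"] exI[of _ "\<lambda>_. k"]) simp

lemma bc_span_zero: "(\<lambda>_. 0) \<in> bc_span \<beta>"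
  unfolding bc_span_def by (intro CollectI exI[of _ "{}"]) simp

lemma bc_span_add:
  assumes "f \<in> bc_span \<beta>" "g \<in> bc_span \<beta>"
  shows "(\<lambda>m. f m + g m) \<in> bc_span \<beta>"
proof -
  obtain A r where A: "finite A" "f = (\<lambda>m. \<Sum>i\<in>A. r i * bc (\<beta> + of_int i / 3) m)"
    using assms(1) unfolding bc_span_def by blast
  obtain B s where B: "finite B" "g = (\<lambda>m. \<Sum>i\<in>B. s i * bc (\<beta> + of_int i / 3) m)"
    using assms(2) unfolding bc_span_def by blast
  have "f m + g m = (\<Sum>i\<in>A \<union> B. ((if i \<in> A then r i else 0) + (if i \<in> B then s i else 0)) * bc (\<beta> + of_int i / 3) m)" for m
  proof -
    have "(\<Sum>i\<in>A \<union> B. (if i \<in> A then r i else 0) * bc (\<beta> + of_int i / 3) m) = f m"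
      unfolding A(2) by (rule sum.mono_neutral_cong_right) (use A(1) B(1) in auto)
    moreover have "(\<Sum>i\<in>A \<union> B. (if i \<in> B then s i else 0) * bc (\<beta> + of_int i / 3) m) = g m"
      unfolding B(2) by (rule sum.mono_neutral_cong_right) (use A(1) B(1) in auto)
    ultimately show ?thesis by (simp add: distrib_right sum.distrib)
  qed
  thus ?thesis unfolding bc_span_def
    by (intro CollectI exI[of _ "A \<union> B"] exI[of _ "\<lambda>i. (if i \<in> A then r i else 0) + (if i \<in> B then s i else 0)"])
      (use A(1) B(1) in auto)
qed

lemma bc_span_scale: "f \<in> bc_span \<beta> \<Longrightarrow> (\<lambda>m. k * f m) \<in> bc_span \<beta>"
  unfolding bc_span_def
proof clarify
  fix A :: "int set" and r :: "int \<Rightarrow> complex"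
  assume "finite A"
  thus "\<exists>A' r'. finite A' \<and> (\<lambda>m. k * (\<Sum>i\<in>A. r i * bc (\<beta> + of_int i / 3) m))
      = (\<lambda>m. \<Sum>i\<in>A'. r' i * bc (\<beta> + of_int i / 3) m)"
    by (intro exI[of _ A] exI[of _ "\<lambda>i. k * r i"]) (simp add: sum_distrib_left mult_ac)
qed

lemma bc_span_sum: "(\<And>i. i \<in> A \<Longrightarrow> f i \<in> bc_span \<beta>) \<Longrightarrow> (\<lambda>m. \<Sum>i\<in>A. f i m) \<in> bc_span \<beta>"
  by (induction A rule: infinite_finite_induct) (auto intro!: bc_span_add bc_span_zero)

lemma bc_span_shift:
  assumes "f \<in> bc_span \<beta>"
  shows "seq_shift f \<in> bc_span \<beta>"
proof -
  obtain A r where A: "finite A" "f = (\<lambda>m. \<Sum>i\<in>A. r i * bc (\<beta> + of_int i / 3) m)"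
    using assms unfolding bc_span_def by blast
  have "seq_shift f m = (\<Sum>i\<in>A. r i * bc (\<beta> + of_int i / 3) m + (- r i) * bc (\<beta> + of_int (i + 3) / 3) m)" for m
  proof -
    have "seq_shift f m = (\<Sum>i\<in>A. r i * seq_shift (bc (\<beta> + of_int i / 3)) m)"
      by (cases m) (simp_all add: A(2))
    thus ?thesis by (simp add: seq_shift_bc right_diff_distrib add_divide_distrib add_ac)
  qed
  hence "seq_shift f = (\<lambda>m. \<Sum>i\<in>A. r i * bc (\<beta> + of_int i / 3) m + (- r i) * bc (\<beta> + of_int (i + 3) / 3) m)"
    by (rule ext)
  thus ?thesis by (simp only:) (intro bc_span_sum bc_span_add bc_span_base)
qed

lemma bc_span_lin:
  assumes "f \<in> bc_span \<beta>"
  shows "lin a b f \<in> bc_span \<beta>"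
proof -
  obtain A r where A: "finite A" "f = (\<lambda>m. \<Sum>i\<in>A. r i * bc (\<beta> + of_int i / 3) m)"
    using assms unfolding bc_span_def by blast
  have "lin a b f m = (\<Sum>i\<in>A. (a * r i * (\<beta> + of_int i / 3)) * bc (\<beta> + of_int i / 3) m
      + (- (a * r i * (\<beta> + of_int i / 3))) * bc (\<beta> + of_int (i - 3) / 3) m) + b * f m" for m
  proof -
    have "a * of_nat m * f m = (\<Sum>i\<in>A. a * r i * (of_nat m * bc (\<beta> + of_int i / 3) m))"
      by (simp add: A(2) sum_distrib_left mult_ac)
    also have "\<dots> = (\<Sum>i\<in>A. (a * r i * (\<beta> + of_int i / 3)) * bc (\<beta> + of_int i / 3) m
      + (- (a * r i * (\<beta> + of_int i / 3))) * bc (\<beta> + of_int (i - 3) / 3) m)"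
    proof (rule sum.cong[OF refl])
      fix i
      have "\<beta> + of_int (i - 3) / 3 = \<beta> + of_int i / 3 - 1" by (simp add: diff_divide_distrib)
      thus "a * r i * (of_nat m * bc (\<beta> + of_int i / 3) m) = (a * r i * (\<beta> + of_int i / 3)) * bc (\<beta> + of_int i / 3) m
      + (- (a * r i * (\<beta> + of_int i / 3))) * bc (\<beta> + of_int (i - 3) / 3) m"
        by (simp only: mult_bc) (simp add: algebra_simps)
    qed
    finally show ?thesis by (simp add: lin_def distrib_right)
  qed
  hence "lin a b f = (\<lambda>m. (\<Sum>i\<in>A. (a * r i * (\<beta> + of_int i / 3)) * bc (\<beta> + of_int i / 3) m
      + (- (a * r i * (\<beta> + of_int i / 3))) * bc (\<beta> + of_int (i - 3) / 3) m) + b * f m)"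
    by (rule ext)
  thus ?thesis by (simp only:) (intro bc_span_sum bc_span_add bc_span_base bc_span_scale assms)
qed

lemma bigo_ipow_scale: "f \<in> O(ipow p) \<Longrightarrow> (\<lambda>m. k * f m) \<in> O(ipow p)"
  by (cases "k = 0") simp_all

text \<open>The exponents have pairwise different real parts, so the term with the smallest one
  dominates. Abel's theorem forces this real part to be at least b, and then every term is
  small.\<close>

lemma bc_span_regular_small:
  assumes f: "f \<in> bc_span \<beta>" and nonint: "\<And>i. \<beta> + of_int i / 3 \<notin> \<int>" and reg: "regular_upto b f"
  shows "f \<in> O(ipow b)"
proof -
  obtain A r where A: "finite A" "f = (\<lambda>m. \<Sum>i\<in>A. r i * bc (\<beta> + of_int i / 3) m)"
    using f unfolding bc_span_def by blast
  \<comment> \<open>Zero coefficients are discarded, so that the smallest exponent really occurs and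
    the limit \<open>r j\<close> obtained for it is nonzero.\<close>
  define B where "B = {i \<in> A. r i \<noteq> 0}"
  have B: "finite B" "f = (\<lambda>m. \<Sum>i\<in>B. r i * bc (\<beta> + of_int i / 3) m)"
    using A(1) by (auto simp: A(2) B_def intro!: ext sum.mono_neutral_right)
  show ?thesis
  proof (cases "B = {}")
    case False
    define j where "j = Min B"
    have j: "j \<in> B" "\<And>i. i \<in> B \<Longrightarrow> j \<le> i" using B(1) False by (auto simp: j_def)
    have "(\<lambda>m. \<Sum>i\<in>B. r i * (bc (\<beta> + of_int i / 3) m / bc (\<beta> + of_int j / 3) m))
        \<longlonglongrightarrow> (\<Sum>i\<in>B. r i * (if i = j then 1 else 0))"
    proof (intro tendsto_sum tendsto_mult tendsto_const)
      fix i assume "i \<in> B"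
      show "(\<lambda>m. bc (\<beta> + of_int i / 3) m / bc (\<beta> + of_int j / 3) m) \<longlonglongrightarrow> (if i = j then 1 else 0)"
      proof (cases "i = j")
        case True
        thus ?thesis using bc_nonzero[OF nonint[of j]] by simp
      next
        case False
        hence "j < i" using j(2)[OF \<open>i \<in> B\<close>] by simp
        thus ?thesis using False by (simp add: bc_ratio_to_0 nonint)
      qed
    qed
    also have "(\<Sum>i\<in>B. r i * (if i = j then 1 else 0)) = r j"
      using B(1) j(1) by (simp add: if_distrib cong: if_cong)
    also have "(\<lambda>m. \<Sum>i\<in>B. r i * (bc (\<beta> + of_int i / 3) m / bc (\<beta> + of_int j / 3) m))
        = (\<lambda>m. f m / bc (\<beta> + of_int j / 3) m)"
      by (simp add: B(2) sum_divide_distrib)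
    finally have "(\<lambda>m. f m / bc (\<beta> + of_int j / 3) m) \<longlonglongrightarrow> r j" .
    from regular_upto_leading_coeff_0[OF reg this nonint[of j]]
    have "real b \<le> Re (\<beta> + of_int j / 3)" using j(1) by (force simp: B_def)
    moreover have "Re (\<beta> + of_int j / 3) \<le> Re (\<beta> + of_int i / 3)" if "i \<in> B" for i
      using j(2)[OF that] by simp
    ultimately have "real b \<le> Re (\<beta> + of_int i / 3) + 1" if "i \<in> B" for i
      using that by force
    hence "(\<lambda>m. \<Sum>i\<in>B. r i * bc (\<beta> + of_int i / 3) m) \<in> O(ipow b)"
      by (intro big_sum_in_bigo bigo_ipow_scale bc_bigo_ipow)
    thus ?thesis by (simp add: B(2))
  qed (simp add: B(2))
qed

lemma regular_upto_lin:
  assumes "regular_upto (Suc b) f"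
  shows "regular_upto b (lin a c f)"
proof -
  have "regular_upto b (\<lambda>m. a * (of_nat m * f m) + c * f m)"
    by (intro regular_upto_add regular_upto_scale regular_upto_mult_index assms regular_upto_mono[OF assms]) simp
  thus ?thesis by (simp add: lin_def [abs_def] algebra_simps)
qed

lemma bigo_ipow_lin: "f \<in> O(ipow (Suc p)) \<Longrightarrow> lin a b f \<in> O(ipow p)"
  using bigo_ipow_linear[of f p a b] by (simp add: lin_def [abs_def])

lemma bigo_ipow_seq_shift: "f \<in> O(ipow p) \<Longrightarrow> seq_shift f \<in> O(ipow p)"
  by (rule bigo_ipow_unshift[where k = 1]) simp

text \<open>
  The two sides of the recurrence for $b(\kappa;m,n_1,n_2)$ after multiplication by
  $\Gamma(-\mu-m)(-2\kappa s_0)^m (\mu+m)(\mu+m-1)(\mu+m-2)/(18\kappa s_0)$: the multiples of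
  $b(\kappa;\cdot,n_1,n_2)$, and those of $b(\kappa;\cdot,n_1-1,n_2)$ or $b(\kappa;\cdot,n_1,n_2-1)$.
\<close>

definition main_op :: "complex \<Rightarrow> complex \<Rightarrow> complex \<Rightarrow> complex \<Rightarrow> complex \<Rightarrow> complex \<Rightarrow> (nat \<Rightarrow> complex) \<Rightarrow> nat \<Rightarrow> complex" where
  "main_op c t l \<mu> k1 k2 h = (\<lambda>m. lin 1 (- c) (lin 1 \<mu> (lin 1 (\<mu> - 1) (lin 1 (\<mu> - 2) h))) m
     + (- 1) * lin 1 (t + l) (lin 1 (t - l) (lin 1 (\<mu> - 1) (lin 1 (\<mu> - 2) (seq_shift h)))) m
     + k1 * lin 1 (\<mu> - 2) (seq_shift (seq_shift h)) m + k2 * seq_shift (seq_shift (seq_shift h)) m)"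

definition lower_op :: "complex \<Rightarrow> complex \<Rightarrow> complex \<Rightarrow> complex \<Rightarrow> complex \<Rightarrow> (nat \<Rightarrow> complex) \<Rightarrow> nat \<Rightarrow> complex" where
  "lower_op \<mu> a b d1 d2 h = (\<lambda>m. lin a b (lin 1 (\<mu> - 1) (lin 1 (\<mu> - 2) (seq_shift h))) m
     + d1 * lin 1 (\<mu> - 2) (seq_shift (seq_shift h)) m + d2 * seq_shift (seq_shift (seq_shift h)) m)"

lemma lin_diff: "lin a b (\<lambda>m. f m - g m) = (\<lambda>m. lin a b f m - lin a b g m)"
  by (auto simp: lin_def algebra_simps)

lemma seq_shift_diff: "seq_shift (\<lambda>m. f m - g m :: complex) = (\<lambda>m. seq_shift f m - seq_shift g m)"
  by (auto simp: seq_shift_def split: nat.splits)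

lemma main_op_diff: "main_op c t l \<mu> k1 k2 (\<lambda>m. f m - g m) m = main_op c t l \<mu> k1 k2 f m - main_op c t l \<mu> k1 k2 g m"
  unfolding main_op_def lin_diff seq_shift_diff by (simp add: algebra_simps)

lemma lower_op_diff: "lower_op \<mu> a b d1 d2 (\<lambda>m. f m - g m) m = lower_op \<mu> a b d1 d2 f m - lower_op \<mu> a b d1 d2 g m"
  unfolding lower_op_def lin_diff seq_shift_diff by (simp add: algebra_simps)

lemma main_op_bc_span: "f \<in> bc_span \<beta> \<Longrightarrow> main_op c t l \<mu> k1 k2 f \<in> bc_span \<beta>"
  unfolding main_op_def by (intro bc_span_add bc_span_scale bc_span_lin bc_span_shift)

lemma lower_op_bc_span: "f \<in> bc_span \<beta> \<Longrightarrow> lower_op \<mu> a b d1 d2 f \<in> bc_span \<beta>"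
  unfolding lower_op_def by (intro bc_span_add bc_span_scale bc_span_lin bc_span_shift)

text \<open>Four nested factors of degree one in m cost four orders; shifts and scalars cost
  none.\<close>

lemma main_op_regular:
  assumes "regular_upto (b + 4) f"
  shows "regular_upto b (main_op c t l \<mu> k1 k2 f)"
  unfolding main_op_def
  by (intro regular_upto_add regular_upto_scale regular_upto_lin regular_upto_shift regular_upto_mono[OF assms]) auto

lemma lower_op_regular:
  assumes "regular_upto (b + 4) f"
  shows "regular_upto b (lower_op \<mu> a c d1 d2 f)"
  unfolding lower_op_def
  by (intro regular_upto_add regular_upto_scale regular_upto_lin regular_upto_shift regular_upto_mono[OF assms]) auto

lemma lower_op_bigo:
  assumes "f \<in> O(ipow (p + 3))"
  shows "lower_op \<mu> a c d1 d2 f \<in> O(ipow p)"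
  unfolding lower_op_def
  by (intro sum_in_bigo bigo_ipow_scale bigo_ipow_lin bigo_ipow_seq_shift bigo_ipow_mono[OF assms]) auto

section \<open>Decay of the truncation error from the recurrence\<close>

lemma eventually_of_nat_add_nonzero: "\<forall>\<^sub>F n in sequentially. complex_of_nat n + c \<noteq> 0"
proof -
  have "\<forall>\<^sub>F n in sequentially. real n > norm c"
    using filterlim_real_sequentially by (simp add: filterlim_at_top_dense)
  thus ?thesis
  proof eventually_elim
    case (elim n)
    thus ?case by (metis add_eq_0_iff less_irrefl norm_minus_cancel norm_of_nat)
  qed
qed

text \<open>Dividing by \<open>bc \<alpha>\<close> gives a recurrence for the quotient H with
  coefficients O(n^-2): the hypothesis on the exponent says exactly that the 1/n terms in the ratios
  of consecutive values agree. So H converges, Abel's theorem makes the limit 0, and H inherits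
  decay from \<open>w\<close>. Division and multiplication by \<open>bc \<alpha>\<close> lose k
  powers each, the summation of differences one more.\<close>

lemma decay_from_recurrence:
  assumes rec: "\<And>m. main_op c t l \<mu> k1 k2 h m = w m"
    and w: "w \<in> O(ipow N)" and reg: "regular_upto b h" and \<alpha>: "\<alpha> \<notin> \<int>" "Re \<alpha> < real b"
    and exponent: "2 * t + c - \<mu> + 1 + \<alpha> = 0"
    and k: "\<bar>Re \<alpha>\<bar> + 1 \<le> real k" "2 * k + 2 \<le> N"
  shows "h \<in> O(ipow (N - 2 * k - 1))"
proof -
  define H where "H = (\<lambda>m. h m / bc \<alpha> m)"
  note bc0 = bc_nonzero[OF \<alpha>(1)]
  have h: "h m = H m * bc \<alpha> m" for m using bc0 by (simp add: H_def)
  \<comment> \<open>Coefficients in (m+t+l)(m+t-l)m - (m-c)(m+\<mu>)(m-1-\<alpha>) = e1 m + e0: the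
    cubic terms cancel, and the quadratic ones do so by the hypothesis on the exponent. With m = n +
    3 the constant term becomes 3 e1 + e0.\<close>
  define e1 where "e1 = t ^ 2 - l ^ 2 + c * \<mu> + (1 + \<alpha>) * (\<mu> - c)"
  define e0 where "e0 = - c * \<mu> * (1 + \<alpha>)"
  let ?Y = "\<lambda>a n. complex_of_nat n + a"
  define s0 where "s0 = (\<lambda>n. (e1 * of_nat n + (3 * e1 + e0)) * (1 / ?Y (3 - c) n / ?Y (3 + \<mu>) n / ?Y (2 - \<alpha>) n))"
  define s1 where "s1 = (\<lambda>n. (1 * of_nat n + 3) * ((1 * of_nat n + 2) *
      ((- k1) / ?Y (3 - c) n / ?Y (3 + \<mu>) n / ?Y (2 + \<mu>) n / ?Y (2 - \<alpha>) n / ?Y (1 - \<alpha>) n)))"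
  define s2 where "s2 = (\<lambda>n. (1 * of_nat n + 3) * ((1 * of_nat n + 2) * ((1 * of_nat n + 1) *
      ((- k2) / ?Y (3 - c) n / ?Y (3 + \<mu>) n / ?Y (2 + \<mu>) n / ?Y (1 + \<mu>) n / ?Y (2 - \<alpha>) n / ?Y (1 - \<alpha>) n / ?Y (- \<alpha>) n))))"
  define \<omega> where "\<omega> = (\<lambda>n. w (n + 3) / bc \<alpha> (n + 3) / ?Y (3 - c) n / ?Y (3 + \<mu>) n / ?Y (2 + \<mu>) n / ?Y (1 + \<mu>) n)"
  have const: "(\<lambda>n. x) \<in> O(ipow 0)" for x :: complex by simp
  have s0: "s0 \<in> O(ipow 2)"
    unfolding s0_def by (rule bigo_ipow_linear, rule bigo_ipow_mono[where q = "Suc (Suc (Suc 0))"], intro bigo_ipow_div_linear const) auto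
  have s1: "s1 \<in> O(ipow 2)"
    unfolding s1_def by (intro bigo_ipow_linear, rule bigo_ipow_mono[where q = "Suc (Suc (Suc (Suc (Suc 0))))"], intro bigo_ipow_div_linear const) auto
  have s2: "s2 \<in> O(ipow 2)"
    unfolding s2_def by (intro bigo_ipow_linear, rule bigo_ipow_mono[where q = "Suc (Suc (Suc (Suc (Suc (Suc (Suc 0))))))"], intro bigo_ipow_div_linear const) auto
  have "(\<lambda>m. w m / bc \<alpha> m) \<in> O(ipow (N - k))"
    by (rule bigo_ipow_div_bc[OF \<alpha>(1) w]) (use k in auto)
  from bigo_ipow_shift[OF this, of 3]
  have "\<omega> \<in> O(ipow (Suc (Suc (Suc (Suc (N - k))))))"
    unfolding \<omega>_def by (intro bigo_ipow_div_linear) simp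
  hence \<omega>: "\<omega> \<in> O(ipow (Suc (N - k - 1)))" by (rule bigo_ipow_mono) simp
  have recH: "\<forall>\<^sub>F n in sequentially. H (n + 3) - H (n + 2) = s0 n * H (n + 2) + s1 n * H (n + 1) + s2 n * H n + \<omega> n"
    using eventually_of_nat_add_nonzero[of "3 - c"] eventually_of_nat_add_nonzero[of "3 + \<mu>"]
      eventually_of_nat_add_nonzero[of "2 + \<mu>"] eventually_of_nat_add_nonzero[of "1 + \<mu>"]
      eventually_of_nat_add_nonzero[of "2 - \<alpha>"] eventually_of_nat_add_nonzero[of "1 - \<alpha>"]
      eventually_of_nat_add_nonzero[of "- \<alpha>"]
  proof eventually_elim
    case (elim n)
    define x where "x = complex_of_nat n"
    have ne: "x + 1 \<noteq> 0" "x + 2 \<noteq> 0" "x + 3 \<noteq> 0"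
      using of_nat_neq_0[of n, where 'a = complex] of_nat_neq_0[of "n + 1", where 'a = complex]
        of_nat_neq_0[of "n + 2", where 'a = complex] by (simp_all add: x_def add_ac)
    define B where "B = bc \<alpha> (n + 3)"
    have B: "B \<noteq> 0" using bc0 by (simp add: B_def)
    note ne' = elim[folded x_def]
    \<comment> \<open>All binomial values are expressed through the one at n + 3, so that division
      by \<open>P * B\<close> leaves rational functions of x.\<close>
    have b2: "bc \<alpha> (n + 2) = B * (x + 3) / (x + (2 - \<alpha>))"
      using bc_Suc[of \<alpha> "n + 2"] ne ne' by (simp add: B_def x_def numeral_3_eq_3 field_simps)
    have b1: "bc \<alpha> (n + 1) = B * (x + 3) * (x + 2) / ((x + (2 - \<alpha>)) * (x + (1 - \<alpha>)))"
    proof -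
      have "bc \<alpha> (n + 1) = bc \<alpha> (n + 2) * (x + 2) / (x + (1 - \<alpha>))"
        using bc_Suc[of \<alpha> "n + 1"] ne ne' by (simp add: x_def field_simps)
      thus ?thesis unfolding b2 by simp
    qed
    have b0: "bc \<alpha> n = B * (x + 3) * (x + 2) * (x + 1) / ((x + (2 - \<alpha>)) * (x + (1 - \<alpha>)) * (x + - \<alpha>))"
    proof -
      have "bc \<alpha> n = bc \<alpha> (n + 1) * (x + 1) / (x + - \<alpha>)"
        using bc_Suc[of \<alpha> "n"] ne ne' by (simp add: x_def field_simps)
      thus ?thesis unfolding b1 by simp
    qed
    define P where "P = (x + (3 - c)) * (x + (3 + \<mu>)) * (x + (2 + \<mu>)) * (x + (1 + \<mu>))"
    have P: "P \<noteq> 0" using ne' by (simp add: P_def)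
    have main: "P * (H (n + 3) * B) = (x + 3 + t + l) * (x + 3 + t - l) * (x + (2 + \<mu>)) * (x + (1 + \<mu>)) * (H (n + 2) * bc \<alpha> (n + 2))
        - k1 * (x + (1 + \<mu>)) * (H (n + 1) * bc \<alpha> (n + 1)) - k2 * (H n * bc \<alpha> n) + w (n + 3)"
      using rec[of "n + 3"]
      by (simp add: main_op_def lin_def h numeral_3_eq_3 P_def B_def x_def algebra_simps)
    have "H (n + 3) = (P * (H (n + 3) * B)) / (P * B)" using P B by simp
    also have "\<dots> = (x + 3 + t + l) * (x + 3 + t - l) * (x + (2 + \<mu>)) * (x + (1 + \<mu>)) * (bc \<alpha> (n + 2) / (P * B)) * H (n + 2)
        + (- k1) * (x + (1 + \<mu>)) * (bc \<alpha> (n + 1) / (P * B)) * H (n + 1)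
        + (- k2) * (bc \<alpha> n / (P * B)) * H n + w (n + 3) / (P * B)"
      unfolding main by (simp add: add_divide_distrib diff_divide_distrib mult_ac)
    also have "(x + 3 + t + l) * (x + 3 + t - l) * (x + (2 + \<mu>)) * (x + (1 + \<mu>)) * (bc \<alpha> (n + 2) / (P * B))
        = ((x + 3 + t + l) * (x + 3 + t - l) * (x + 3)) / ((x + (3 - c)) * (x + (3 + \<mu>)) * (x + (2 - \<alpha>)))"
      unfolding b2 P_def using B ne' by (simp add: mult_ac)
    also have "(x + 3 + t + l) * (x + 3 + t - l) * (x + 3)
        = (x + (3 - c)) * (x + (3 + \<mu>)) * (x + (2 - \<alpha>)) + (e1 * x + (3 * e1 + e0))"
    proof -
      have \<alpha>': "\<alpha> = \<mu> - 1 - c - 2 * t" using exponent by (simp add: algebra_simps)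
      show ?thesis unfolding e1_def e0_def \<alpha>' by (simp add: algebra_simps power2_eq_square)
    qed
    also have "((x + (3 - c)) * (x + (3 + \<mu>)) * (x + (2 - \<alpha>)) + (e1 * x + (3 * e1 + e0)))
        / ((x + (3 - c)) * (x + (3 + \<mu>)) * (x + (2 - \<alpha>))) = 1 + s0 n"
      unfolding s0_def using ne' by (simp add: add_divide_distrib flip: x_def)
    also have "(- k1) * (x + (1 + \<mu>)) * (bc \<alpha> (n + 1) / (P * B)) = s1 n"
      unfolding s1_def b1 P_def x_def[symmetric] using B ne' by (simp add: mult_ac)
    also have "(- k2) * (bc \<alpha> n / (P * B)) = s2 n"
      unfolding s2_def b0 P_def x_def[symmetric] using B ne' by (simp add: mult_ac)
    also have "w (n + 3) / (P * B) = \<omega> n"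
      unfolding \<omega>_def P_def x_def[symmetric] B_def by (simp add: mult_ac)
    finally show ?case by (simp add: algebra_simps)
  qed
  have N1: "1 \<le> N - k - 1" using k by simp
  obtain C where C: "H \<longlonglongrightarrow> C"
    using recurrence_asymptotics(1)[OF recH s0 s1 s2 \<omega> N1] by (auto simp: convergent_def)
  hence "C = 0"
    by (intro regular_upto_leading_coeff_0[OF reg _ \<alpha>]) (simp add: H_def)
  hence "H \<in> O(ipow (N - k - 1))"
    using recurrence_asymptotics(2)[OF recH s0 s1 s2 \<omega> N1] C by simp
  hence "(\<lambda>m. H m * bc \<alpha> m) \<in> O(ipow (N - k - 1 - k))"
    by (rule bigo_ipow_mult_bc) (use k in auto)
  moreover have "N - k - 1 - k = N - 2 * k - 1" by simp
  moreover have "h = (\<lambda>m. H m * bc \<alpha> m)" using h by (rule ext)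
  ultimately show ?thesis by (simp only:)
qed

text \<open>Since the true coefficients satisfy the recurrence, the residual \<open>r\<close> is, up
  to sign, the same combination of operators applied to the predictions alone, hence a combination
  of binomial sequences. It is also built from regular errors. Both facts together make it small,
  and it becomes part of the inhomogeneity in the recurrence for the error.\<close>

lemma truncation_error_step:
  fixes g g1 g2 p p1 p2 :: "nat \<Rightarrow> complex"
  assumes rec: "\<And>m. main_op c t l \<mu> k1 k2 g m = lower_op \<mu> a1 b1 d1 d2 g1 m + lower_op \<mu> a2 b2 d3 d4 g2 m"
    and span: "p \<in> bc_span \<beta>" "p1 \<in> bc_span \<beta>" "p2 \<in> bc_span \<beta>" and nonint: "\<And>i. \<beta> + of_int i / 3 \<notin> \<int>"
    and reg: "regular_upto (N + 4) (\<lambda>m. g m - p m)" "regular_upto (N + 4) (\<lambda>m. g1 m - p1 m)"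
      "regular_upto (N + 4) (\<lambda>m. g2 m - p2 m)"
    and low: "(\<lambda>m. g1 m - p1 m) \<in> O(ipow (N + 3))" "(\<lambda>m. g2 m - p2 m) \<in> O(ipow (N + 3))"
    and \<alpha>: "\<alpha> \<notin> \<int>" "2 * t + c - \<mu> + 1 + \<alpha> = 0"
    and k: "\<bar>Re \<alpha>\<bar> + 1 \<le> real k" "2 * k + 2 \<le> N"
  shows "(\<lambda>m. g m - p m) \<in> O(ipow (N - 2 * k - 1))"
proof -
  let ?M = "main_op c t l \<mu> k1 k2" and ?L1 = "lower_op \<mu> a1 b1 d1 d2" and ?L2 = "lower_op \<mu> a2 b2 d3 d4"
  define r where "r = (\<lambda>m. ?M (\<lambda>m. g m - p m) m + (-1) * ?L1 (\<lambda>m. g1 m - p1 m) m + (-1) * ?L2 (\<lambda>m. g2 m - p2 m) m)"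
  have "r = (\<lambda>m. (-1) * ?M p m + ?L1 p1 m + ?L2 p2 m)"
    by (simp add: r_def main_op_diff lower_op_diff rec algebra_simps)
  hence "r \<in> bc_span \<beta>"
    by (simp only:) (intro bc_span_add bc_span_scale main_op_bc_span lower_op_bc_span span)
  moreover have "regular_upto N r"
    unfolding r_def by (intro regular_upto_add regular_upto_scale main_op_regular lower_op_regular reg)
  ultimately have r: "r \<in> O(ipow N)" using nonint by (intro bc_span_regular_small)
  define w where "w = (\<lambda>m. r m + ?L1 (\<lambda>m. g1 m - p1 m) m + ?L2 (\<lambda>m. g2 m - p2 m) m)"
  have w: "w \<in> O(ipow N)"
    unfolding w_def by (intro sum_in_bigo r lower_op_bigo low)
  show ?thesis
  proof (rule decay_from_recurrence[OF _ w _ \<alpha>(1) _ \<alpha>(2) k])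
    show "?M (\<lambda>m. g m - p m) m = w m" for m by (simp add: w_def r_def)
    show "regular_upto (N + 4) (\<lambda>m. g m - p m)" by fact
    show "Re \<alpha> < real (N + 4)" using k by simp
  qed
qed

text \<open>Induction on n1 + n2, as the recurrence couples (n1, n2) to the pairs with one index
  lowered. The order N varies in the induction because the step consumes an amount that depends on
  (n1, n2).\<close>

lemma truncation_error_decay:
  fixes g :: "nat \<Rightarrow> nat \<Rightarrow> nat \<Rightarrow> complex" and p :: "nat \<Rightarrow> nat \<Rightarrow> nat \<Rightarrow> nat \<Rightarrow> complex"
  assumes rec: "\<And>n1 n2 m. main_op (c n1 n2) (t n1 n2) l \<mu> k1 k2 (g n1 n2) m =
      lower_op \<mu> (a1 n1 n2) (b1 n1 n2) d1 d2 (if n1 = 0 then \<lambda>_. 0 else g (n1 - 1) n2) m +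
      lower_op \<mu> (a2 n1 n2) (b2 n1 n2) d3 d4 (if n2 = 0 then \<lambda>_. 0 else g n1 (n2 - 1)) m"
    and span: "\<And>M n1 n2. p M n1 n2 \<in> bc_span \<beta>" and nonint: "\<And>i. \<beta> + of_int i / 3 \<notin> \<int>"
    and reg: "\<And>n1 n2 b. \<exists>M0. \<forall>M\<ge>M0. regular_upto b (\<lambda>m. g n1 n2 m - p M n1 n2 m)"
    and \<alpha>: "\<And>n1 n2. \<alpha> n1 n2 \<notin> \<int>" "\<And>n1 n2. 2 * t n1 n2 + c n1 n2 - \<mu> + 1 + \<alpha> n1 n2 = 0"
  shows "\<exists>M0. \<forall>M\<ge>M0. (\<lambda>m. g n1 n2 m - p M n1 n2 m) \<in> O(ipow N)"
proof (induction "n1 + n2" arbitrary: n1 n2 N rule: less_induct)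
  case less
  define k where "k = nat \<lceil>\<bar>Re (\<alpha> n1 n2)\<bar> + 1\<rceil>"
  \<comment> \<open>Satisfies 2k + 2 \<le> N' and leaves the order N + 1 after the loss of 2k +
    1.\<close>
  define N' where "N' = N + 2 * k + 2"
  have k: "\<bar>Re (\<alpha> n1 n2)\<bar> + 1 \<le> real k" unfolding k_def by linarith
  let ?lower = "\<lambda>f::nat \<Rightarrow> nat \<Rightarrow> nat \<Rightarrow> complex. if n1 = 0 then (\<lambda>_. 0) else f (n1 - 1) n2"
  let ?lower2 = "\<lambda>f::nat \<Rightarrow> nat \<Rightarrow> nat \<Rightarrow> complex. if n2 = 0 then (\<lambda>_. 0) else f n1 (n2 - 1)"
  have 1: "\<exists>M0. \<forall>M\<ge>M0. regular_upto (N' + 4) (\<lambda>m. ?lower g m - ?lower (p M) m)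
      \<and> (\<lambda>m. ?lower g m - ?lower (p M) m) \<in> O(ipow (N' + 3))"
  proof (cases "n1 = 0")
    case False
    then obtain M1 M2 where "\<forall>M\<ge>M1. regular_upto (N' + 4) (\<lambda>m. g (n1 - 1) n2 m - p M (n1 - 1) n2 m)"
      "\<forall>M\<ge>M2. (\<lambda>m. g (n1 - 1) n2 m - p M (n1 - 1) n2 m) \<in> O(ipow (N' + 3))"
      using reg less[of "n1 - 1" n2 "N' + 3"] by fastforce
    thus ?thesis using False by (intro exI[of _ "max M1 M2"]) simp
  qed (simp add: regular_upto_zero)
  have 2: "\<exists>M0. \<forall>M\<ge>M0. regular_upto (N' + 4) (\<lambda>m. ?lower2 g m - ?lower2 (p M) m)
      \<and> (\<lambda>m. ?lower2 g m - ?lower2 (p M) m) \<in> O(ipow (N' + 3))"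
  proof (cases "n2 = 0")
    case False
    then obtain M1 M2 where "\<forall>M\<ge>M1. regular_upto (N' + 4) (\<lambda>m. g n1 (n2 - 1) m - p M n1 (n2 - 1) m)"
      "\<forall>M\<ge>M2. (\<lambda>m. g n1 (n2 - 1) m - p M n1 (n2 - 1) m) \<in> O(ipow (N' + 3))"
      using reg less[of n1 "n2 - 1" "N' + 3"] by fastforce
    thus ?thesis using False by (intro exI[of _ "max M1 M2"]) simp
  qed (simp add: regular_upto_zero)
  obtain M1 where M1: "\<forall>M\<ge>M1. regular_upto (N' + 4) (\<lambda>m. ?lower g m - ?lower (p M) m)
      \<and> (\<lambda>m. ?lower g m - ?lower (p M) m) \<in> O(ipow (N' + 3))" using 1 by blast
  obtain M2 where M2: "\<forall>M\<ge>M2. regular_upto (N' + 4) (\<lambda>m. ?lower2 g m - ?lower2 (p M) m)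
      \<and> (\<lambda>m. ?lower2 g m - ?lower2 (p M) m) \<in> O(ipow (N' + 3))" using 2 by blast
  obtain M3 where M3: "\<forall>M\<ge>M3. regular_upto (N' + 4) (\<lambda>m. g n1 n2 m - p M n1 n2 m)" using reg by blast
  show ?case
  proof (intro exI[of _ "max M1 (max M2 M3)"] allI impI)
    fix M assume M: "max M1 (max M2 M3) \<le> M"
    have "(\<lambda>m. g n1 n2 m - p M n1 n2 m) \<in> O(ipow (N' - 2 * k - 1))"
    proof (rule truncation_error_step[OF rec])
      show "?lower (p M) \<in> bc_span \<beta>" "?lower2 (p M) \<in> bc_span \<beta>"
        using span bc_span_zero by auto
    qed (use span nonint M M1 M2 M3 \<alpha> k in \<open>simp_all only: max.bounded_iff\<close>, simp_all add: N'_def)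
    thus "(\<lambda>m. g n1 n2 m - p M n1 n2 m) \<in> O(ipow N)"
      by (rule bigo_ipow_mono) (simp add: N'_def)
  qed
qed

section \<open>Local expansion at the boundary point\<close>

lemma norm_powr_complex_le: "norm (z powr w) \<le> norm z powr Re w * exp (\<bar>Im w\<bar> * pi)"
proof -
  have "- Im w * Arg z \<le> \<bar>Im w\<bar> * \<bar>Arg z\<bar>"
    by (metis abs_ge_self abs_minus_cancel abs_mult minus_mult_left)
  also have "\<dots> \<le> \<bar>Im w\<bar> * pi"
    using Arg_bounded[of z] by (intro mult_left_mono) auto
  finally show ?thesis unfolding norm_powr_complex by (intro mult_left_mono) auto
qed

lemma powser_holomorphic:
  fixes c :: "nat \<Rightarrow> complex"
  assumes "\<And>z. norm z < 1 \<Longrightarrow> summable (\<lambda>k. c k * z ^ k)"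
  shows "(\<lambda>z. \<Sum>k. c k * z ^ k) holomorphic_on ball 0 1"
proof (unfold holomorphic_on_open[OF open_ball], intro ballI)
  fix z :: complex assume "z \<in> ball 0 1"
  thus "\<exists>f'. ((\<lambda>z. \<Sum>k. c k * z ^ k) has_field_derivative f') (at z)"
    using powser_euler(1)[OF assms, of z] by auto
qed

text \<open>The tail is y^M times a power series that is continuous on the closed disc of radius
  1/2, hence bounded there.\<close>

lemma powser_tail_bounded:
  fixes f :: "nat \<Rightarrow> complex"
  assumes "\<And>y. norm y < 1 \<Longrightarrow> summable (\<lambda>k. f k * y ^ k)"
  shows "\<exists>C. \<forall>y. norm y \<le> 1 / 2 \<longrightarrow> norm ((\<Sum>k. f k * y ^ k) - (\<Sum>k<M. f k * y ^ k)) \<le> C * norm y ^ M"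
proof -
  have summ: "summable (\<lambda>k. f (k + M) * y ^ k)" if "norm y < 1" for y
  proof (cases "y = 0")
    case False
    have "summable (\<lambda>k. f (k + M) * y ^ (k + M) * inverse (y ^ M))"
      by (intro summable_mult2 summable_ignore_initial_segment assms that)
    moreover have "f (k + M) * y ^ (k + M) * inverse (y ^ M) = f (k + M) * y ^ k" for k
      using False by (simp add: power_add field_simps)
    ultimately show ?thesis by simp
  qed simp
  let ?t = "\<lambda>y. \<Sum>k. f (k + M) * y ^ k"
  have "continuous_on (cball 0 (1 / 2)) ?t"
    by (rule continuous_on_subset[OF holomorphic_on_imp_continuous_on[OF powser_holomorphic[OF summ]]]) auto
  hence "bounded (?t ` cball 0 (1 / 2))"
    by (intro compact_imp_bounded compact_continuous_image compact_cball)
  then obtain C where "\<forall>w\<in>?t ` cball 0 (1 / 2). norm w \<le> C"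
    unfolding bounded_iff by (rule exE)
  hence C: "norm (?t y) \<le> C" if "norm y \<le> 1 / 2" for y
    using that by simp
  have "norm ((\<Sum>k. f k * y ^ k) - (\<Sum>k<M. f k * y ^ k)) \<le> C * norm y ^ M" if y: "norm y \<le> 1 / 2" for y
  proof -
    have y1: "norm y < 1" using y by simp
    have "(\<Sum>k. f k * y ^ k) - (\<Sum>k<M. f k * y ^ k) = (\<Sum>k. f (k + M) * y ^ (k + M))"
      using suminf_split_initial_segment[OF assms[OF y1], of M] by simp
    also have "\<dots> = ?t y * y ^ M"
      using suminf_mult2[OF summ[OF y1], of "y ^ M"] by (simp add: power_add mult_ac)
    finally show ?thesis using C[OF y] by (simp add: norm_mult norm_power mult_right_mono)
  qed
  thus ?thesis by blast
qed

text \<open>The expansion is given on a real segment only, whereas regularity asks for a cone. Both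
  sides are holomorphic on the intersection of the unit disc with the disc around 1, so the identity
  theorem carries the expansion over. What the truncation omits is of size |1-z|^(Re \<alpha> + M),
  up to a constant.\<close>

lemma regular_upto_of_expansion:
  fixes a :: "nat \<Rightarrow> complex" and \<alpha> :: "'q \<Rightarrow> complex" and f :: "'q \<Rightarrow> nat \<Rightarrow> complex"
  assumes Q: "finite Q"
    and summ: "\<And>z. norm z < 1 \<Longrightarrow> summable (\<lambda>m. a m * z ^ m)"
    and fsumm: "\<And>q y. q \<in> Q \<Longrightarrow> norm y < 1 \<Longrightarrow> summable (\<lambda>k. f q k * y ^ k)"
    and u: "u holomorphic_on ball 1 \<delta>" and \<delta>: "0 < \<delta>" "\<delta> \<le> 1"
    and eq: "\<And>x. 1 - \<delta> < x \<Longrightarrow> x < 1 \<Longrightarrow> (\<Sum>m. a m * of_real x ^ m) =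
        (\<Sum>q\<in>Q. (1 - of_real x) powr \<alpha> q * (\<Sum>k. f q k * (1 - of_real x) ^ k)) + u (of_real x)"
    and M: "\<And>q. q \<in> Q \<Longrightarrow> real b \<le> Re (\<alpha> q) + real M"
  shows "regular_upto b (\<lambda>m. a m - (\<Sum>q\<in>Q. \<Sum>k<M. f q k * bc (\<alpha> q + of_nat k) m))"
proof -
  let ?A = "\<lambda>z. \<Sum>m. a m * z ^ m" and ?F = "\<lambda>q y. \<Sum>k. f q k * y ^ k"
  let ?p = "\<lambda>m. \<Sum>q\<in>Q. \<Sum>k<M. f q k * bc (\<alpha> q + of_nat k) m"
  define S where "S = ball (0 :: complex) 1 \<inter> ball 1 \<delta>"
  have S: "open S" "connected S"
    unfolding S_def by (auto intro!: convex_connected convex_Int)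
  have S_re: "Re (1 - z) > 0" and S1: "norm z < 1" "norm (1 - z) < 1" "z \<in> ball 1 \<delta>" if "z \<in> S" for z
    using that \<delta> complex_Re_le_cmod[of z] by (auto simp: S_def dist_norm norm_minus_commute)
  have Fhol: "(\<lambda>z. ?F q (1 - z)) holomorphic_on S" if "q \<in> Q" for q
  proof -
    have "(?F q \<circ> (\<lambda>z. 1 - z)) holomorphic_on S"
      by (rule holomorphic_on_compose_gen[OF _ powser_holomorphic[OF fsumm[OF that]]])
        (use S1 in \<open>auto intro!: holomorphic_intros\<close>)
    thus ?thesis by (simp add: o_def)
  qed
  \<comment> \<open>1 - z stays in the right half-plane, away from the branch cut of
    \<open>powr\<close>.\<close>
  have not_nonpos: "1 - z \<notin> \<real>\<^sub>\<le>\<^sub>0" if "z \<in> S" for z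
    using S_re[OF that] by (auto simp: complex_nonpos_Reals_iff)
  define G where "G = (\<lambda>z. ?A z - ((\<Sum>q\<in>Q. (1 - z) powr \<alpha> q * ?F q (1 - z)) + u z))"
  have Ghol: "G holomorphic_on S"
    unfolding G_def
    by (intro holomorphic_intros Fhol holomorphic_on_subset[OF powser_holomorphic[OF summ]] holomorphic_on_subset[OF u])
      (use not_nonpos S1 in auto)
  have G0: "G z = 0" if "z \<in> S" for z
  proof (rule analytic_continuation[OF Ghol S, of "of_real ` {1 - \<delta><..<1}"])
    have x: "norm (complex_of_real x) < 1" "norm (1 - complex_of_real x) < \<delta>" if "1 - \<delta> < x" "x < 1" for x
    proof -
      have "norm (1 - complex_of_real x) = norm (complex_of_real (1 - x))" by simp
      also have "\<dots> = 1 - x" using that by (simp only: norm_of_real)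
      finally show "norm (1 - complex_of_real x) < \<delta>" using that by simp
    qed (use that \<delta> in auto)
    show sub: "complex_of_real ` {1 - \<delta><..<1} \<subseteq> S"
      using x by (auto simp: S_def dist_norm)
    show "complex_of_real (1 - \<delta> / 2) \<in> S"
      using \<delta> by (intro subsetD[OF sub] imageI) auto
    show "complex_of_real (1 - \<delta> / 2) islimpt complex_of_real ` {1 - \<delta><..<1}"
    proof -
      have "(1 - \<delta> / 2) islimpt {1 - \<delta><..<1}"
        using \<delta> by (intro interior_limit_point) auto
      thus ?thesis
      proof (rule islimpt_isCont_image)
        show "\<forall>\<^sub>F y in at (1 - \<delta> / 2). complex_of_real y \<noteq> complex_of_real (1 - \<delta> / 2)"
          by (rule eventually_mono[OF eventually_neq_at_within[of "1 - \<delta> / 2"]]) (metis of_real_eq_iff)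
      qed (intro continuous_intros)
    qed
    show "G w = 0" if "w \<in> complex_of_real ` {1 - \<delta><..<1}" for w
      using that eq by (auto simp: G_def)
  qed (use that in auto)
  have "\<exists>C. \<forall>y. norm y \<le> 1 / 2 \<longrightarrow> norm (?F q y - (\<Sum>k<M. f q k * y ^ k)) \<le> C * norm y ^ M" if "q \<in> Q" for q
    by (rule powser_tail_bounded[OF fsumm[OF that]])
  then obtain C where C: "\<And>q y. q \<in> Q \<Longrightarrow> norm y \<le> 1 / 2 \<Longrightarrow> norm (?F q y - (\<Sum>k<M. f q k * y ^ k)) \<le> C q * norm y ^ M"
    by metis
  have psums: "(\<lambda>m. ?p m * z ^ m) sums (\<Sum>q\<in>Q. \<Sum>k<M. f q k * (1 - z) powr (\<alpha> q + of_nat k))" if "norm z < 1" for z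
  proof -
    have "(\<lambda>m. \<Sum>q\<in>Q. \<Sum>k<M. f q k * (bc (\<alpha> q + of_nat k) m * z ^ m)) sums (\<Sum>q\<in>Q. \<Sum>k<M. f q k * (1 - z) powr (\<alpha> q + of_nat k))"
      by (intro sums_sum sums_mult bc_sums that)
    thus ?thesis by (simp add: sum_distrib_right mult.assoc)
  qed
  have summ': "summable (\<lambda>m. (a m - ?p m) * z ^ m)" if "norm z < 1" for z
    using summable_diff[OF summ[OF that] sums_summable[OF psums[OF that]]] by (simp add: left_diff_distrib)
  have eq': "(\<Sum>m. (a m - ?p m) * z ^ m) - u z = (\<Sum>q\<in>Q. (1 - z) powr \<alpha> q * (?F q (1 - z) - (\<Sum>k<M. f q k * (1 - z) ^ k)))"
    if z: "z \<in> S" for z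
  proof -
    have nz: "1 - z \<noteq> 0" using S_re[OF z] by auto
    have "(\<lambda>m. a m * z ^ m - ?p m * z ^ m) sums (?A z - (\<Sum>q\<in>Q. \<Sum>k<M. f q k * (1 - z) powr (\<alpha> q + of_nat k)))"
      by (intro sums_diff psums summable_sums summ S1(1)[OF z])
    hence "(\<Sum>m. (a m - ?p m) * z ^ m) = ?A z - (\<Sum>q\<in>Q. \<Sum>k<M. f q k * (1 - z) powr (\<alpha> q + of_nat k))"
      by (simp add: sums_iff left_diff_distrib)
    moreover have "(\<Sum>k<M. f q k * (1 - z) powr (\<alpha> q + of_nat k)) = (1 - z) powr \<alpha> q * (\<Sum>k<M. f q k * (1 - z) ^ k)" for q
      using nz by (simp add: powr_add powr_nat' sum_distrib_left mult_ac)
    moreover have "?A z = (\<Sum>q\<in>Q. (1 - z) powr \<alpha> q * ?F q (1 - z)) + u z"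
      using G0[OF z] by (simp add: G_def)
    ultimately show ?thesis by (simp add: right_diff_distrib sum_subtractf)
  qed
  define K where "K = (\<Sum>q\<in>Q. exp (\<bar>Im (\<alpha> q)\<bar> * pi) * \<bar>C q\<bar>)"
  \<comment> \<open>The radius is halved so that |1-z| < 1/2 on the cone, where the tail estimate is
    valid.\<close>
  have bound: "norm ((\<Sum>m. (a m - ?p m) * z ^ m) - u z) \<le> (K * 2 ^ b) * (1 - x) ^ b"
    if x: "1 - (\<delta> / 2) / 2 < x" "x < 1" "norm (z - of_real x) < 1 * (1 - x)" for x z
  proof -
    have cb: "norm z < 1" "norm (1 - z) < \<delta> / 2" "norm (1 - z) \<le> 2 * (1 - x)"
      using cone_bounds[OF _ _ x] \<delta> by auto
    hence z: "z \<in> S" using \<delta> by (simp add: S_def dist_norm)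
    define y where "y = 1 - z"
    have y: "norm y \<le> 1 / 2" "y \<noteq> 0" "norm y > 0" using cb \<delta> S_re[OF z] by (auto simp: y_def)
    have "norm ((\<Sum>m. (a m - ?p m) * z ^ m) - u z) \<le> (\<Sum>q\<in>Q. exp (\<bar>Im (\<alpha> q)\<bar> * pi) * \<bar>C q\<bar> * norm y ^ b)"
      unfolding eq'[OF z] y_def[symmetric]
    proof (rule sum_norm_le)
      fix q assume q: "q \<in> Q"
      have "norm (y powr \<alpha> q) \<le> norm y powr Re (\<alpha> q) * exp (\<bar>Im (\<alpha> q)\<bar> * pi)"
        by (rule norm_powr_complex_le)
      moreover have "norm (?F q y - (\<Sum>k<M. f q k * y ^ k)) \<le> \<bar>C q\<bar> * norm y ^ M"
        by (rule order_trans[OF C[OF q y(1)]]) (intro mult_right_mono, auto)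
      ultimately have "norm (y powr \<alpha> q * (?F q y - (\<Sum>k<M. f q k * y ^ k)))
          \<le> (norm y powr Re (\<alpha> q) * exp (\<bar>Im (\<alpha> q)\<bar> * pi)) * (\<bar>C q\<bar> * norm y ^ M)"
        unfolding norm_mult by (intro mult_mono) auto
      also have "\<dots> = exp (\<bar>Im (\<alpha> q)\<bar> * pi) * \<bar>C q\<bar> * (norm y powr (Re (\<alpha> q) + real M))"
        using y by (simp add: powr_add powr_realpow)
      also have "norm y powr (Re (\<alpha> q) + real M) \<le> norm y powr real b"
        using y M[OF q] by (intro powr_mono') auto
      also have "norm y powr real b = norm y ^ b" using y by (simp add: powr_realpow)
      finally show "norm (y powr \<alpha> q * (?F q y - (\<Sum>k<M. f q k * y ^ k))) \<le> exp (\<bar>Im (\<alpha> q)\<bar> * pi) * \<bar>C q\<bar> * norm y ^ b"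
        by (simp add: mult_left_mono)
    qed
    also have "\<dots> = K * norm y ^ b" by (simp add: K_def sum_distrib_right)
    also have "\<dots> \<le> K * (2 * (1 - x)) ^ b"
      using cb by (intro mult_left_mono power_mono) (auto simp: y_def K_def intro!: sum_nonneg)
    finally show ?thesis unfolding power_mult_distrib by (simp only: mult.assoc)
  qed
  show ?thesis
  proof (rule regular_uptoI[OF summ' _ _ _ _ _ bound, where c = 1])
    show "u holomorphic_on ball 1 (\<delta> / 2)" using u by (rule holomorphic_on_subset) (use \<delta> in auto)
  qed (use \<delta> in simp_all)
qed

section \<open>Laurent coefficients as limits of averages over roots of unity\<close>

text \<open>Finite averages replace contour integrals: they commute with unordered infinite sums and
  preserve holomorphy by finite additivity alone. The price is aliasing, which disappears as N
  grows.\<close>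

definition circle_avg :: "nat \<Rightarrow> (complex \<Rightarrow> complex) \<Rightarrow> complex" where
  "circle_avg N F = (\<Sum>a<N. F (cis (2 * pi * real a / real N))) / of_nat N"

lemma circle_avg_cmult: "circle_avg N (\<lambda>\<zeta>. c * F \<zeta>) = c * circle_avg N F"
  by (simp add: circle_avg_def sum_distrib_left)

lemma circle_avg_cong: "(\<And>\<zeta>. norm \<zeta> = 1 \<Longrightarrow> F \<zeta> = G \<zeta>) \<Longrightarrow> circle_avg N F = circle_avg N G"
  by (simp add: circle_avg_def)

lemma circle_avg_diff: "circle_avg N (\<lambda>\<zeta>. F \<zeta> - G \<zeta>) = circle_avg N F - circle_avg N G"
  by (simp add: circle_avg_def sum_subtractf diff_divide_distrib)

lemma norm_circle_avg_le:
  assumes "\<And>\<zeta>. norm \<zeta> = 1 \<Longrightarrow> norm (F \<zeta>) \<le> B" "0 \<le> B"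
  shows "norm (circle_avg N F) \<le> B"
proof (cases "N = 0")
  case False
  have "norm (\<Sum>a<N. F (cis (2 * pi * real a / real N))) \<le> (\<Sum>a<N. B)"
    by (intro sum_norm_le assms) simp
  thus ?thesis using False by (simp add: circle_avg_def norm_divide field_simps)
qed (simp add: circle_avg_def assms)

text \<open>Orthogonality of roots of unity; |k| < N leaves 0 as the only exponent divisible by
  N.\<close>

lemma circle_avg_powi:
  assumes "\<bar>k\<bar> < int N"
  shows "circle_avg N (\<lambda>\<zeta>. \<zeta> powi k) = (if k = 0 then 1 else 0)"
proof (cases "k = 0")
  case False
  define v where "v = cis (2 * pi * of_int k / real N)"
  have N: "N > 0" using assms by auto
  have "v ^ N = cis (2 * pi * of_int k)"
    using N by (simp add: v_def Complex.DeMoivre del: cis_multiple_2pi)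
  also have "\<dots> = 1" by (rule cis_multiple_2pi) simp
  finally have vN: "v ^ N = 1" .
  have "v \<noteq> 1"
  proof
    assume "v = 1"
    then obtain n :: int where "2 * pi * of_int k / real N = of_int n * (2 * pi)"
      unfolding v_def cis_eq_1_iff by blast
    hence "real_of_int k = of_int (n * int N)" using N by (simp add: field_simps)
    hence "k = n * int N" by (simp only: of_int_eq_iff)
    hence "\<bar>k\<bar> = \<bar>n\<bar> * int N" by (simp add: abs_mult)
    moreover have "n \<noteq> 0" using \<open>k = n * int N\<close> False by auto
    ultimately have "\<bar>k\<bar> \<ge> 1 * int N" by (simp only:) (intro mult_right_mono, auto)
    thus False using assms by simp
  qed
  hence "(\<Sum>a<N. v ^ a) = 0"
    using vN by (simp add: geometric_sum)
  moreover have "cis (2 * pi * real a / real N) powi k = v ^ a" for a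
    by (simp add: v_def cis_power_int Complex.DeMoivre mult_ac)
  ultimately show ?thesis using False by (simp add: circle_avg_def)
qed (use assms in \<open>simp add: circle_avg_def\<close>)

lemma has_sum_finite_sum:
  fixes f :: "'a \<Rightarrow> 'i \<Rightarrow> complex"
  assumes "finite A" "\<And>a. a \<in> A \<Longrightarrow> (f a has_sum s a) I"
  shows "((\<lambda>i. \<Sum>a\<in>A. f a i) has_sum (\<Sum>a\<in>A. s a)) I"
  using assms by (induction A rule: finite_induct) (auto intro: has_sum_add)

lemma circle_avg_has_sum:
  assumes "\<And>\<zeta>. norm \<zeta> = 1 \<Longrightarrow> ((\<lambda>i. f i \<zeta>) has_sum F \<zeta>) I"
  shows "((\<lambda>i. circle_avg N (f i)) has_sum circle_avg N F) I"
  unfolding circle_avg_def divide_inverse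
  by (intro has_sum_cmult_left has_sum_finite_sum assms) auto

lemma circle_avg_sums:
  assumes "\<And>\<zeta>. norm \<zeta> = 1 \<Longrightarrow> (\<lambda>i. f i \<zeta>) sums F \<zeta>"
  shows "(\<lambda>i. circle_avg N (f i)) sums circle_avg N F"
  unfolding circle_avg_def by (intro sums_divide sums_sum assms) auto

text \<open>
  The coefficient of $w^{-A}$ in the expansion of $(w+c)^{-a}$ at infinity.
\<close>

definition laurent_coeff :: "nat \<Rightarrow> nat \<Rightarrow> complex \<Rightarrow> complex" where
  "laurent_coeff a A c = (if a \<le> A then bc (- of_nat a) (A - a) * (- c) ^ (A - a) else 0)"

text \<open>At finite N the average also picks up the powers of \<zeta> whose exponent is a nonzero
  multiple of N. Absolute convergence of the Laurent series on the circle allows passing to the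
  limit termwise by Tannery's theorem, and only the exponent 0 survives.\<close>

lemma circle_avg_laurent_coeff:
  assumes R: "norm c < R"
  shows "(\<lambda>N. circle_avg N (\<lambda>\<zeta>. (of_real R * \<zeta>) ^ A / (of_real R * \<zeta> + c) ^ a)) \<longlonglongrightarrow> laurent_coeff a A c"
proof -
  have R0: "R > 0" using R norm_ge_zero[of c] by linarith
  define r where "r = complex_of_real R"
  have r: "r \<noteq> 0" "norm r = R" using R0 by (auto simp: r_def)
  define d where "d = (\<lambda>p. r ^ A / r ^ a * (bc (- of_nat a) p * (- c / r) ^ p))"
  define k where "k = (\<lambda>p. int A - int a - int p)"
  have ncr: "norm (- c / r) < 1" using R R0 r by (simp add: norm_divide)
  have expand: "(\<lambda>p. d p * \<zeta> powi (k p)) sums ((r * \<zeta>) ^ A / (r * \<zeta> + c) ^ a)" if \<zeta>: "norm \<zeta> = 1" for \<zeta>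
  proof -
    have z0: "\<zeta> \<noteq> 0" using \<zeta> by auto
    let ?z = "- c / (r * \<zeta>)"
    have "norm ?z < 1" using ncr \<zeta> by (simp add: norm_divide norm_mult)
    hence "(\<lambda>p. bc (- of_nat a) p * ?z ^ p) sums (1 - ?z) powr (- of_nat a)" by (rule bc_sums)
    hence "(\<lambda>p. ((r * \<zeta>) ^ A / (r * \<zeta>) ^ a) * (bc (- of_nat a) p * ?z ^ p)) sums
        (((r * \<zeta>) ^ A / (r * \<zeta>) ^ a) * (1 - ?z) powr (- of_nat a))" by (rule sums_mult)
    moreover have "((r * \<zeta>) ^ A / (r * \<zeta>) ^ a) * (bc (- of_nat a) p * ?z ^ p) = d p * \<zeta> powi (k p)" for p
    proof -
      have "?z ^ p = (- c / r) ^ p / \<zeta> ^ p"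
        by (simp only: power_divide power_mult_distrib divide_divide_eq_left)
      thus ?thesis using z0 r unfolding d_def k_def
        by (simp only: power_mult_distrib) (simp add: power_int_diff mult_ac)
    qed
    moreover have "((r * \<zeta>) ^ A / (r * \<zeta>) ^ a) * (1 - ?z) powr (- of_nat a) = (r * \<zeta>) ^ A / (r * \<zeta> + c) ^ a"
    proof -
      have ne: "1 - ?z \<noteq> 0"
      proof
        assume "1 - ?z = 0"
        hence "1 = ?z" by (simp only: right_minus_eq)
        thus False using \<open>norm ?z < 1\<close> by (metis norm_one less_irrefl)
      qed
      have "(1 - ?z) powr (- of_nat a) = 1 / (1 - ?z) ^ a"
        using ne by (simp add: powr_minus powr_nat' divide_inverse)
      moreover have "r * \<zeta> + c = (r * \<zeta>) * (1 - ?z)" using r z0 by (simp add: field_simps)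
      ultimately show ?thesis by (simp add: power_mult_distrib)
    qed
    ultimately show ?thesis by simp
  qed
  have avg: "circle_avg N (\<lambda>\<zeta>. (r * \<zeta>) ^ A / (r * \<zeta> + c) ^ a) = (\<Sum>p. d p * circle_avg N (\<lambda>\<zeta>. \<zeta> powi (k p)))" for N
    using circle_avg_sums[of "\<lambda>p \<zeta>. d p * \<zeta> powi (k p)" "\<lambda>\<zeta>. (r * \<zeta>) ^ A / (r * \<zeta> + c) ^ a" N, OF expand]
    by (simp add: circle_avg_cmult sums_iff)
  have summ: "summable (\<lambda>p. norm (d p))"
  proof -
    have "summable (\<lambda>p. bc (- of_nat a) p * of_real (norm (- c / r)) ^ p)"
      using bc_sums[of "of_real (norm (- c / r))" "- of_nat a"] ncr by (auto simp: sums_iff)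
    hence "summable (\<lambda>p. norm (bc (- of_nat a) p * (- c / r) ^ p))"
      using powser_insidea[of "bc (- of_nat a)" "of_real ((norm (- c / r) + 1) / 2)" "- c / r"]
        bc_sums[of "of_real ((norm (- c / r) + 1) / 2)" "- of_nat a"] ncr
      by (auto simp: sums_iff simp del: norm_mult)
    from summable_mult[OF this, of "norm (r ^ A / r ^ a)"] show ?thesis
      by (simp only: d_def norm_mult)
  qed
  have "(\<lambda>N. \<Sum>p. d p * circle_avg N (\<lambda>\<zeta>. \<zeta> powi (k p))) \<longlonglongrightarrow> (\<Sum>p. d p * (if k p = 0 then 1 else 0))"
  proof (rule conjunct2[OF conjunct2[OF tannerys_theorem]])
    show "(\<lambda>N. d p * circle_avg N (\<lambda>\<zeta>. \<zeta> powi (k p))) \<longlonglongrightarrow> d p * (if k p = 0 then 1 else 0)" for p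
    proof (intro tendsto_mult tendsto_const)
      show "(\<lambda>N. circle_avg N (\<lambda>\<zeta>. \<zeta> powi (k p))) \<longlonglongrightarrow> (if k p = 0 then 1 else 0)"
      proof (rule tendsto_eventually, use eventually_gt_at_top[of "nat \<bar>k p\<bar>"] in eventually_elim)
        case (elim N)
        thus ?case by (intro circle_avg_powi) linarith
      qed
    qed
    have "norm (d p * circle_avg N (\<lambda>\<zeta>. \<zeta> powi (k p))) \<le> norm (d p)" for p N
    proof -
      have "norm (circle_avg N (\<lambda>\<zeta>. \<zeta> powi (k p))) \<le> 1"
        by (rule norm_circle_avg_le) (auto simp: norm_power_int)
      thus ?thesis unfolding norm_mult by (intro mult_left_le) auto
    qed
    thus "\<forall>\<^sub>F (p, N) in sequentially \<times>\<^sub>F sequentially. norm (d p * circle_avg N (\<lambda>\<zeta>. \<zeta> powi (k p))) \<le> norm (d p)"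
      by (intro always_eventually) auto
  qed (use summ in auto)
  moreover have "(\<Sum>p. d p * (if k p = 0 then 1 else 0)) = laurent_coeff a A c"
  proof (cases "a \<le> A")
    case True
    hence "(\<lambda>p. d p * (if k p = 0 then 1 else 0)) = (\<lambda>p. if p = A - a then d p else 0)"
      by (auto simp: k_def fun_eq_iff)
    moreover have "d (A - a) = laurent_coeff a A c"
    proof -
      have "r ^ A = r ^ a * r ^ (A - a)" using True by (simp flip: power_add)
      thus ?thesis using r True unfolding d_def laurent_coeff_def
        by (simp only: power_divide if_True) simp
    qed
    ultimately show ?thesis using sums_single[of "A - a" d] by (simp add: sums_iff)
  next
    case False
    hence "(\<lambda>p. d p * (if k p = 0 then 1 else 0)) = (\<lambda>p. 0)" by (auto simp: k_def)
    thus ?thesis using False by (simp add: laurent_coeff_def)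
  qed
  ultimately show ?thesis by (simp add: avg flip: r_def)
qed

text \<open>Dominated convergence for the counting measure.\<close>

lemma infsum_dominated_convergence:
  fixes f :: "nat \<Rightarrow> 'i \<Rightarrow> complex"
  assumes lim: "\<And>i. i \<in> I \<Longrightarrow> (\<lambda>N. f N i) \<longlonglongrightarrow> g i"
    and bound: "\<And>N i. i \<in> I \<Longrightarrow> norm (f N i) \<le> M i" and M: "M summable_on I"
  shows "(\<lambda>N. infsum (f N) I) \<longlonglongrightarrow> infsum g I"
proof -
  have nonneg: "M i \<ge> 0" if "i \<in> I" for i using bound[OF that, of 0] norm_ge_zero order_trans by blast
  have "(\<lambda>i. norm (M i)) summable_on I"
    using M by (rule summable_on_cong[THEN iffD1, rotated]) (use nonneg in auto)
  hence Mabs: "Infinite_Set_Sum.abs_summable_on M I" by (rule iffD1[OF abs_summable_equivalent])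
  hence Mint: "integrable (count_space I) M" by (simp add: Infinite_Set_Sum.abs_summable_on_def)
  have fg: "integrable (count_space I) g" "\<And>N. integrable (count_space I) (f N)"
    "(\<lambda>N. integral\<^sup>L (count_space I) (f N)) \<longlonglongrightarrow> integral\<^sup>L (count_space I) g"
  proof -
    have lim': "AE i in count_space I. (\<lambda>N. f N i) \<longlonglongrightarrow> g i"
      and bound': "\<And>N. AE i in count_space I. norm (f N i) \<le> M i"
      using lim bound by (auto simp: AE_count_space)
    show "integrable (count_space I) g"
      by (rule integrable_dominated_convergence[OF _ _ Mint lim' bound']) auto
    show "integrable (count_space I) (f N)" for N
      by (rule integrable_dominated_convergence2[OF _ _ Mint lim' bound']) auto
    show "(\<lambda>N. integral\<^sup>L (count_space I) (f N)) \<longlonglongrightarrow> integral\<^sup>L (count_space I) g"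
      by (rule integral_dominated_convergence[OF _ _ Mint lim' bound']) auto
  qed
  have "integral\<^sup>L (count_space I) h = infsum h I" if "integrable (count_space I) h" for h :: "'i \<Rightarrow> complex"
    using infsetsum_infsum[of h I] that by (simp add: Infinite_Set_Sum.abs_summable_on_def infsetsum_def)
  thus ?thesis using fg by simp
qed

lemma norm_laurent_term_le:
  fixes c \<zeta> :: complex
  assumes "norm c < R" "norm \<zeta> = 1"
  shows "norm ((of_real R * \<zeta>) ^ A / (of_real R * \<zeta> + c) ^ a) \<le> R ^ A / (R - norm c) ^ a"
proof -
  have R: "R > 0" using assms norm_ge_zero[of c] by linarith
  have "R - norm c \<le> norm (of_real R * \<zeta> + c)"
    using norm_diff_ineq[of "of_real R * \<zeta>" c] R assms by (simp add: norm_mult)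
  hence "(R - norm c) ^ a \<le> norm (of_real R * \<zeta> + c) ^ a"
    using assms by (intro power_mono) auto
  moreover have "(R - norm c) ^ a > 0" using assms by simp
  ultimately have "R ^ A / norm (of_real R * \<zeta> + c) ^ a \<le> R ^ A / (R - norm c) ^ a"
    using R by (intro divide_left_mono mult_pos_pos) auto
  thus ?thesis using R assms by (simp add: norm_divide norm_power norm_mult)
qed

text \<open>On the two circles the denominators are at least the corresponding powers of R - |c1|
  and R - |c2|. This gives a summable majorant independent of N, which permits the limit inside the
  unordered sum.\<close>

lemma circle_avg_extraction:
  fixes d :: "'i \<Rightarrow> complex" and a b :: "'i \<Rightarrow> nat"
  assumes c: "norm c1 < R" "norm c2 < R"
    and summ: "(\<lambda>i. norm (d i) / ((R - norm c1) ^ a i * (R - norm c2) ^ b i)) summable_on I"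
  shows "(\<lambda>N. circle_avg N (\<lambda>\<zeta>1. circle_avg N (\<lambda>\<zeta>2. (of_real R * \<zeta>1) ^ A * (of_real R * \<zeta>2) ^ B *
      infsum (\<lambda>i. d i / ((of_real R * \<zeta>1 + c1) ^ a i * (of_real R * \<zeta>2 + c2) ^ b i)) I)))
      \<longlonglongrightarrow> infsum (\<lambda>i. d i * laurent_coeff (a i) A c1 * laurent_coeff (b i) B c2) I"
proof -
  define f where "f = (\<lambda>i \<zeta>. (of_real R * \<zeta>) ^ A / (of_real R * \<zeta> + c1) ^ a i)"
  define g where "g = (\<lambda>i \<zeta>. (of_real R * \<zeta>) ^ B / (of_real R * \<zeta> + c2) ^ b i)"
  define M where "M = (\<lambda>i. norm (d i) * (R ^ A / (R - norm c1) ^ a i) * (R ^ B / (R - norm c2) ^ b i))"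
  have "(\<lambda>i. (R ^ A * R ^ B) * (norm (d i) / ((R - norm c1) ^ a i * (R - norm c2) ^ b i))) summable_on I"
    by (intro summable_on_cmult_right summ)
  hence M: "M summable_on I" by (simp add: M_def mult_ac)
  have fb: "norm (f i \<zeta>) \<le> R ^ A / (R - norm c1) ^ a i" if "norm \<zeta> = 1" for i \<zeta>
    unfolding f_def by (rule norm_laurent_term_le[OF c(1) that])
  have gb: "norm (g i \<zeta>) \<le> R ^ B / (R - norm c2) ^ b i" if "norm \<zeta> = 1" for i \<zeta>
    unfolding g_def by (rule norm_laurent_term_le[OF c(2) that])
  have R: "R \<ge> 0" using c(1) norm_ge_zero[of c1] by linarith
  have nn: "0 \<le> R ^ A / (R - norm c1) ^ a i" "0 \<le> R ^ B / (R - norm c2) ^ b i" for i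
    using R c by auto
  have hs: "((\<lambda>i. d i * f i \<zeta>1 * g i \<zeta>2) has_sum
      ((of_real R * \<zeta>1) ^ A * (of_real R * \<zeta>2) ^ B *
        infsum (\<lambda>i. d i / ((of_real R * \<zeta>1 + c1) ^ a i * (of_real R * \<zeta>2 + c2) ^ b i)) I)) I"
    if z: "norm \<zeta>1 = 1" "norm \<zeta>2 = 1" for \<zeta>1 \<zeta>2
  proof -
    let ?h = "\<lambda>i. d i / ((of_real R * \<zeta>1 + c1) ^ a i * (of_real R * \<zeta>2 + c2) ^ b i)"
    have "norm (?h i) \<le> norm (d i) / ((R - norm c1) ^ a i * (R - norm c2) ^ b i)" for i
      using mult_mono[OF norm_laurent_term_le[OF c(1) z(1), of 0 "a i"] norm_laurent_term_le[OF c(2) z(2), of 0 "b i"]] c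
        mult_left_mono[of _ _ "norm (d i)"]
      by (fastforce simp: norm_mult norm_divide)
    hence "(\<lambda>i. norm (?h i)) summable_on I"
      by (intro summable_on_comparison_test[OF summ]) auto
    hence "?h summable_on I" by (rule abs_summable_summable)
    hence "(?h has_sum infsum ?h I) I" by simp
    from has_sum_cmult_right[OF this, of "(of_real R * \<zeta>1) ^ A * (of_real R * \<zeta>2) ^ B"]
    show ?thesis by (simp add: f_def g_def mult_ac)
  qed
  let ?avg = "\<lambda>N i. d i * circle_avg N (f i) * circle_avg N (g i)"
  have "((\<lambda>i. circle_avg N (\<lambda>\<zeta>1. circle_avg N (\<lambda>\<zeta>2. d i * f i \<zeta>1 * g i \<zeta>2))) has_sum
      circle_avg N (\<lambda>\<zeta>1. circle_avg N (\<lambda>\<zeta>2. (of_real R * \<zeta>1) ^ A * (of_real R * \<zeta>2) ^ B *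
      infsum (\<lambda>i. d i / ((of_real R * \<zeta>1 + c1) ^ a i * (of_real R * \<zeta>2 + c2) ^ b i)) I))) I" for N
    by (intro circle_avg_has_sum hs)
  moreover have "circle_avg N (\<lambda>\<zeta>1. circle_avg N (\<lambda>\<zeta>2. d i * f i \<zeta>1 * g i \<zeta>2)) = ?avg N i" for N i
    by (simp add: circle_avg_cmult mult.assoc mult.commute[of _ "circle_avg N (g i)"])
  ultimately have "(?avg N has_sum circle_avg N (\<lambda>\<zeta>1. circle_avg N (\<lambda>\<zeta>2. (of_real R * \<zeta>1) ^ A * (of_real R * \<zeta>2) ^ B *
      infsum (\<lambda>i. d i / ((of_real R * \<zeta>1 + c1) ^ a i * (of_real R * \<zeta>2 + c2) ^ b i)) I))) I" for N
    by simp
  hence eq: "circle_avg N (\<lambda>\<zeta>1. circle_avg N (\<lambda>\<zeta>2. (of_real R * \<zeta>1) ^ A * (of_real R * \<zeta>2) ^ B *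
      infsum (\<lambda>i. d i / ((of_real R * \<zeta>1 + c1) ^ a i * (of_real R * \<zeta>2 + c2) ^ b i)) I)) = infsum (?avg N) I" for N
    by (rule infsumI[symmetric])
  have "(\<lambda>N. infsum (?avg N) I) \<longlonglongrightarrow> infsum (\<lambda>i. d i * laurent_coeff (a i) A c1 * laurent_coeff (b i) B c2) I"
  proof (rule infsum_dominated_convergence[OF _ _ M])
    show "(\<lambda>N. ?avg N i) \<longlonglongrightarrow> d i * laurent_coeff (a i) A c1 * laurent_coeff (b i) B c2" for i
      unfolding f_def g_def by (intro tendsto_mult tendsto_const circle_avg_laurent_coeff c)
    show "norm (?avg N i) \<le> M i" for N i
      unfolding M_def norm_mult using nn[of i]
      by (intro mult_mono norm_circle_avg_le fb gb mult_nonneg_nonneg) auto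
  qed
  thus ?thesis by (simp only: eq)
qed

section \<open>The continuation formula\<close>

lemma coeff_b_neg: "m < 0 \<or> n1 < 0 \<or> n2 < 0 \<Longrightarrow> coeff_b D B L \<kappa> m n1 n2 = 0"
  by (simp add: coeff_b.simps)

text \<open>Passing to the coefficients on the right of the recurrence never increases m - n1 - n2.
  Once negative, it stays negative, so the only nonzero seed (0, 0, 0) is never reached.\<close>

lemma coeff_b_eq_0: "m < n1 + n2 \<Longrightarrow> coeff_b D B L \<kappa> m n1 n2 = 0"
proof (induction "nat (m + 1)" arbitrary: m n1 n2 rule: less_induct)
  case less
  show ?case
  proof (cases "m < 0 \<or> n1 < 0 \<or> n2 < 0")
    case False
    have IH: "coeff_b D B L \<kappa> a b c = 0" if "a < m" "a < b + c" for a b c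
      using less(1)[of a b c] that False by auto
    have "coeff_b D B L \<kappa> (m - 1) n1 n2 = 0" "coeff_b D B L \<kappa> (m - 1) (n1 - 1) n2 = 0"
      "coeff_b D B L \<kappa> (m - 1) n1 (n2 - 1) = 0" "coeff_b D B L \<kappa> (m - 2) (n1 - 1) n2 = 0"
      "coeff_b D B L \<kappa> (m - 2) n1 (n2 - 1) = 0" "coeff_b D B L \<kappa> (m - 2) n1 n2 = 0"
      "coeff_b D B L \<kappa> (m - 3) (n1 - 1) n2 = 0" "coeff_b D B L \<kappa> (m - 3) n1 (n2 - 1) = 0"
      "coeff_b D B L \<kappa> (m - 3) n1 n2 = 0"
      by (rule IH; use less(2) in linarith)+
    thus ?thesis using False less(2) by (subst coeff_b.simps) simp
  qed (simp add: coeff_b_neg)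
qed

lemma laurent_coeff_0: "laurent_coeff a A 0 = (if a = A then 1 else 0)"
  by (auto simp: laurent_coeff_def)

text \<open>The Pochhammer symbol in the Laurent coefficient completes Gamma(a) to Gamma(A). The
  Gamma factors then depend only on the extracted power and can be cancelled from the whole
  formula.\<close>

lemma Gamma_mult_laurent_coeff:
  assumes "a > 0" "a \<le> A"
  shows "Gamma (of_nat a) * laurent_coeff a A c = Gamma (of_nat A) * (- c) ^ (A - a) / fact (A - a)"
proof -
  have "pochhammer (of_nat a :: complex) (A - a) = Gamma (of_nat a + of_nat (A - a)) / Gamma (of_nat a)"
    by (rule pochhammer_Gamma) (use assms in \<open>simp add: of_nat_in_nonpos_Ints_iff\<close>)
  moreover have "Gamma (of_nat a :: complex) \<noteq> 0"
    using assms by (simp add: Gamma_eq_zero_iff of_nat_in_nonpos_Ints_iff)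
  moreover have "of_nat a + of_nat (A - a) = (of_nat A :: complex)" using assms by (simp flip: of_nat_add)
  ultimately show ?thesis using assms by (simp add: laurent_coeff_def bc_def)
qed

text \<open>One sign \<kappa> is fixed and the starting index is r = (0, 0): \<open>Eq q1 q2\<close>
  stands for E(-\<kappa>; 0, 0; q1, q2), the only coefficients that enter e(-\<kappa>; q).\<close>

locale continuation =
  fixes D B :: "nat \<Rightarrow> real" and L \<kappa> :: real and lam :: complex and \<nu>1 \<nu>2 :: nat and Eq :: "nat \<Rightarrow> nat \<Rightarrow> complex"
  assumes B6: "B 6 > 0" and \<kappa>: "\<kappa> \<in> {1, -1}" and \<nu>: "\<nu>1 > 0" "\<nu>2 > 0"
    and nonint: "\<And>\<sigma> r1 r2. \<sigma> \<in> {1, -1} \<Longrightarrow> mu B \<nu>1 \<nu>2 lam \<sigma> + phi r1 r2 \<notin> \<int>"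
    and cont: "continuation_coeffs D B L \<nu>1 \<nu>2 lam \<kappa> 0 0 Eq"
begin

definition \<mu> where "\<mu> = mu B \<nu>1 \<nu>2 lam \<kappa>"
definition \<mu>' where "\<mu>' = mu B \<nu>1 \<nu>2 lam (- \<kappa>)"
text \<open>The series in x that remains of W(\<kappa>; 0, 0) when one power of each t variable is
  extracted and Gamma factors and x^\<mu> are split off. \<open>bseq\<close> plays the same role for
  W(-\<kappa>; q) in powers of 1 - x.\<close>

definition gseq where "gseq n1 n2 m = Gamma (- \<mu> - of_nat m) * of_real (coeff_b D B L \<kappa> (int m) (int n1) (int n2))
  * of_real ((- 2 * \<kappa> * s0 B) ^ m)"
definition bseq where "bseq q1 q2 l1 l2 j = Gamma (- \<mu>' - phi q1 q2 - of_nat j)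
  * of_real (coeff_b D B L (- \<kappa>) (int j) (int l1) (int l2)) * of_real ((2 * \<kappa> * s0 B) ^ j)"

text \<open>The general term of W stripped of its dependence on t1 and t2.\<close>

definition Wc where "Wc \<sigma> r1 r2 s = (\<lambda>(m, n1, n2).
     Gamma (of_nat (\<nu>1 + r1 + n1)) * Gamma (of_nat (\<nu>2 + r2 + n2))
     * Gamma (- mu B \<nu>1 \<nu>2 lam \<sigma> - phi r1 r2 - of_nat m)
     * of_real (coeff_b D B L \<sigma> (int m) (int n1) (int n2))
     * of_real ((- 2 * \<sigma> * s0 B) ^ m)
     * of_real (1 / 2 - s / (2 * \<sigma> * s0 B)) powr (mu B \<nu>1 \<nu>2 lam \<sigma> + phi r1 r2 + of_nat m))"

lemma W_term_eq: "W_term D B L \<nu>1 \<nu>2 lam \<sigma> r1 r2 s t1 t2 (m, n1, n2) =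
    Wc \<sigma> r1 r2 s (m, n1, n2) / ((t1 - of_real (\<sigma> * t10 B)) ^ (\<nu>1 + r1 + n1) * (t2 - of_real (\<sigma> * t20 B)) ^ (\<nu>2 + r2 + n2))"
  by (simp add: W_term_def Wc_def)

lemma s0_pos: "s0 B > 0"
  using B6 by (simp add: s0_def)

lemma \<kappa>_sq: "\<kappa> * \<kappa> = 1" and abs_\<kappa>: "\<bar>\<kappa>\<bar> = 1" and \<kappa>_nz: "\<kappa> \<noteq> 0"
  using \<kappa> by auto

text \<open>With w = t1 - \<kappa> t10, the denominators of W(-\<kappa>; q) are powers of t1 +
  \<kappa> t10 = w + c1.\<close>

definition c1 :: complex where "c1 = of_real (2 * \<kappa> * t10 B)"
definition c2 :: complex where "c2 = of_real (2 * \<kappa> * t20 B)"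

text \<open>Here and in \<open>rhs_limit\<close> stands the coefficient of w1^(-\<nu>1-n1)
  w2^(-\<nu>2-n2), where w1 = t1 - \<kappa> t10 and w2 = t2 - \<kappa> t20, as the averages extract
  it from the two series.\<close>

definition lhs_limit where
  "lhs_limit n1 n2 s = infsum (\<lambda>(m, k1, k2). Wc \<kappa> 0 0 s (m, k1, k2)
     * laurent_coeff (\<nu>1 + k1) (\<nu>1 + n1) 0 * laurent_coeff (\<nu>2 + k2) (\<nu>2 + n2) 0) W_index"

definition rhs_limit where
  "rhs_limit n1 n2 s = infsum (\<lambda>((q1, q2), (j, l1, l2)). Eq q1 q2 * Wc (- \<kappa>) q1 q2 s (j, l1, l2)
     * laurent_coeff (\<nu>1 + q1 + l1) (\<nu>1 + n1) c1 * laurent_coeff (\<nu>2 + q2 + l2) (\<nu>2 + n2) c2) (({0..} \<times> {0..}) \<times> W_index)"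

text \<open>The lower bound R - |c| is attained at a point of the circle, so convergence of the
  series at that very point supplies the majorant for all others. As c is real, the point is 1 or
  -1.\<close>

lemma exists_unit_minimizing:
  fixes r c :: real
  assumes "\<bar>c\<bar> < r"
  shows "\<exists>\<zeta>::complex. norm \<zeta> = 1 \<and> norm (of_real r * \<zeta> + of_real c) = r - \<bar>c\<bar>"
proof (cases "c \<ge> 0")
  case True
  have "norm (of_real r * (-1) + of_real c :: complex) = norm (complex_of_real (c - r))" by simp
  also have "\<dots> = r - \<bar>c\<bar>" unfolding norm_of_real using True assms by linarith
  finally show ?thesis by (intro exI[of _ "-1"]) simp
next
  case False
  have "norm (of_real r * 1 + of_real c :: complex) = norm (complex_of_real (c + r))" by (simp add: add.commute)
  also have "\<dots> = r - \<bar>c\<bar>" unfolding norm_of_real using False assms by linarith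
  finally show ?thesis by (intro exI[of _ 1]) simp
qed

text \<open>
  The averages over roots of unity of the function $U$ are holomorphic in $s$ and locally bounded, and converge on a
  real segment, so Montel's theorem gives a holomorphic limit.
\<close>

lemma singular_difference_holomorphic:
  "\<exists>u \<delta>. \<delta> > 0 \<and> u holomorphic_on ball (of_real (- \<kappa> * s0 B)) \<delta> \<and>
     (\<forall>s. - s0 B < s \<and> s < s0 B \<and> complex_of_real s \<in> ball (of_real (- \<kappa> * s0 B)) \<delta> \<longrightarrow>
        lhs_limit n1 n2 s = rhs_limit n1 n2 s + u (of_real s))"
  and lhs_summable: "- s0 B < s \<Longrightarrow> s < s0 B \<Longrightarrow> \<exists>r>0. (\<lambda>(m, k1, k2). Wc \<kappa> 0 0 s (m, k1, k2) / (of_real r ^ (\<nu>1 + k1) * of_real r ^ (\<nu>2 + k2))) summable_on W_index"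
  and rhs_summable: "- s0 B < s \<Longrightarrow> s < s0 B \<Longrightarrow> \<exists>r r'. r > 0 \<and> r' > 0 \<and> (\<lambda>((q1, q2), (j, l1, l2)). norm (Eq q1 q2 * Wc (- \<kappa>) q1 q2 s (j, l1, l2)) / (r ^ (\<nu>1 + q1 + l1) * r' ^ (\<nu>2 + q2 + l2)))
      summable_on (({0..} \<times> {0..}) \<times> W_index)"
proof -
  obtain T \<delta> U where \<delta>: "\<delta> > (0::real)" and
    eqs: "\<And>s t1 t2. - s0 B < s \<Longrightarrow> s < s0 B \<Longrightarrow> norm t1 > T \<Longrightarrow> norm t2 > T \<Longrightarrow>
        W_term D B L \<nu>1 \<nu>2 lam \<kappa> 0 0 s t1 t2 summable_on W_index \<and>
        (\<lambda>((q1, q2), i). Eq q1 q2 * W_term D B L \<nu>1 \<nu>2 lam (- \<kappa>) q1 q2 s t1 t2 i)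
          summable_on (({0..} \<times> {0..}) \<times> W_index) \<and>
        W D B L \<nu>1 \<nu>2 lam \<kappa> 0 0 s t1 t2 =
          (\<Sum>\<^sub>\<infinity>(q1, q2)\<in>{0..} \<times> {0..}. Eq q1 q2 * W D B L \<nu>1 \<nu>2 lam (- \<kappa>) q1 q2 s t1 t2)
          + U (of_real s) t1 t2" and
    Uhol: "\<And>t1 t2. norm t1 > T \<Longrightarrow> norm t2 > T \<Longrightarrow> (\<lambda>s. U s t1 t2) holomorphic_on ball (of_real (- \<kappa> * s0 B)) \<delta>" and
    Ucont: "continuous_on (ball (of_real (- \<kappa> * s0 B)) \<delta> \<times> {t. norm t > T} \<times> {t. norm t > T}) (\<lambda>(s, t1, t2). U s t1 t2)"
    using cont unfolding continuation_coeffs_def by blast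
  \<comment> \<open>Large enough that the circles of radius R around \<kappa> t10 and \<kappa> t20
    lie in the region |t| > T and enclose the poles at distance |c1| and |c2| from their
    centres.\<close>
  define R where "R = \<bar>T\<bar> + 2 * \<bar>t10 B\<bar> + 2 * \<bar>t20 B\<bar> + 1"
  have R: "R > 0" "norm c1 < R" "norm c2 < R"
    by (auto simp: R_def c1_def c2_def norm_mult abs_mult abs_\<kappa>)
  define T1 where "T1 = (\<lambda>\<zeta>. of_real (\<kappa> * t10 B) + of_real R * \<zeta> :: complex)"
  define T2 where "T2 = (\<lambda>\<zeta>. of_real (\<kappa> * t20 B) + of_real R * \<zeta> :: complex)"
  have T1: "norm (T1 \<zeta>) > T" and T2: "norm (T2 \<zeta>) > T" if "norm \<zeta> = 1" for \<zeta>
  proof -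
    have *: "norm (of_real R * \<zeta>) = R" using R that by (simp add: norm_mult)
    have t: "R - \<bar>t10 B\<bar> > T" "R - \<bar>t20 B\<bar> > T" by (auto simp: R_def)
    have "norm (complex_of_real (\<kappa> * t10 B)) = \<bar>t10 B\<bar>" "norm (complex_of_real (\<kappa> * t20 B)) = \<bar>t20 B\<bar>"
      by (simp_all add: norm_mult abs_mult abs_\<kappa> flip: of_real_mult)
    thus "norm (T1 \<zeta>) > T" "norm (T2 \<zeta>) > T"
      using norm_diff_ineq[of "of_real R * \<zeta>" "of_real (\<kappa> * t10 B)"] norm_diff_ineq[of "of_real R * \<zeta>" "of_real (\<kappa> * t20 B)"]
        t
      unfolding * T1_def T2_def add.commute[of _ "of_real R * \<zeta>"] by linarith+
  qed
  have Tc: "T1 \<zeta> - of_real (\<kappa> * t10 B) = of_real R * \<zeta> + 0" "T2 \<zeta> - of_real (\<kappa> * t20 B) = of_real R * \<zeta> + 0"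
    "T1 \<zeta> - of_real (- \<kappa> * t10 B) = of_real R * \<zeta> + c1" "T2 \<zeta> - of_real (- \<kappa> * t20 B) = of_real R * \<zeta> + c2" for \<zeta>
    by (simp_all add: T1_def T2_def c1_def c2_def)
  have W1: "W_term D B L \<nu>1 \<nu>2 lam \<kappa> 0 0 s (T1 \<zeta>1) (T2 \<zeta>2) i = (case i of (m, k1, k2) \<Rightarrow> Wc \<kappa> 0 0 s i
      / ((of_real R * \<zeta>1 + 0) ^ (\<nu>1 + k1) * (of_real R * \<zeta>2 + 0) ^ (\<nu>2 + k2)))" for s \<zeta>1 \<zeta>2 i
    by (cases i) (simp only: W_term_eq Tc prod.case add_0_right)
  have W2: "Eq q1 q2 * W_term D B L \<nu>1 \<nu>2 lam (- \<kappa>) q1 q2 s (T1 \<zeta>1) (T2 \<zeta>2) (j, l1, l2) =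
      Eq q1 q2 * Wc (- \<kappa>) q1 q2 s (j, l1, l2)
      / ((of_real R * \<zeta>1 + c1) ^ (\<nu>1 + q1 + l1) * (of_real R * \<zeta>2 + c2) ^ (\<nu>2 + q2 + l2))" for s \<zeta>1 \<zeta>2 q1 q2 j l1 l2
    by (simp only: W_term_eq Tc times_divide_eq_right)
  define J where "J = (({0::nat..} \<times> {0::nat..}) \<times> W_index)"
  define aL where "aL = (\<lambda>(m::nat, k1, k2::nat). \<nu>1 + k1)"
  define bL where "bL = (\<lambda>(m::nat, k1::nat, k2). \<nu>2 + k2)"
  define dR where "dR = (\<lambda>s ((q1, q2), (j, l1, l2)). Eq q1 q2 * Wc (- \<kappa>) q1 q2 s (j, l1, l2))"
  define aR where "aR = (\<lambda>((q1::nat, q2::nat), (j::nat, l1, l2::nat)). \<nu>1 + q1 + l1)"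
  define bR where "bR = (\<lambda>((q1::nat, q2::nat), (j::nat, l1::nat, l2)). \<nu>2 + q2 + l2)"
  have sumL0: "(\<lambda>i. Wc \<kappa> 0 0 s i / (of_real R ^ aL i * of_real R ^ bL i)) summable_on W_index"
    if s: "- s0 B < s" "s < s0 B" for s
  proof -
    have "W_term D B L \<nu>1 \<nu>2 lam \<kappa> 0 0 s (T1 1) (T2 1) summable_on W_index"
      using eqs[OF s T1 T2, of 1 1] by simp
    moreover have "W_term D B L \<nu>1 \<nu>2 lam \<kappa> 0 0 s (T1 1) (T2 1) = (\<lambda>i. Wc \<kappa> 0 0 s i / (of_real R ^ aL i * of_real R ^ bL i))"
      unfolding W1 by (auto simp: fun_eq_iff aL_def bL_def)
    ultimately show ?thesis by simp
  qed
  have sumL: "(\<lambda>i. norm (Wc \<kappa> 0 0 s i) / ((R - norm (0::complex)) ^ aL i * (R - norm (0::complex)) ^ bL i)) summable_on W_index"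
    if s: "- s0 B < s" "s < s0 B" for s
    using sumL0[OF s] R unfolding summable_on_iff_abs_summable_on_complex
    by (simp add: norm_divide norm_mult norm_power)
  have sumR: "(\<lambda>i. norm (dR s i) / ((R - norm c1) ^ aR i * (R - norm c2) ^ bR i)) summable_on J"
    if s: "- s0 B < s" "s < s0 B" for s
  proof -
    obtain \<zeta>1 :: complex where z1: "norm \<zeta>1 = 1" "norm (of_real R * \<zeta>1 + c1) = R - norm c1"
      using exists_unit_minimizing[of "2 * \<kappa> * t10 B" R] R unfolding c1_def norm_of_real by blast
    obtain \<zeta>2 :: complex where z2: "norm \<zeta>2 = 1" "norm (of_real R * \<zeta>2 + c2) = R - norm c2"
      using exists_unit_minimizing[of "2 * \<kappa> * t20 B" R] R unfolding c2_def norm_of_real by blast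
    have "(\<lambda>((q1, q2), i). Eq q1 q2 * W_term D B L \<nu>1 \<nu>2 lam (- \<kappa>) q1 q2 s (T1 \<zeta>1) (T2 \<zeta>2) i) summable_on J"
      using eqs[OF s T1 T2, OF z1(1) z2(1)] unfolding J_def by simp
    hence "(\<lambda>z. dR s z / ((of_real R * \<zeta>1 + c1) ^ aR z * (of_real R * \<zeta>2 + c2) ^ bR z)) summable_on J"
      by (rule summable_on_cong[THEN iffD1, rotated]) (auto simp: dR_def aR_def bR_def W2)
    thus ?thesis
      unfolding summable_on_iff_abs_summable_on_complex norm_divide norm_mult norm_power z1 z2 .
  qed
  show "\<exists>r>0. (\<lambda>(m, k1, k2). Wc \<kappa> 0 0 s (m, k1, k2) / (of_real r ^ (\<nu>1 + k1) * of_real r ^ (\<nu>2 + k2))) summable_on W_index"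
    if "- s0 B < s" "s < s0 B"
    using sumL0[OF that] R(1)
    by (intro exI[of _ R] conjI) (auto simp: aL_def bL_def elim!: summable_on_cong[THEN iffD1, rotated])
  show "\<exists>r r'. r > 0 \<and> r' > 0 \<and> (\<lambda>((q1, q2), (j, l1, l2)). norm (Eq q1 q2 * Wc (- \<kappa>) q1 q2 s (j, l1, l2)) / (r ^ (\<nu>1 + q1 + l1) * r' ^ (\<nu>2 + q2 + l2)))
      summable_on (({0..} \<times> {0..}) \<times> W_index)"
    if "- s0 B < s" "s < s0 B"
    using sumR[OF that] R(2,3)
    by (intro exI[of _ "R - norm c1"] exI[of _ "R - norm c2"] conjI)
      (auto simp: dR_def aR_def bR_def J_def elim!: summable_on_cong[THEN iffD1, rotated])
  define V where "V = (\<lambda>N s. circle_avg N (\<lambda>\<zeta>1. circle_avg N (\<lambda>\<zeta>2.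
      (of_real R * \<zeta>1) ^ (\<nu>1 + n1) * (of_real R * \<zeta>2) ^ (\<nu>2 + n2) * U s (T1 \<zeta>1) (T2 \<zeta>2))))"
  have Vlim: "(\<lambda>N. V N (of_real s)) \<longlonglongrightarrow> lhs_limit n1 n2 s - rhs_limit n1 n2 s"
    if s: "- s0 B < s" "s < s0 B" for s
  proof -
    let ?P = "\<lambda>\<zeta>1 \<zeta>2. (of_real R * \<zeta>1) ^ (\<nu>1 + n1) * (of_real R * \<zeta>2) ^ (\<nu>2 + n2) :: complex"
    let ?WL = "\<lambda>\<zeta>1 \<zeta>2. infsum (\<lambda>i. Wc \<kappa> 0 0 s i / ((of_real R * \<zeta>1 + 0) ^ aL i * (of_real R * \<zeta>2 + 0) ^ bL i)) W_index"
    let ?WR = "\<lambda>\<zeta>1 \<zeta>2. infsum (\<lambda>i. dR s i / ((of_real R * \<zeta>1 + c1) ^ aR i * (of_real R * \<zeta>2 + c2) ^ bR i)) J"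
    have L: "(\<lambda>N. circle_avg N (\<lambda>\<zeta>1. circle_avg N (\<lambda>\<zeta>2. ?P \<zeta>1 \<zeta>2 * ?WL \<zeta>1 \<zeta>2))) \<longlonglongrightarrow>
        infsum (\<lambda>i. Wc \<kappa> 0 0 s i * laurent_coeff (aL i) (\<nu>1 + n1) 0 * laurent_coeff (bL i) (\<nu>2 + n2) 0) W_index"
      by (rule circle_avg_extraction[OF _ _ sumL[OF s]]) (use R in auto)
    have R': "(\<lambda>N. circle_avg N (\<lambda>\<zeta>1. circle_avg N (\<lambda>\<zeta>2. ?P \<zeta>1 \<zeta>2 * ?WR \<zeta>1 \<zeta>2))) \<longlonglongrightarrow>
        infsum (\<lambda>i. dR s i * laurent_coeff (aR i) (\<nu>1 + n1) c1 * laurent_coeff (bR i) (\<nu>2 + n2) c2) J"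
      by (rule circle_avg_extraction[OF _ _ sumR[OF s]]) (use R in auto)
    have "U (of_real s) (T1 \<zeta>1) (T2 \<zeta>2) = ?WL \<zeta>1 \<zeta>2 - ?WR \<zeta>1 \<zeta>2" if z: "norm \<zeta>1 = 1" "norm \<zeta>2 = 1" for \<zeta>1 \<zeta>2
    proof -
      note e = eqs[OF s T1[OF z(1)] T2[OF z(2)]]
      have eqL: "W D B L \<nu>1 \<nu>2 lam \<kappa> 0 0 s (T1 \<zeta>1) (T2 \<zeta>2) = ?WL \<zeta>1 \<zeta>2"
        unfolding W_def W1 by (rule infsum_cong) (auto simp: aL_def bL_def)
      have eqR: "(\<Sum>\<^sub>\<infinity>(q1, q2)\<in>{0..} \<times> {0..}. Eq q1 q2 * W D B L \<nu>1 \<nu>2 lam (- \<kappa>) q1 q2 s (T1 \<zeta>1) (T2 \<zeta>2)) = ?WR \<zeta>1 \<zeta>2"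
      proof -
        let ?t = "\<lambda>q i. (case q of (q1, q2) \<Rightarrow> Eq q1 q2 * W_term D B L \<nu>1 \<nu>2 lam (- \<kappa>) q1 q2 s (T1 \<zeta>1) (T2 \<zeta>2) i)"
        have eqt: "(\<lambda>((q1, q2), i). Eq q1 q2 * W_term D B L \<nu>1 \<nu>2 lam (- \<kappa>) q1 q2 s (T1 \<zeta>1) (T2 \<zeta>2) i) = (\<lambda>(q, i). ?t q i)"
          by (auto simp: fun_eq_iff)
        have "(\<Sum>\<^sub>\<infinity>(q1, q2)\<in>{0..} \<times> {0..}. Eq q1 q2 * W D B L \<nu>1 \<nu>2 lam (- \<kappa>) q1 q2 s (T1 \<zeta>1) (T2 \<zeta>2))
            = (\<Sum>\<^sub>\<infinity>q\<in>{0..} \<times> {0..}. \<Sum>\<^sub>\<infinity>i\<in>W_index. ?t q i)"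
          by (rule infsum_cong) (auto simp: W_def infsum_cmult_right')
        also have "\<dots> = infsum (\<lambda>(q, i). ?t q i) J"
          unfolding J_def by (rule infsum_Sigma'_banach) (use e eqt in simp)
        also have "\<dots> = ?WR \<zeta>1 \<zeta>2"
          by (rule infsum_cong) (auto simp: dR_def aR_def bR_def W2)
        finally show ?thesis .
      qed
      have "?WL \<zeta>1 \<zeta>2 = ?WR \<zeta>1 \<zeta>2 + U (of_real s) (T1 \<zeta>1) (T2 \<zeta>2)"
        using conjunct2[OF conjunct2[OF e]] unfolding eqL eqR .
      thus ?thesis by (simp only: add_diff_cancel_left')
    qed
    hence "V N (of_real s) = circle_avg N (\<lambda>\<zeta>1. circle_avg N (\<lambda>\<zeta>2. ?P \<zeta>1 \<zeta>2 * ?WL \<zeta>1 \<zeta>2)) -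
        circle_avg N (\<lambda>\<zeta>1. circle_avg N (\<lambda>\<zeta>2. ?P \<zeta>1 \<zeta>2 * ?WR \<zeta>1 \<zeta>2))" for N
      unfolding V_def circle_avg_diff[symmetric] by (intro circle_avg_cong) (simp add: right_diff_distrib)
    moreover have "infsum (\<lambda>i. Wc \<kappa> 0 0 s i * laurent_coeff (aL i) (\<nu>1 + n1) 0 * laurent_coeff (bL i) (\<nu>2 + n2) 0) W_index = lhs_limit n1 n2 s"
      unfolding lhs_limit_def by (rule infsum_cong) (auto simp: aL_def bL_def)
    moreover have "infsum (\<lambda>i. dR s i * laurent_coeff (aR i) (\<nu>1 + n1) c1 * laurent_coeff (bR i) (\<nu>2 + n2) c2) J = rhs_limit n1 n2 s"
      unfolding rhs_limit_def J_def by (rule infsum_cong) (auto simp: dR_def aR_def bR_def)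
    ultimately show ?thesis using tendsto_diff[OF L R'] by simp
  qed
  define S where "S = ball (complex_of_real (- \<kappa> * s0 B)) \<delta>"
  have Vhol: "V N holomorphic_on S" for N
    unfolding V_def circle_avg_def S_def divide_inverse
    by (intro holomorphic_intros Uhol T1 T2) auto
  \<comment> \<open>Joint continuity bounds U on the product of a compact set of s with the two
    circles, and the averages obey the resulting bound for every N.\<close>
  have Vbdd: "\<exists>C. \<forall>h\<in>range V. \<forall>z\<in>K. norm (h z) \<le> C" if K: "compact K" "K \<subseteq> S" for K
  proof -
    let ?C = "T1 ` sphere 0 1" and ?C' = "T2 ` sphere 0 1"
    have "compact (K \<times> ?C \<times> ?C')"
      unfolding T1_def T2_def by (intro compact_Times K compact_continuous_image continuous_intros) auto
    hence "compact ((\<lambda>(s, t1, t2). U s t1 t2) ` (K \<times> ?C \<times> ?C'))"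
      by (intro compact_continuous_image continuous_on_subset[OF Ucont]) (use K T1 T2 in \<open>auto simp: S_def\<close>)
    then obtain C where C: "\<forall>w\<in>(\<lambda>(s, t1, t2). U s t1 t2) ` (K \<times> ?C \<times> ?C'). norm w \<le> C"
      using compact_imp_bounded bounded_iff by metis
    have "norm (V N z) \<le> R ^ (\<nu>1 + n1) * R ^ (\<nu>2 + n2) * \<bar>C\<bar>" if "z \<in> K" for N z
      unfolding V_def
    proof (intro norm_circle_avg_le)
      fix \<zeta>1 \<zeta>2 :: complex assume z: "norm \<zeta>1 = 1" "norm \<zeta>2 = 1"
      have "norm (U z (T1 \<zeta>1) (T2 \<zeta>2)) \<le> C" using C that z by force
      hence "norm (U z (T1 \<zeta>1) (T2 \<zeta>2)) \<le> \<bar>C\<bar>" by simp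
      thus "norm ((of_real R * \<zeta>1) ^ (\<nu>1 + n1) * (of_real R * \<zeta>2) ^ (\<nu>2 + n2) * U z (T1 \<zeta>1) (T2 \<zeta>2))
          \<le> R ^ (\<nu>1 + n1) * R ^ (\<nu>2 + n2) * \<bar>C\<bar>"
        using R z by (simp add: norm_mult norm_power mult_left_mono)
    qed (use R in auto)
    thus ?thesis by blast
  qed
  obtain u r where u: "u holomorphic_on S" "strict_mono (r :: nat \<Rightarrow> nat)"
    "\<And>x. x \<in> S \<Longrightarrow> ((\<lambda>n. V (r n) x) \<longlongrightarrow> u x) sequentially"
    by (rule Montel[of S "range V" V]) (use Vhol Vbdd in \<open>auto simp: S_def\<close>)
  \<comment> \<open>The full sequence of averages converges at real s, which identifies the limit of
    the subsequence there.\<close>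
  have "lhs_limit n1 n2 s = rhs_limit n1 n2 s + u (of_real s)"
    if s: "- s0 B < s" "s < s0 B" "complex_of_real s \<in> S" for s
  proof -
    have "(\<lambda>n. V (r n) (of_real s)) \<longlonglongrightarrow> lhs_limit n1 n2 s - rhs_limit n1 n2 s"
      using LIMSEQ_subseq_LIMSEQ[OF Vlim[OF s(1,2)] u(2)] by (simp add: o_def)
    hence "u (of_real s) = lhs_limit n1 n2 s - rhs_limit n1 n2 s"
      using u(3)[OF s(3)] LIMSEQ_unique by blast
    thus ?thesis by simp
  qed
  thus "\<exists>u \<delta>. \<delta> > 0 \<and> u holomorphic_on ball (of_real (- \<kappa> * s0 B)) \<delta> \<and>
     (\<forall>s. - s0 B < s \<and> s < s0 B \<and> complex_of_real s \<in> ball (of_real (- \<kappa> * s0 B)) \<delta> \<longrightarrow>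
        lhs_limit n1 n2 s = rhs_limit n1 n2 s + u (of_real s))"
    using \<delta> u(1) unfolding S_def by blast
qed

section \<open>The formula in the variable x = 1/2 - s/(2 \<kappa> s0), with x = 1 at s = -\<kappa>
  s0\<close>

definition sx where "sx x = \<kappa> * s0 B * (1 - 2 * x)"

lemma sx_range: "0 < x \<Longrightarrow> x < 1 \<Longrightarrow> - s0 B < sx x \<and> sx x < s0 B"
proof -
  assume x: "0 < x" "x < 1"
  have "\<bar>sx x\<bar> = s0 B * \<bar>1 - 2 * x\<bar>" using s0_pos by (simp add: sx_def abs_mult abs_\<kappa>)
  also have "\<dots> < s0 B * 1" using x s0_pos by (intro mult_strict_left_mono) auto
  finally show ?thesis by auto
qed

lemma sx_base: "1 / 2 - sx x / (2 * \<kappa> * s0 B) = x" "1 / 2 - sx x / (2 * (- \<kappa>) * s0 B) = 1 - x"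
  using s0_pos \<kappa>_nz by (simp_all add: sx_def field_simps)

lemma Gamma_\<nu>_nonzero: "Gamma (of_nat (\<nu>1 + k) :: complex) \<noteq> 0" "Gamma (of_nat (\<nu>2 + k) :: complex) \<noteq> 0"
  using \<nu> by (simp_all add: Gamma_eq_zero_iff of_nat_in_nonpos_Ints_iff flip: of_nat_add)

lemma Wc_lhs:
  assumes "0 < x"
  shows "Wc \<kappa> 0 0 (sx x) (m, n1, n2) = Gamma (of_nat (\<nu>1 + n1)) * Gamma (of_nat (\<nu>2 + n2)) * of_real x powr \<mu>
    * (gseq n1 n2 m * of_real x ^ m)"
  using assms unfolding Wc_def prod.case sx_base
  by (simp add: gseq_def \<mu>_def phi_def powr_add powr_nat' mult_ac)

lemma Wc_rhs:
  assumes "x < 1"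
  shows "Wc (- \<kappa>) q1 q2 (sx x) (j, l1, l2) = Gamma (of_nat (\<nu>1 + q1 + l1)) * Gamma (of_nat (\<nu>2 + q2 + l2))
    * (1 - of_real x) powr (\<mu>' + phi q1 q2) * (bseq q1 q2 l1 l2 j * (1 - of_real x) ^ j)"
proof -
  have "complex_of_real (1 - x) \<noteq> 0" using assms by simp
  hence "complex_of_real (1 - x) powr (\<mu>' + phi q1 q2 + of_nat j) = of_real (1 - x) powr (\<mu>' + phi q1 q2) * of_real (1 - x) ^ j"
    by (simp add: powr_add powr_nat' del: of_real_diff)
  thus ?thesis unfolding Wc_def prod.case sx_base
    by (simp add: bseq_def \<mu>'_def mult_ac)
qed

lemma coeff_vanish:
  assumes "\<not> (n1 \<le> m \<and> n2 \<le> m)"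
  shows "gseq n1 n2 m = 0" "bseq q1 q2 n1 n2 m = 0" "Wc \<sigma> q1 q2 s (m, n1, n2) = 0"
proof -
  have "int m < int n1 + int n2" using assms by auto
  thus "gseq n1 n2 m = 0" "bseq q1 q2 n1 n2 m = 0" "Wc \<sigma> q1 q2 s (m, n1, n2) = 0"
    by (simp_all add: gseq_def bseq_def Wc_def coeff_b_eq_0)
qed

lemma lhs_slice_summable:
  assumes x: "0 < x" "x < 1"
  shows "(\<lambda>m. gseq n1 n2 m * of_real x ^ m) summable_on UNIV"
proof -
  obtain r where r: "r > 0" "(\<lambda>(m, k1, k2). Wc \<kappa> 0 0 (sx x) (m, k1, k2) / (of_real r ^ (\<nu>1 + k1) * of_real r ^ (\<nu>2 + k2))) summable_on W_index"
    using lhs_summable[of "sx x"] sx_range[OF x] by blast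
  have inj: "inj_on (\<lambda>m. (m, n1, n2)) {m. n1 \<le> m \<and> n2 \<le> m}" by (auto simp: inj_on_def)
  have sub: "(\<lambda>m. (m, n1, n2)) ` {m. n1 \<le> m \<and> n2 \<le> m} \<subseteq> W_index" by (auto simp: W_index_def)
  define K where "K = (complex_of_real r ^ (\<nu>1 + n1) * of_real r ^ (\<nu>2 + n2)) / (Gamma (of_nat (\<nu>1 + n1)) * Gamma (of_nat (\<nu>2 + n2)) * of_real x powr \<mu>)"
  have "(\<lambda>m. Wc \<kappa> 0 0 (sx x) (m, n1, n2) / (of_real r ^ (\<nu>1 + n1) * of_real r ^ (\<nu>2 + n2))) summable_on {m. n1 \<le> m \<and> n2 \<le> m}"
    using summable_on_reindex[OF inj, THEN iffD1, OF summable_on_subset_banach[OF r(2) sub]] by (simp add: o_def)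
  from summable_on_cmult_right[OF this, of K]
  have "(\<lambda>m. gseq n1 n2 m * of_real x ^ m) summable_on {m. n1 \<le> m \<and> n2 \<le> m}"
    using r(1) x Gamma_\<nu>_nonzero[of n1] Gamma_\<nu>_nonzero[of n2] by (simp add: Wc_lhs K_def)
  thus ?thesis
    by (rule summable_on_cong_neutral[THEN iffD1, rotated -1]) (auto simp: coeff_vanish)
qed

text \<open>\<open>Eq\<close> stays inside the series: the continuation formula yields convergence
  of the products only, and says nothing about \<open>bseq\<close> where the coefficient
  vanishes.\<close>

lemma rhs_slice_summable:
  assumes x: "0 < x" "x < 1"
  shows "(\<lambda>j. Eq q1 q2 * (bseq q1 q2 l1 l2 j * (1 - of_real x) ^ j)) summable_on UNIV"
proof -
  obtain r r' where r: "r > 0" "r' > 0" "(\<lambda>((q1, q2), (j, l1, l2)). norm (Eq q1 q2 * Wc (- \<kappa>) q1 q2 (sx x) (j, l1, l2)) / (r ^ (\<nu>1 + q1 + l1) * r' ^ (\<nu>2 + q2 + l2)))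
      summable_on (({0..} \<times> {0..}) \<times> W_index)"
    using rhs_summable[of "sx x"] sx_range[OF x] by blast
  have inj: "inj_on (\<lambda>j. ((q1, q2), (j, l1, l2))) {m. l1 \<le> m \<and> l2 \<le> m}" by (auto simp: inj_on_def)
  have sub: "(\<lambda>j. ((q1, q2), (j, l1, l2))) ` {m. l1 \<le> m \<and> l2 \<le> m} \<subseteq> ({0..} \<times> {0..}) \<times> W_index" by (auto simp: W_index_def)
  define K where "K = Gamma (of_nat (\<nu>1 + q1 + l1)) * Gamma (of_nat (\<nu>2 + q2 + l2)) * (1 - complex_of_real x) powr (\<mu>' + phi q1 q2)"
  have K: "K \<noteq> 0"
  proof -
    have "complex_of_real (1 - x) \<noteq> 0" using x by simp
    thus ?thesis using Gamma_\<nu>_nonzero[of "q1 + l1"] Gamma_\<nu>_nonzero[of "q2 + l2"] by (simp add: K_def add.assoc)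
  qed
  have "(\<lambda>j. norm (Eq q1 q2 * Wc (- \<kappa>) q1 q2 (sx x) (j, l1, l2)) / (r ^ (\<nu>1 + q1 + l1) * r' ^ (\<nu>2 + q2 + l2))) summable_on {m. l1 \<le> m \<and> l2 \<le> m}"
    using summable_on_reindex[OF inj, THEN iffD1, OF summable_on_subset_banach[OF r(3) sub]] by (simp add: o_def)
  from summable_on_cmult_right[OF this, of "r ^ (\<nu>1 + q1 + l1) * r' ^ (\<nu>2 + q2 + l2)"]
  have "(\<lambda>j. norm (Eq q1 q2 * Wc (- \<kappa>) q1 q2 (sx x) (j, l1, l2))) summable_on {m. l1 \<le> m \<and> l2 \<le> m}"
    using r(1,2) by simp
  hence "(\<lambda>j. Eq q1 q2 * Wc (- \<kappa>) q1 q2 (sx x) (j, l1, l2)) summable_on {m. l1 \<le> m \<and> l2 \<le> m}"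
    by (rule abs_summable_summable)
  from summable_on_cmult_right[OF this, of "1 / K"]
  have "(\<lambda>j. Eq q1 q2 * (bseq q1 q2 l1 l2 j * (1 - of_real x) ^ j)) summable_on {m. l1 \<le> m \<and> l2 \<le> m}"
    unfolding Wc_rhs[OF x(2)] K_def[symmetric] using K by simp
  thus ?thesis
    by (rule summable_on_cong_neutral[THEN iffD1, rotated -1]) (auto simp: coeff_vanish)
qed

lemma infsum_eq_suminf: "f summable_on UNIV \<Longrightarrow> infsum f UNIV = suminf f" for f :: "nat \<Rightarrow> complex"
  using has_sum_imp_sums[OF has_sum_infsum] sums_unique by metis

text \<open>Around its own centre each term is a single Laurent monomial, so exactly one pair (k1,
  k2) survives the extraction.\<close>

lemma lhs_limit_eq:
  assumes x: "0 < x" "x < 1"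
  shows "lhs_limit n1 n2 (sx x) = Gamma (of_nat (\<nu>1 + n1)) * Gamma (of_nat (\<nu>2 + n2)) * of_real x powr \<mu>
    * (\<Sum>m. gseq n1 n2 m * of_real x ^ m)"
proof -
  let ?F = "\<lambda>(m, k1, k2). Wc \<kappa> 0 0 (sx x) (m, k1, k2)
     * laurent_coeff (\<nu>1 + k1) (\<nu>1 + n1) 0 * laurent_coeff (\<nu>2 + k2) (\<nu>2 + n2) 0"
  have inj: "inj (\<lambda>m. (m::nat, n1, n2))" by (auto simp: inj_on_def)
  have "lhs_limit n1 n2 (sx x) = infsum ?F (range (\<lambda>m. (m, n1, n2)))"
    unfolding lhs_limit_def
    by (rule infsum_cong_neutral) (auto simp: laurent_coeff_0 W_index_def, (use coeff_vanish(3) in blast)+)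
  also have "\<dots> = infsum (\<lambda>m. Wc \<kappa> 0 0 (sx x) (m, n1, n2)) UNIV"
    by (simp add: infsum_reindex[OF inj] o_def laurent_coeff_0)
  also have "\<dots> = Gamma (of_nat (\<nu>1 + n1)) * Gamma (of_nat (\<nu>2 + n2)) * of_real x powr \<mu>
      * infsum (\<lambda>m. gseq n1 n2 m * of_real x ^ m) UNIV"
    unfolding Wc_lhs[OF x(1)] by (rule infsum_cmult_right')
  finally show ?thesis by (simp add: infsum_eq_suminf lhs_slice_summable x)
qed

text \<open>What expanding the shifted powers at infinity leaves after the common factor
  Gamma(\<nu>1+n1) Gamma(\<nu>2+n2) is taken out.\<close>

definition mixed_coeff where "mixed_coeff n1 n2 q1 q2 l1 l2 =
  (- c1) ^ (n1 - q1 - l1) / fact (n1 - q1 - l1) * ((- c2) ^ (n2 - q2 - l2) / fact (n2 - q2 - l2))"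

text \<open>Power series coefficients, in 1 - x, of the analytic factor that accompanies
  (1-x)^(\<mu>' + \<phi>(q)).\<close>

definition phicoef where "phicoef n1 n2 = (\<lambda>(q1, q2) j. \<Sum>(l1, l2)\<in>{..n1 - q1} \<times> {..n2 - q2}.
  mixed_coeff n1 n2 q1 q2 l1 l2 * (Eq q1 q2 * bseq q1 q2 l1 l2 j))"

lemma phicoef_sums:
  assumes x: "0 < x" "x < 1"
  shows "(\<lambda>j. phicoef n1 n2 (q1, q2) j * (1 - of_real x) ^ j) sums
    (\<Sum>(l1, l2)\<in>{..n1 - q1} \<times> {..n2 - q2}. mixed_coeff n1 n2 q1 q2 l1 l2 *
      (\<Sum>\<^sub>\<infinity>j. Eq q1 q2 * (bseq q1 q2 l1 l2 j * (1 - of_real x) ^ j)))"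
proof -
  have "(\<lambda>j. \<Sum>(l1, l2)\<in>{..n1 - q1} \<times> {..n2 - q2}. mixed_coeff n1 n2 q1 q2 l1 l2 *
      (Eq q1 q2 * (bseq q1 q2 l1 l2 j * (1 - of_real x) ^ j))) sums
    (\<Sum>(l1, l2)\<in>{..n1 - q1} \<times> {..n2 - q2}. mixed_coeff n1 n2 q1 q2 l1 l2 *
      (\<Sum>\<^sub>\<infinity>j. Eq q1 q2 * (bseq q1 q2 l1 l2 j * (1 - of_real x) ^ j)))"
    unfolding case_prod_beta
    by (intro sums_sum sums_mult has_sum_imp_sums has_sum_infsum rhs_slice_summable x)
  thus ?thesis by (simp add: phicoef_def sum_distrib_right case_prod_beta mult.assoc)
qed

text \<open>A Laurent coefficient vanishes unless q1 + l1 \<le> n1 and q2 + l2 \<le> n2. Only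
  finitely many slices with free j remain, so the infinite sum over q becomes finite.\<close>

lemma rhs_limit_eq:
  assumes x: "0 < x" "x < 1"
  shows "rhs_limit n1 n2 (sx x) = Gamma (of_nat (\<nu>1 + n1)) * Gamma (of_nat (\<nu>2 + n2)) *
    (\<Sum>q\<in>{..n1} \<times> {..n2}. (1 - of_real x) powr (\<mu>' + phi (fst q) (snd q)) * (\<Sum>j. phicoef n1 n2 q j * (1 - of_real x) ^ j))"
proof -
  let ?F = "\<lambda>((q1, q2), (j, l1, l2)). Eq q1 q2 * Wc (- \<kappa>) q1 q2 (sx x) (j, l1, l2)
     * laurent_coeff (\<nu>1 + q1 + l1) (\<nu>1 + n1) c1 * laurent_coeff (\<nu>2 + q2 + l2) (\<nu>2 + n2) c2"
  let ?Fin = "Sigma ({..n1} \<times> {..n2}) (\<lambda>(q1, q2). {..n1 - q1} \<times> {..n2 - q2})"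
  let ?h = "\<lambda>((q, l1, l2), j :: nat). (q :: nat \<times> nat, (j, l1 :: nat, l2 :: nat))"
  let ?G = "Gamma (of_nat (\<nu>1 + n1)) * Gamma (of_nat (\<nu>2 + n2)) :: complex"
  have fin: "finite ?Fin" by auto
  have inj: "inj_on ?h (?Fin \<times> UNIV)" by (auto simp: inj_on_def)
  have term_eq: "?F ((q1, q2), (j, l1, l2)) = (?G * (1 - of_real x) powr (\<mu>' + phi q1 q2) * mixed_coeff n1 n2 q1 q2 l1 l2) *
      (Eq q1 q2 * (bseq q1 q2 l1 l2 j * (1 - of_real x) ^ j))"
    if "q1 \<le> n1" "q2 \<le> n2" "l1 \<le> n1 - q1" "l2 \<le> n2 - q2" for q1 q2 l1 l2 j
  proof -
    have "Gamma (of_nat (\<nu>1 + q1 + l1)) * laurent_coeff (\<nu>1 + q1 + l1) (\<nu>1 + n1) c1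
        = Gamma (of_nat (\<nu>1 + n1)) * (- c1) ^ (n1 - q1 - l1) / fact (n1 - q1 - l1)"
      using Gamma_mult_laurent_coeff[of "\<nu>1 + q1 + l1" "\<nu>1 + n1" c1] \<nu> that
      by (simp add: diff_diff_eq flip: of_nat_add)
    moreover have "Gamma (of_nat (\<nu>2 + q2 + l2)) * laurent_coeff (\<nu>2 + q2 + l2) (\<nu>2 + n2) c2
        = Gamma (of_nat (\<nu>2 + n2)) * (- c2) ^ (n2 - q2 - l2) / fact (n2 - q2 - l2)"
      using Gamma_mult_laurent_coeff[of "\<nu>2 + q2 + l2" "\<nu>2 + n2" c2] \<nu> that
      by (simp add: diff_diff_eq flip: of_nat_add)
    moreover have "?F ((q1, q2), (j, l1, l2)) = (Gamma (of_nat (\<nu>1 + q1 + l1)) * laurent_coeff (\<nu>1 + q1 + l1) (\<nu>1 + n1) c1)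
        * (Gamma (of_nat (\<nu>2 + q2 + l2)) * laurent_coeff (\<nu>2 + q2 + l2) (\<nu>2 + n2) c2)
        * (1 - of_real x) powr (\<mu>' + phi q1 q2) * (Eq q1 q2 * (bseq q1 q2 l1 l2 j * (1 - of_real x) ^ j))"
      unfolding Wc_rhs[OF x(2)] prod.case by (simp only: mult_ac)
    ultimately show ?thesis by (simp add: mixed_coeff_def)
  qed
  have slice: "(\<lambda>j. ?F (?h (p, j))) summable_on UNIV" if "p \<in> ?Fin" for p
  proof -
    obtain q1 q2 l1 l2 where p1: "p = ((q1, q2), l1, l2)" by (metis prod.exhaust)
    with that have p: "p = ((q1, q2), l1, l2)" "q1 \<le> n1" "q2 \<le> n2" "l1 \<le> n1 - q1" "l2 \<le> n2 - q2"
      by auto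
    have "(\<lambda>j. (?G * (1 - of_real x) powr (\<mu>' + phi q1 q2) * mixed_coeff n1 n2 q1 q2 l1 l2) *
      (Eq q1 q2 * (bseq q1 q2 l1 l2 j * (1 - of_real x) ^ j))) summable_on UNIV"
      by (intro summable_on_cmult_right rhs_slice_summable x)
    moreover have "?F (?h (p, j)) = (?G * (1 - of_real x) powr (\<mu>' + phi q1 q2) * mixed_coeff n1 n2 q1 q2 l1 l2) *
      (Eq q1 q2 * (bseq q1 q2 l1 l2 j * (1 - of_real x) ^ j))" for j
      using term_eq[OF p(2-5), of j] by (simp only: p(1) prod.case)
    ultimately show ?thesis by (simp only:)
  qed
  have "(\<lambda>z. norm (?F (?h z))) summable_on (?Fin \<times> UNIV)"
    by (rule Infinite_Sum.abs_summable_on_Sigma_iff[THEN iffD2], intro conjI ballI summable_on_finite[OF fin]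
        slice[unfolded summable_on_iff_abs_summable_on_complex])
  hence sumFin: "(\<lambda>z. ?F (?h z)) summable_on (?Fin \<times> UNIV)" by (rule abs_summable_summable)
  have "rhs_limit n1 n2 (sx x) = infsum ?F (?h ` (?Fin \<times> UNIV))"
    unfolding rhs_limit_def
  proof (rule infsum_cong_neutral)
    fix z assume z: "z \<in> ?h ` (?Fin \<times> UNIV) - ({0..} \<times> {0..}) \<times> W_index"
    obtain q1 q2 l1 l2 j where zz: "z = ((q1, q2), (j, l1, l2))" by (metis prod.exhaust)
    have "\<not> (l1 \<le> j \<and> l2 \<le> j)" using z unfolding zz by (auto simp: W_index_def)
    from coeff_vanish(3)[OF this] show "?F z = 0" by (simp add: zz)
  next
    fix z assume z: "z \<in> ({0..} \<times> {0..}) \<times> W_index - ?h ` (?Fin \<times> UNIV)"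
    obtain q1 q2 j l1 l2 where zz: "z = ((q1, q2), (j, l1, l2))" by (cases z) auto
    have "\<not> (q1 + l1 \<le> n1 \<and> q2 + l2 \<le> n2)"
    proof
      assume "q1 + l1 \<le> n1 \<and> q2 + l2 \<le> n2"
      hence "(((q1, q2), l1, l2), j) \<in> ?Fin \<times> UNIV" by auto
      from imageI[OF this, of ?h] show False using z zz by simp
    qed
    thus "?F z = 0" unfolding zz by (auto simp: laurent_coeff_def)
  qed auto
  also have "\<dots> = infsum (\<lambda>z. ?F (?h z)) (?Fin \<times> UNIV)"
    by (subst infsum_reindex[OF inj]) (simp only: o_def)
  also have "\<dots> = (\<Sum>\<^sub>\<infinity>p\<in>?Fin. \<Sum>\<^sub>\<infinity>j. ?F (?h (p, j)))"
    by (rule infsum_Sigma_banach[OF sumFin, symmetric])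
  also have "\<dots> = (\<Sum>p\<in>?Fin. \<Sum>\<^sub>\<infinity>j. ?F (?h (p, j)))"
    by (rule infsum_finite[OF fin])
  also have "\<dots> = (\<Sum>(q, l)\<in>?Fin. case q of (q1, q2) \<Rightarrow> case l of (l1, l2) \<Rightarrow>
      (?G * (1 - of_real x) powr (\<mu>' + phi q1 q2) * mixed_coeff n1 n2 q1 q2 l1 l2) *
      (\<Sum>\<^sub>\<infinity>j. Eq q1 q2 * (bseq q1 q2 l1 l2 j * (1 - of_real x) ^ j)))"
  proof (rule sum.cong[OF refl])
    fix p assume pF: "p \<in> ?Fin"
    obtain q1 q2 l1 l2 where p1: "p = ((q1, q2), l1, l2)" by (metis prod.exhaust)
    with pF have p: "p = ((q1, q2), l1, l2)" "q1 \<le> n1" "q2 \<le> n2" "l1 \<le> n1 - q1" "l2 \<le> n2 - q2"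
      by auto
    have "(\<Sum>\<^sub>\<infinity>j. ?F (?h (p, j))) = (\<Sum>\<^sub>\<infinity>j. (?G * (1 - of_real x) powr (\<mu>' + phi q1 q2) * mixed_coeff n1 n2 q1 q2 l1 l2) *
      (Eq q1 q2 * (bseq q1 q2 l1 l2 j * (1 - of_real x) ^ j)))"
      by (rule infsum_cong) (use term_eq[OF p(2-5)] in \<open>simp only: p(1) prod.case\<close>)
    thus "(\<Sum>\<^sub>\<infinity>j. ?F (?h (p, j))) = (case p of (q, l) \<Rightarrow> case q of (q1, q2) \<Rightarrow> case l of (l1, l2) \<Rightarrow>
      (?G * (1 - of_real x) powr (\<mu>' + phi q1 q2) * mixed_coeff n1 n2 q1 q2 l1 l2) *
      (\<Sum>\<^sub>\<infinity>j. Eq q1 q2 * (bseq q1 q2 l1 l2 j * (1 - of_real x) ^ j)))"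
      by (simp add: p(1) infsum_cmult_right')
  qed
  also have "\<dots> = (\<Sum>q\<in>{..n1} \<times> {..n2}. \<Sum>l\<in>(case q of (q1, q2) \<Rightarrow> {..n1 - q1} \<times> {..n2 - q2}). case q of (q1, q2) \<Rightarrow> case l of (l1, l2) \<Rightarrow>
      (?G * (1 - of_real x) powr (\<mu>' + phi q1 q2) * mixed_coeff n1 n2 q1 q2 l1 l2) *
      (\<Sum>\<^sub>\<infinity>j. Eq q1 q2 * (bseq q1 q2 l1 l2 j * (1 - of_real x) ^ j)))"
    by (rule sum.Sigma[symmetric]) auto
  also have "\<dots> = (\<Sum>q\<in>{..n1} \<times> {..n2}. ?G * ((1 - of_real x) powr (\<mu>' + phi (fst q) (snd q)) * (\<Sum>j. phicoef n1 n2 q j * (1 - of_real x) ^ j)))"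
  proof (rule sum.cong[OF refl])
    fix q :: "nat \<times> nat"
    obtain q1 q2 where q: "q = (q1, q2)" by (cases q)
    show "(\<Sum>l\<in>(case q of (q1, q2) \<Rightarrow> {..n1 - q1} \<times> {..n2 - q2}). case q of (q1, q2) \<Rightarrow> case l of (l1, l2) \<Rightarrow>
      (?G * (1 - of_real x) powr (\<mu>' + phi q1 q2) * mixed_coeff n1 n2 q1 q2 l1 l2) *
      (\<Sum>\<^sub>\<infinity>j. Eq q1 q2 * (bseq q1 q2 l1 l2 j * (1 - of_real x) ^ j))) =
      ?G * ((1 - of_real x) powr (\<mu>' + phi (fst q) (snd q)) * (\<Sum>j. phicoef n1 n2 q j * (1 - of_real x) ^ j))"
      unfolding q prod.case fst_conv snd_conv sums_unique[OF phicoef_sums[OF x], symmetric]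
      by (simp add: sum_distrib_left case_prod_beta mult_ac)
  qed
  finally show ?thesis by (simp only: sum_distrib_left)
qed

lemma powser_norm_summable:
  fixes a :: "nat \<Rightarrow> complex"
  assumes "\<And>x. 0 < x \<Longrightarrow> x < 1 \<Longrightarrow> summable (\<lambda>m. a m * of_real x ^ m)" "norm z < 1"
  shows "summable (\<lambda>m. norm (a m * z ^ m))"
proof (rule powser_insidea)
  define x where "x = (norm z + 1) / 2"
  have x: "0 < x" "x < 1" "norm z < x" using assms(2) norm_ge_zero[of z] by (auto simp: x_def simp del: norm_ge_zero)
  show "summable (\<lambda>m. a m * of_real x ^ m)" by (rule assms(1)[OF x(1,2)])
  show "norm z < norm (complex_of_real x)" using x by simp
qed

text \<open>Division of the formula by x^\<mu> = (1-y)^\<mu> with y = 1 - x, carried out as a Cauchy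
  product.\<close>

definition fcoef where "fcoef n1 n2 q k = (\<Sum>i\<le>k. phicoef n1 n2 q i * bc (- \<mu>) (k - i))"
definition aq where "aq q = \<mu>' + phi (fst q) (snd q)"
text \<open>The predicted coefficients: each term y^(aq q + k) of the singular expansion contributes
  its binomial sequence.\<close>

definition trunc where "trunc M n1 n2 m = (\<Sum>q\<in>{..n1} \<times> {..n2}. \<Sum>k<M. fcoef n1 n2 q k * bc (aq q + of_nat k) m)"

lemma phicoef_norm_summable:
  assumes "norm y < 1" shows "summable (\<lambda>j. norm (phicoef n1 n2 q j * y ^ j))"
proof (rule powser_norm_summable[OF _ assms])
  fix x :: real assume "0 < x" "x < 1"
  thus "summable (\<lambda>m. phicoef n1 n2 q m * of_real x ^ m)"
    using phicoef_sums[of "1 - x" n1 n2 "fst q" "snd q"] by (auto simp: sums_iff)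
qed

lemma bc_norm_summable:
  assumes "norm y < 1" shows "summable (\<lambda>j. norm (bc \<alpha> j * y ^ j))"
  by (rule powser_norm_summable[OF _ assms]) (auto intro!: sums_summable[OF bc_sums])

lemma fcoef_sums:
  assumes "norm y < 1"
  shows "(\<lambda>k. fcoef n1 n2 q k * y ^ k) sums ((\<Sum>j. phicoef n1 n2 q j * y ^ j) * (1 - y) powr (- \<mu>))"
proof -
  have "(\<lambda>k. \<Sum>i\<le>k. (phicoef n1 n2 q i * y ^ i) * (bc (- \<mu>) (k - i) * y ^ (k - i))) sums
      ((\<Sum>j. phicoef n1 n2 q j * y ^ j) * (\<Sum>j. bc (- \<mu>) j * y ^ j))"
    by (rule Cauchy_product_sums[OF phicoef_norm_summable[OF assms] bc_norm_summable[OF assms]])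
  also have "(\<Sum>j. bc (- \<mu>) j * y ^ j) = (1 - y) powr (- \<mu>)"
    using bc_sums[OF assms] by (simp add: sums_iff)
  also have "(\<lambda>k. \<Sum>i\<le>k. (phicoef n1 n2 q i * y ^ i) * (bc (- \<mu>) (k - i) * y ^ (k - i))) = (\<lambda>k. fcoef n1 n2 q k * y ^ k)"
  proof
    fix k
    have "(phicoef n1 n2 q i * y ^ i) * (bc (- \<mu>) (k - i) * y ^ (k - i)) = phicoef n1 n2 q i * bc (- \<mu>) (k - i) * y ^ k"
      if "i \<le> k" for i
    proof -
      have "y ^ k = y ^ i * y ^ (k - i)" using that by (simp flip: power_add)
      thus ?thesis by simp
    qed
    thus "(\<Sum>i\<le>k. (phicoef n1 n2 q i * y ^ i) * (bc (- \<mu>) (k - i) * y ^ (k - i))) = fcoef n1 n2 q k * y ^ k"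
      unfolding fcoef_def sum_distrib_right by (intro sum.cong) auto
  qed
  finally show ?thesis .
qed

text \<open>Dividing by the Gamma factors and by x^\<mu> keeps the remainder holomorphic near x = 1;
  everything else is the expansion that the truncation cuts off after M terms.\<close>

lemma truncation_regular: "\<exists>M0. \<forall>M\<ge>M0. regular_upto b (\<lambda>m. gseq n1 n2 m - trunc M n1 n2 m)"
proof -
  obtain u0 \<delta>0 where \<delta>0: "\<delta>0 > 0" and u0: "u0 holomorphic_on ball (of_real (- \<kappa> * s0 B)) \<delta>0"
    and eq0: "\<And>s. - s0 B < s \<Longrightarrow> s < s0 B \<Longrightarrow> complex_of_real s \<in> ball (of_real (- \<kappa> * s0 B)) \<delta>0 \<Longrightarrow>
        lhs_limit n1 n2 s = rhs_limit n1 n2 s + u0 (of_real s)"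
    using singular_difference_holomorphic[of n1 n2] by blast
  \<comment> \<open>The passage from x to s stretches distances by 2 s0, which explains the second
    bound. The first keeps the disc away from the branch cut of z^(-\<mu>).\<close>
  define \<delta> where "\<delta> = min (1 / 2) (\<delta>0 / (2 * s0 B))"
  have \<delta>: "0 < \<delta>" "\<delta> \<le> 1" "\<delta> \<le> 1 / 2" "2 * s0 B * \<delta> \<le> \<delta>0"
  proof -
    have "2 * s0 B * \<delta> \<le> 2 * s0 B * (\<delta>0 / (2 * s0 B))"
      using s0_pos unfolding \<delta>_def by (intro mult_left_mono) auto
    thus "2 * s0 B * \<delta> \<le> \<delta>0" using s0_pos by simp
  qed (use \<delta>0 s0_pos in \<open>auto simp: \<delta>_def\<close>)
  let ?G = "Gamma (of_nat (\<nu>1 + n1)) * Gamma (of_nat (\<nu>2 + n2)) :: complex"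
  have G: "?G \<noteq> 0" using Gamma_\<nu>_nonzero by simp
  define sz where "sz = (\<lambda>z. of_real (\<kappa> * s0 B) * (1 - 2 * z) :: complex)"
  define u where "u = (\<lambda>z. z powr (- \<mu>) * u0 (sz z) / ?G)"
  have sz_in: "sz z \<in> ball (of_real (- \<kappa> * s0 B)) \<delta>0" if "z \<in> ball 1 \<delta>" for z
  proof -
    have "sz z - of_real (- \<kappa> * s0 B) = of_real (2 * \<kappa> * s0 B) * (1 - z)"
      by (simp add: sz_def algebra_simps)
    hence "dist (sz z) (of_real (- \<kappa> * s0 B)) = 2 * s0 B * norm (1 - z)"
      using s0_pos by (simp add: dist_norm norm_mult abs_\<kappa>)
    also have "\<dots> < 2 * s0 B * \<delta>"
      using that s0_pos by (intro mult_strict_left_mono) (auto simp: dist_norm)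
    finally show ?thesis using \<delta> by (simp add: dist_commute)
  qed
  have u: "u holomorphic_on ball 1 \<delta>"
  proof -
    have "z \<notin> \<real>\<^sub>\<le>\<^sub>0" if "z \<in> ball 1 \<delta>" for z :: complex
    proof -
      have "Re (1 - z) \<le> norm (1 - z)" by (rule complex_Re_le_cmod)
      also have "\<dots> < 1" using that \<delta> by (simp add: dist_norm)
      finally show ?thesis by (auto simp: complex_nonpos_Reals_iff)
    qed
    moreover have "(u0 \<circ> sz) holomorphic_on ball 1 \<delta>"
      by (rule holomorphic_on_compose_gen[OF _ u0]) (use sz_in in \<open>auto simp: sz_def intro!: holomorphic_intros\<close>)
    ultimately show ?thesis
      unfolding u_def by (intro holomorphic_intros) (auto simp: o_def G)
  qed
  have eq: "(\<Sum>m. gseq n1 n2 m * of_real x ^ m) = (\<Sum>q\<in>{..n1} \<times> {..n2}. (1 - of_real x) powr aq q *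
      (\<Sum>k. fcoef n1 n2 q k * (1 - of_real x) ^ k)) + u (of_real x)" if x: "1 - \<delta> < x" "x < 1" for x
  proof -
    have x0: "0 < x" using x \<delta> by linarith
    have sxz: "complex_of_real (sx x) = sz (of_real x)" by (simp add: sx_def sz_def)
    have dx: "norm (1 - complex_of_real x) = 1 - x"
    proof -
      have "norm (1 - complex_of_real x) = norm (complex_of_real (1 - x))" by simp
      also have "\<dots> = 1 - x" unfolding norm_of_real using x by simp
      finally show ?thesis .
    qed
    have "complex_of_real x \<in> ball 1 \<delta>" using dx x by (simp add: dist_norm)
    hence e: "lhs_limit n1 n2 (sx x) = rhs_limit n1 n2 (sx x) + u0 (sz (of_real x))"
      using eq0[of "sx x"] sx_range[OF x0 x(2)] sz_in by (simp add: sxz)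
    have xp: "complex_of_real x powr (- \<mu>) * of_real x powr \<mu> = 1"
      using x0 by (simp flip: powr_add)
    have F: "(\<Sum>k. fcoef n1 n2 q k * (1 - of_real x) ^ k) = (\<Sum>j. phicoef n1 n2 q j * (1 - of_real x) ^ j) * of_real x powr (- \<mu>)" for q
      using fcoef_sums[of "1 - of_real x" n1 n2 q] dx x0 by (simp add: sums_iff)
    let ?S = "\<Sum>m. gseq n1 n2 m * of_real x ^ m"
    let ?R = "\<Sum>q\<in>{..n1} \<times> {..n2}. (1 - of_real x) powr aq q * (\<Sum>j. phicoef n1 n2 q j * (1 - of_real x) ^ j)"
    have main: "?G * of_real x powr \<mu> * ?S = ?G * ?R + u0 (sz (of_real x))"
      using e unfolding lhs_limit_eq[OF x0 x(2)] rhs_limit_eq[OF x0 x(2)] aq_def .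
    have "?S = (of_real x powr (- \<mu>) * of_real x powr \<mu>) * ?S" by (simp only: xp mult_1_left)
    also have "\<dots> = of_real x powr (- \<mu>) / ?G * (?G * of_real x powr \<mu> * ?S)" using G by simp
    also have "\<dots> = of_real x powr (- \<mu>) * ?R + u (of_real x)"
      unfolding main u_def using G by (simp add: field_simps)
    also have "of_real x powr (- \<mu>) * ?R = (\<Sum>q\<in>{..n1} \<times> {..n2}. (1 - of_real x) powr aq q * (\<Sum>k. fcoef n1 n2 q k * (1 - of_real x) ^ k))"
      unfolding F sum_distrib_left by (intro sum.cong refl) (simp only: mult_ac)
    finally show ?thesis .
  qed
  show ?thesis
  \<comment> \<open>Sufficient for every q at once, since Re \<phi>(q) \<ge> 0.\<close>
  proof (intro exI[of _ "nat \<lceil>real b - Re \<mu>'\<rceil>"] allI impI)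
    fix M assume M: "nat \<lceil>real b - Re \<mu>'\<rceil> \<le> M"
    have "regular_upto b (\<lambda>m. gseq n1 n2 m - (\<Sum>q\<in>{..n1} \<times> {..n2}. \<Sum>k<M. fcoef n1 n2 q k * bc (aq q + of_nat k) m))"
    proof (rule regular_upto_of_expansion[OF _ _ _ u \<delta>(1,2) eq])
      show "summable (\<lambda>m. gseq n1 n2 m * z ^ m)" if "norm z < 1" for z
        by (rule summable_norm_cancel, rule powser_norm_summable[OF _ that])
          (rule summable_on_imp_summable[OF lhs_slice_summable])
      show "summable (\<lambda>k. fcoef n1 n2 q k * y ^ k)" if "norm y < 1" for q y
        by (rule sums_summable[OF fcoef_sums[OF that]])
      fix q :: "nat \<times> nat"
      have "Re (phi (fst q) (snd q)) \<ge> 0" by (simp add: phi_def)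
      thus "real b \<le> Re (aq q) + real M" using M unfolding aq_def by simp
    qed auto
    thus "regular_upto b (\<lambda>m. gseq n1 n2 m - trunc M n1 n2 m)" by (simp add: trunc_def)
  qed
qed

end

section \<open>The recurrence for the coefficients\<close>

lemma Gamma_minus_of_nat:
  fixes z :: complex
  assumes "z \<notin> \<int>"
  shows "Gamma (z - of_nat k) = (- 1) ^ k * Gamma z / pochhammer (1 - z) k"
proof -
  have nz: "z - of_nat k \<notin> \<int>\<^sub>\<le>\<^sub>0"
  proof
    assume "z - of_nat k \<in> \<int>\<^sub>\<le>\<^sub>0"
    then obtain n where "z - of_nat k = of_int n" by (auto elim!: nonpos_Ints_cases)
    hence "z = of_int (n + int k)" by (simp add: algebra_simps)
    thus False using assms by (metis Ints_of_int)
  qed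
  have "pochhammer (z - of_nat k) k = Gamma (z - of_nat k + of_nat k) / Gamma (z - of_nat k)"
    by (rule pochhammer_Gamma[OF nz])
  moreover have "pochhammer (z - of_nat k) k = (- 1) ^ k * pochhammer (1 - z) k"
    using pochhammer_minus[of "of_nat k - z" k] by (simp add: algebra_simps)
  moreover have "Gamma (z - of_nat k) \<noteq> 0" using nz by (simp add: Gamma_eq_zero_iff)
  moreover have "pochhammer (1 - z) k \<noteq> 0"
  proof
    assume "pochhammer (1 - z) k = 0"
    then obtain i where "1 - z = - of_nat i" by (auto simp: pochhammer_eq_0_iff)
    hence "z = of_nat (i + 1)" by (simp add: algebra_simps)
    thus False using assms by simp
  qed
  ultimately have *: "Gamma z = (- 1) ^ k * pochhammer (1 - z) k * Gamma (z - of_nat k)"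
    by (simp add: field_simps)
  show ?thesis unfolding * using \<open>pochhammer (1 - z) k \<noteq> 0\<close> by (cases "even k") simp_all
qed

text \<open>For 3m = 2 n1 + n2 the definition prescribes a value instead of the recurrence, which
  still holds there: either m = 0 and every coefficient on the right has a negative index, or m < n1
  + n2 and all of them vanish by the support condition.\<close>

lemma coeff_b_rec:
  fixes m n1 n2 :: int
  assumes "0 \<le> m" "0 \<le> n1" "0 \<le> n2" and "\<kappa> \<noteq> 0" "s0 B \<noteq> 0"
  shows "6 * \<kappa> * s0 B * of_int (3 * m - 2 * n1 - n2) * coeff_b D B L \<kappa> m n1 n2 =
      ((real_of_int (3 * m - 2 * n1 - n2) + tau B \<kappa> - 3)\<^sup>2 - L\<^sup>2) * coeff_b D B L \<kappa> (m - 1) n1 n2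
       + (- 4 * \<kappa> * t10 B * (real_of_int (3 * m - 2 * n1 - n2) + tau B \<kappa> - 2) + (t20 B)\<^sup>2 - B 2)
          * coeff_b D B L \<kappa> (m - 1) (n1 - 1) n2
       + (- 2 * \<kappa> * t20 B * (real_of_int (3 * m - 2 * n1 - n2) + tau B \<kappa> - 5 / 2) - B 1)
          * coeff_b D B L \<kappa> (m - 1) n1 (n2 - 1)
       - D 1 * coeff_b D B L \<kappa> (m - 2) (n1 - 1) n2
       - D 2 * coeff_b D B L \<kappa> (m - 2) n1 (n2 - 1)
       - D 3 * coeff_b D B L \<kappa> (m - 2) n1 n2
       - D 4 * coeff_b D B L \<kappa> (m - 3) (n1 - 1) n2
       - D 5 * coeff_b D B L \<kappa> (m - 3) n1 (n2 - 1)
       - D 6 * coeff_b D B L \<kappa> (m - 3) n1 n2" (is "_ = ?R")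
proof (cases "3 * m - 2 * n1 - n2 = 0")
  case True
  have "coeff_b D B L \<kappa> (m - 1) n1 n2 = 0" "coeff_b D B L \<kappa> (m - 1) (n1 - 1) n2 = 0"
    "coeff_b D B L \<kappa> (m - 1) n1 (n2 - 1) = 0" "coeff_b D B L \<kappa> (m - 2) (n1 - 1) n2 = 0"
    "coeff_b D B L \<kappa> (m - 2) n1 (n2 - 1) = 0" "coeff_b D B L \<kappa> (m - 2) n1 n2 = 0"
    "coeff_b D B L \<kappa> (m - 3) (n1 - 1) n2 = 0" "coeff_b D B L \<kappa> (m - 3) n1 (n2 - 1) = 0"
    "coeff_b D B L \<kappa> (m - 3) n1 n2 = 0"
  proof -
    have van: "coeff_b D B L \<kappa> a b c = 0" if "a < m" "a - b - c \<le> m - n1 - n2" for a b c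
    proof (cases "m = 0")
      case False
      hence "m < n1 + n2" using True assms by linarith
      thus ?thesis using that by (intro coeff_b_eq_0) linarith
    qed (use that in \<open>simp add: coeff_b_neg\<close>)
    show "coeff_b D B L \<kappa> (m - 1) n1 n2 = 0" "coeff_b D B L \<kappa> (m - 1) (n1 - 1) n2 = 0"
    "coeff_b D B L \<kappa> (m - 1) n1 (n2 - 1) = 0" "coeff_b D B L \<kappa> (m - 2) (n1 - 1) n2 = 0"
    "coeff_b D B L \<kappa> (m - 2) n1 (n2 - 1) = 0" "coeff_b D B L \<kappa> (m - 2) n1 n2 = 0"
    "coeff_b D B L \<kappa> (m - 3) (n1 - 1) n2 = 0" "coeff_b D B L \<kappa> (m - 3) n1 (n2 - 1) = 0"
    "coeff_b D B L \<kappa> (m - 3) n1 n2 = 0"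
      by (rule van; linarith)+
  qed
  thus ?thesis using True by simp
next
  case False
  have b: "coeff_b D B L \<kappa> m n1 n2 = ?R / (6 * \<kappa> * s0 B * real_of_int (3 * m - 2 * n1 - n2))"
    by (subst coeff_b.simps) (use False assms in simp)
  have "6 * \<kappa> * s0 B * real_of_int (3 * m - 2 * n1 - n2) \<noteq> 0"
    using False assms by (simp only: mult_eq_0_iff of_int_eq_0_iff) simp
  thus ?thesis unfolding b by (simp only: times_divide_eq_right nonzero_mult_div_cancel_left not_False_eq_True)
qed

context continuation
begin

lemma mu_notin_Ints: "\<mu> \<notin> \<int>"
proof -
  have "mu B \<nu>1 \<nu>2 lam \<kappa> + phi 0 0 \<notin> \<int>" by (rule nonint[OF \<kappa>])
  thus ?thesis by (simp add: \<mu>_def phi_def)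
qed

text \<open>The hypothesis covers only nonnegative thirds. Adding the integer |i| to \<mu>' + i/3
  makes the numerator i + 3|i| \<ge> 0, and a third of it is a value \<phi>(0, r).\<close>

lemma mu'_third_notin_Ints: "\<mu>' + of_int i / 3 \<notin> \<int>"
proof
  assume i: "\<mu>' + of_int i / 3 \<in> \<int>"
  define r where "r = nat (i + 3 * \<bar>i\<bar>)"
  have r: "int r = i + 3 * \<bar>i\<bar>" by (simp add: r_def)
  have "phi 0 r = of_int (int r) / 3" by (simp add: phi_def)
  also have "\<dots> = of_int i / 3 + of_int \<bar>i\<bar>" unfolding r by (simp add: add_divide_distrib)
  finally have "mu B \<nu>1 \<nu>2 lam (- \<kappa>) + phi 0 r = (\<mu>' + of_int i / 3) + of_int \<bar>i\<bar>"
    by (simp add: \<mu>'_def)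
  also have "\<dots> \<in> \<int>" by (rule Ints_add[OF i Ints_of_int])
  finally have "mu B \<nu>1 \<nu>2 lam (- \<kappa>) + phi 0 r \<in> \<int>" .
  thus False using nonint[of "- \<kappa>" 0 r] \<kappa> by auto
qed

lemma aq_eq: "aq q + of_nat k = \<mu>' + of_int (int (2 * fst q + snd q + 3 * k)) / 3"
  by (simp add: aq_def phi_def field_simps)

lemma aq_notin_Ints: "aq q \<notin> \<int>"
  using mu'_third_notin_Ints[of "int (2 * fst q + snd q)"] aq_eq[of q 0] by simp

lemma trunc_bc_span: "trunc M n1 n2 \<in> bc_span \<mu>'"
proof -
  have "trunc M n1 n2 = (\<lambda>m. \<Sum>q\<in>{..n1} \<times> {..n2}. \<Sum>k<M. fcoef n1 n2 q k * bc (\<mu>' + of_int (int (2 * fst q + snd q + 3 * k)) / 3) m)"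
    unfolding trunc_def [abs_def] aq_eq ..
  thus ?thesis by (simp only:) (intro bc_span_sum bc_span_base)
qed

text \<open>With integer indices the vanishing of b replaces case distinctions for n1 = 0, n2 = 0
  and m < 3.\<close>

definition gint :: "int \<Rightarrow> int \<Rightarrow> int \<Rightarrow> complex" where
  "gint m n1 n2 = Gamma (- \<mu> - of_int m) * of_real (coeff_b D B L \<kappa> m n1 n2) * (of_real (- 2 * \<kappa> * s0 B)) powi m"

lemma gint_neg: "m < 0 \<or> n1 < 0 \<or> n2 < 0 \<Longrightarrow> gint m n1 n2 = 0"
  by (simp add: gint_def coeff_b_neg)

lemma gint_gseq: "gint (int m) (int n1) (int n2) = gseq n1 n2 m"
  by (simp add: gint_def gseq_def)

lemma gint_shift: "seq_shift (\<lambda>m. gint (int m - k) n1 n2) m = (if m = 0 then 0 else gint (int m - (k + 1)) n1 n2)"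
  by (cases m) (simp_all add: algebra_simps)

lemma gint_shift': "k \<ge> 0 \<Longrightarrow> seq_shift (\<lambda>m. gint (int m - k) n1 n2) = (\<lambda>m. gint (int m - (k + 1)) n1 n2)"
  by (auto simp: gint_shift gint_neg)

text \<open>The constants come from 6 \<kappa> s0 (3m - 2 n1 - n2) = 18 \<kappa> s0 (m - c) and from
  (3m - 2 n1 - n2 + \<tau> - 3)^2 - L^2 = 9 (m+t+l)(m+t-l). Each shift of m by one contributes a
  quotient of Gamma values and a power of -2 \<kappa> s0.\<close>

lemma gseq_recurrence:
  fixes n1 n2 :: nat
  defines "c \<equiv> (2 * of_nat n1 + of_nat n2) / 3 :: complex"
  shows "main_op c (of_real (tau B \<kappa>) / 3 - 1 - c) (of_real L / 3) \<mu>
      (of_real (2 * \<kappa> * s0 B / 9 * D 3)) (of_real (4 * (\<kappa> * s0 B)\<^sup>2 / 9 * D 6)) (gseq n1 n2) m =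
    lower_op \<mu> (of_real (- 4 * \<kappa> * t10 B / 3))
      (of_real ((- 4 * \<kappa> * t10 B * (- 2 * real n1 - real n2 + tau B \<kappa> - 2) + (t20 B)\<^sup>2 - B 2) / 9))
      (of_real (- (2 * \<kappa> * s0 B / 9 * D 1))) (of_real (- (4 * (\<kappa> * s0 B)\<^sup>2 / 9 * D 4)))
      (if n1 = 0 then \<lambda>_. 0 else gseq (n1 - 1) n2) m +
    lower_op \<mu> (of_real (- 2 * \<kappa> * t20 B / 3))
      (of_real ((- 2 * \<kappa> * t20 B * (- 2 * real n1 - real n2 + tau B \<kappa> - 5 / 2) - B 1) / 9))
      (of_real (- (2 * \<kappa> * s0 B / 9 * D 2))) (of_real (- (4 * (\<kappa> * s0 B)\<^sup>2 / 9 * D 5)))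
      (if n2 = 0 then \<lambda>_. 0 else gseq n1 (n2 - 1)) m"
proof -
  let ?i = "int n1" and ?j = "int n2"
  have e: "gseq n1 n2 = (\<lambda>m. gint (int m - 0) ?i ?j)"
    "(if n1 = 0 then \<lambda>_. 0 else gseq (n1 - 1) n2) = (\<lambda>m. gint (int m - 0) (?i - 1) ?j)"
    "(if n2 = 0 then \<lambda>_. 0 else gseq n1 (n2 - 1)) = (\<lambda>m. gint (int m - 0) ?i (?j - 1))"
    by (auto simp: gint_gseq [symmetric] gint_neg of_nat_diff)
  define G where "G = Gamma (- \<mu> - of_nat m)"
  define s where "s = complex_of_real (s0 B)"
  define k where "k = complex_of_real \<kappa>"
  have k2: "k * k = 1" using \<kappa>_sq by (simp add: k_def flip: of_real_mult)
  have s: "s \<noteq> 0" using s0_pos by (simp add: s_def)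
  define P where "P = (- 2 * k * s) powi (int m)"
  define b where "b = (\<lambda>a i j. complex_of_real (coeff_b D B L \<kappa> a i j))"
  have k0: "k \<noteq> 0" using k2 by auto
  have base: "complex_of_real (- 2 * \<kappa> * s0 B) = - 2 * k * s" "- 2 * k * s \<noteq> 0"
    using k0 s by (simp_all add: k_def s_def)
  have nonpos: "- \<mu> - of_nat m + of_nat r \<notin> \<int>\<^sub>\<le>\<^sub>0" for r
  proof
    assume "- \<mu> - of_nat m + of_nat r \<in> \<int>\<^sub>\<le>\<^sub>0"
    then obtain i where "- \<mu> - of_nat m + of_nat r = of_int i" by (auto elim!: nonpos_Ints_cases)
    hence "\<mu> = of_int (int r - int m - i)" by (simp add: algebra_simps)
    thus False using mu_notin_Ints by (metis Ints_of_int)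
  qed
  define x where "x = complex_of_nat m"
  have G1: "Gamma (- \<mu> - x + 1) = (- \<mu> - x) * G"
    using Gamma_plus1[OF nonpos[of 0]] by (simp add: G_def x_def)
  have G2: "Gamma (- \<mu> - x + 2) = (- \<mu> - x + 1) * Gamma (- \<mu> - x + 1)"
  proof -
    have "- \<mu> - x + 2 = (- \<mu> - of_nat m + of_nat 1) + 1" by (simp add: x_def)
    thus ?thesis by (simp only: Gamma_plus1[OF nonpos[of 1]]) (simp add: x_def)
  qed
  have G3: "Gamma (- \<mu> - x + 3) = (- \<mu> - x + 2) * Gamma (- \<mu> - x + 2)"
  proof -
    have "- \<mu> - x + 3 = (- \<mu> - of_nat m + of_nat 2) + 1" by (simp add: x_def)
    thus ?thesis by (simp only: Gamma_plus1[OF nonpos[of 2]]) (simp add: x_def)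
  qed
  have g0: "gint (int m) i j = G * P * b (int m) i j" for i j
    unfolding gint_def base by (simp add: G_def P_def b_def)
  have g1: "gint (int m - 1) i j = (- \<mu> - x) * (G * P / (- 2 * k * s)) * b (int m - 1) i j" for i j
  proof -
    have "- \<mu> - of_int (int m - 1) = - \<mu> - x + 1" by (simp add: x_def)
    thus ?thesis unfolding gint_def base power_int_diff[OF disjI1[OF base(2)]]
      by (simp only: G1) (simp add: P_def b_def)
  qed
  have g2: "gint (int m - 2) i j = (- \<mu> - x + 1) * (- \<mu> - x) * (G * P / (- 2 * k * s) ^ 2) * b (int m - 2) i j" for i j
  proof -
    have "- \<mu> - of_int (int m - 2) = - \<mu> - x + 2" by (simp add: x_def)
    thus ?thesis unfolding gint_def base power_int_diff[OF disjI1[OF base(2)]]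
      by (simp only: G2 G1) (simp add: P_def b_def)
  qed
  have g3: "gint (int m - 3) i j = (- \<mu> - x + 2) * (- \<mu> - x + 1) * (- \<mu> - x) * (G * P / (- 2 * k * s) ^ 3) * b (int m - 3) i j" for i j
  proof -
    have "- \<mu> - of_int (int m - 3) = - \<mu> - x + 3" by (simp add: x_def)
    thus ?thesis unfolding gint_def base power_int_diff[OF disjI1[OF base(2)]]
      by (simp only: G3 G2 G1) (simp add: P_def b_def)
  qed
  \<comment> \<open>The factor, divided by 18 \<kappa> s0, by which the recurrence for b is
    multiplied. The local name is unrelated to the series of the continuation formula.\<close>
  define W where "W = (x + \<mu>) * (x + (\<mu> - 1)) * (x + (\<mu> - 2)) * G * P"
  define \<tau> where "\<tau> = complex_of_real (tau B \<kappa>)"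
  define t1 where "t1 = complex_of_real (t10 B)"
  define t2 where "t2 = complex_of_real (t20 B)"
  define i where "i = complex_of_nat n1"
  define j where "j = complex_of_nat n2"
  note real_rec = coeff_b_rec[of "int m" "int n1" "int n2" \<kappa> B D L, OF _ _ _ \<kappa>_nz]
  have rec: "6 * k * s * (3 * x - 2 * i - j) * b (int m) ?i ?j =
     ((3 * x - 2 * i - j + \<tau> - 3)\<^sup>2 - (of_real L)\<^sup>2) * b (int m - 1) ?i ?j
       + (- 4 * k * t1 * (3 * x - 2 * i - j + \<tau> - 2) + t2\<^sup>2 - of_real (B 2)) * b (int m - 1) (?i - 1) ?j
       + (- 2 * k * t2 * (3 * x - 2 * i - j + \<tau> - 5 / 2) - of_real (B 1)) * b (int m - 1) ?i (?j - 1)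
       - of_real (D 1) * b (int m - 2) (?i - 1) ?j
       - of_real (D 2) * b (int m - 2) ?i (?j - 1)
       - of_real (D 3) * b (int m - 2) ?i ?j
       - of_real (D 4) * b (int m - 3) (?i - 1) ?j
       - of_real (D 5) * b (int m - 3) ?i (?j - 1)
       - of_real (D 6) * b (int m - 3) ?i ?j"
    using arg_cong[OF real_rec, of complex_of_real] s0_pos
    by (simp add: k_def s_def b_def x_def i_def j_def t1_def t2_def \<tau>_def)
  have sh: "seq_shift (\<lambda>m. gint (int m - 0) p q) = (\<lambda>m. gint (int m - 1) p q)"
    "seq_shift (\<lambda>m. gint (int m - 1) p q) = (\<lambda>m. gint (int m - 2) p q)"
    "seq_shift (\<lambda>m. gint (int m - 2) p q) = (\<lambda>m. gint (int m - 3) p q)" for p q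
    using gint_shift'[of 0 p q] gint_shift'[of 1 p q] gint_shift'[of 2 p q] by simp_all
  have main: "main_op c (\<tau> / 3 - 1 - c) (of_real L / 3) \<mu> (2 * k * s / 9 * of_real (D 3)) (4 * (k * s)\<^sup>2 / 9 * of_real (D 6)) (gseq n1 n2) m
      = W / (18 * k * s) * (6 * k * s * (3 * x - 2 * i - j) * b (int m) ?i ?j
        - ((3 * x - 2 * i - j + \<tau> - 3)\<^sup>2 - (of_real L)\<^sup>2) * b (int m - 1) ?i ?j
        + of_real (D 3) * b (int m - 2) ?i ?j + of_real (D 6) * b (int m - 3) ?i ?j)"
  proof -
    have "main_op c (\<tau> / 3 - 1 - c) (of_real L / 3) \<mu> (2 * k * s / 9 * of_real (D 3)) (4 * (k * s)\<^sup>2 / 9 * of_real (D 6)) (gseq n1 n2) m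
      = (x - c) * (x + \<mu>) * (x + (\<mu> - 1)) * (x + (\<mu> - 2)) * gint (int m) ?i ?j
       - (x + (\<tau> / 3 - 1 - c) + of_real L / 3) * (x + (\<tau> / 3 - 1 - c) - of_real L / 3) * (x + (\<mu> - 1)) * (x + (\<mu> - 2)) * gint (int m - 1) ?i ?j
       + 2 * k * s / 9 * of_real (D 3) * (x + (\<mu> - 2)) * gint (int m - 2) ?i ?j + 4 * (k * s)\<^sup>2 / 9 * of_real (D 6) * gint (int m - 3) ?i ?j"
      unfolding e main_op_def lin_def sh x_def[symmetric] by (simp add: mult.assoc add.assoc[symmetric])
    also have "(x - c) * (x + \<mu>) * (x + (\<mu> - 1)) * (x + (\<mu> - 2)) * gint (int m) ?i ?j = W / (18 * k * s) * (6 * k * s * (3 * x - 2 * i - j) * b (int m) ?i ?j)"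
      unfolding g0 W_def using k0 s by (simp add: c_def i_def j_def field_simps)
    also have "(x + (\<tau> / 3 - 1 - c) + of_real L / 3) * (x + (\<tau> / 3 - 1 - c) - of_real L / 3) * (x + (\<mu> - 1)) * (x + (\<mu> - 2)) * gint (int m - 1) ?i ?j
       = W / (18 * k * s) * (((3 * x - 2 * i - j + \<tau> - 3)\<^sup>2 - (of_real L)\<^sup>2) * b (int m - 1) ?i ?j)"
    proof -
      have "(x + (\<tau> / 3 - 1 - c) + of_real L / 3) * (x + (\<tau> / 3 - 1 - c) - of_real L / 3) = ((3 * x - 2 * i - j + \<tau> - 3)\<^sup>2 - (of_real L)\<^sup>2) / 9"
        by (simp add: c_def i_def j_def power2_eq_square field_simps)
      moreover have "(- \<mu> - x) * (G * P / (- 2 * k * s)) = (x + \<mu>) * G * P * (9 / (18 * k * s))"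
        using k0 s by (simp add: field_simps)
      ultimately show ?thesis unfolding g1 W_def by (simp only:) (simp add: mult_ac)
    qed
    also have "2 * k * s / 9 * of_real (D 3) * (x + (\<mu> - 2)) * gint (int m - 2) ?i ?j = W / (18 * k * s) * (of_real (D 3) * b (int m - 2) ?i ?j)"
      unfolding g2 W_def using k0 s by (simp add: field_simps power2_eq_square)
    also have "4 * (k * s)\<^sup>2 / 9 * of_real (D 6) * gint (int m - 3) ?i ?j = W / (18 * k * s) * (of_real (D 6) * b (int m - 3) ?i ?j)"
      unfolding g3 W_def using k0 s by (simp add: field_simps power2_eq_square power3_eq_cube)
    finally show ?thesis by (simp add: algebra_simps)
  qed
  have lower: "lower_op \<mu> (y / 3) (z / 9) (- (2 * k * s / 9 * d)) (- (4 * (k * s)\<^sup>2 / 9 * d')) (\<lambda>m. gint (int m - 0) p q) m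
      = W / (18 * k * s) * ((3 * y * x + z) * b (int m - 1) p q - d * b (int m - 2) p q - d' * b (int m - 3) p q)" for y z d d' p q
  proof -
    have "lower_op \<mu> (y / 3) (z / 9) (- (2 * k * s / 9 * d)) (- (4 * (k * s)\<^sup>2 / 9 * d')) (\<lambda>m. gint (int m - 0) p q) m
      = (3 * y * x + z) / 9 * (x + (\<mu> - 1)) * (x + (\<mu> - 2)) * gint (int m - 1) p q
       - 2 * k * s / 9 * d * (x + (\<mu> - 2)) * gint (int m - 2) p q - 4 * (k * s)\<^sup>2 / 9 * d' * gint (int m - 3) p q"
    proof -
      have "(y / 3 * x + z / 9) = (3 * y * x + z) / 9" by (simp add: add_divide_distrib)
      thus ?thesis unfolding lower_op_def lin_def sh x_def[symmetric] by (simp only:) (simp add: mult.assoc)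
    qed
    also have "(3 * y * x + z) / 9 * (x + (\<mu> - 1)) * (x + (\<mu> - 2)) * gint (int m - 1) p q = W / (18 * k * s) * ((3 * y * x + z) * b (int m - 1) p q)"
    proof -
      have "(- \<mu> - x) * (G * P / (- 2 * k * s)) = (x + \<mu>) * G * P * (9 / (18 * k * s))"
        using k0 s by (simp add: field_simps)
      thus ?thesis unfolding g1 W_def by (simp only:) (simp add: mult_ac)
    qed
    also have "2 * k * s / 9 * d * (x + (\<mu> - 2)) * gint (int m - 2) p q = W / (18 * k * s) * (d * b (int m - 2) p q)"
      unfolding g2 W_def using k0 s by (simp add: field_simps power2_eq_square)
    also have "4 * (k * s)\<^sup>2 / 9 * d' * gint (int m - 3) p q = W / (18 * k * s) * (d' * b (int m - 3) p q)"
      unfolding g3 W_def using k0 s by (simp add: field_simps power2_eq_square power3_eq_cube)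
    finally show ?thesis by (simp only: right_diff_distrib)
  qed
  let ?z1 = "- 4 * k * t1 * (- 2 * i - j + \<tau> - 2) + t2\<^sup>2 - of_real (B 2)"
  let ?z2 = "- 2 * k * t2 * (- 2 * i - j + \<tau> - 5 / 2) - of_real (B 1)"
  have conv: "complex_of_real (tau B \<kappa>) = \<tau>"
    "complex_of_real (2 * \<kappa> * s0 B / 9 * d) = 2 * k * s / 9 * of_real d"
    "complex_of_real (- (2 * \<kappa> * s0 B / 9 * d)) = - (2 * k * s / 9 * of_real d)"
    "complex_of_real (4 * (\<kappa> * s0 B)\<^sup>2 / 9 * d) = 4 * (k * s)\<^sup>2 / 9 * of_real d"
    "complex_of_real (- (4 * (\<kappa> * s0 B)\<^sup>2 / 9 * d)) = - (4 * (k * s)\<^sup>2 / 9 * of_real d)"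
    "complex_of_real (- 4 * \<kappa> * t10 B / 3) = (- 4 * k * t1) / 3"
    "complex_of_real (- 2 * \<kappa> * t20 B / 3) = (- 2 * k * t2) / 3"
    "complex_of_real ((- 4 * \<kappa> * t10 B * (- 2 * real n1 - real n2 + tau B \<kappa> - 2) + (t20 B)\<^sup>2 - B 2) / 9) = ?z1 / 9"
    "complex_of_real ((- 2 * \<kappa> * t20 B * (- 2 * real n1 - real n2 + tau B \<kappa> - 5 / 2) - B 1) / 9) = ?z2 / 9" for d
    by (simp_all add: k_def s_def \<tau>_def t1_def t2_def i_def j_def)
  show ?thesis
    unfolding conv main e(2,3) lower rec distrib_left[symmetric]
    by (rule arg_cong[where f = "\<lambda>y. W / (18 * k * s) * y"]) (simp add: algebra_simps)
qed

end

section \<open>Assembly of the asymptotic formula\<close>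

lemma bigo_tendsto_0:
  fixes f g :: "nat \<Rightarrow> complex"
  assumes "f \<in> O(g)" "g \<longlonglongrightarrow> 0"
  shows "f \<longlonglongrightarrow> 0"
proof -
  obtain c where "\<forall>\<^sub>F m in sequentially. norm (f m) \<le> c * norm (g m)"
    using landau_o.bigE[OF assms(1)] by blast
  moreover have "(\<lambda>m. c * norm (g m)) \<longlonglongrightarrow> 0"
    using tendsto_mult[OF tendsto_const tendsto_norm[OF assms(2)]] by simp
  ultimately show ?thesis by (rule Lim_null_comparison)
qed

lemma Gamma_nonzero_notin_Ints: "z \<notin> \<int> \<Longrightarrow> Gamma (z::complex) \<noteq> 0"
  using nonpos_Ints_subset_Ints by (auto simp: Gamma_eq_zero_iff)

context continuation
begin

text \<open>Both terms that contain \<kappa> are odd in it. This relation makes the exponent singled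
  out by the recurrence equal to \<mu>' + \<phi>(n).\<close>

lemma tau_minus: "tau B (- \<kappa>) = 3 - tau B \<kappa>"
  using s0_pos \<kappa>_nz by (simp add: tau_def)

lemma error_decay: "\<exists>M0. \<forall>M\<ge>M0. (\<lambda>m. gseq n1 n2 m - trunc M n1 n2 m) \<in> O(ipow N)"
proof (rule truncation_error_decay[where \<alpha> = "\<lambda>n1 n2. aq (n1, n2)", OF gseq_recurrence trunc_bc_span mu'_third_notin_Ints truncation_regular aq_notin_Ints])
  fix n1 n2 :: nat
  show "2 * (complex_of_real (tau B \<kappa>) / 3 - 1 - (2 * of_nat n1 + of_nat n2) / 3) + (2 * of_nat n1 + of_nat n2) / 3 - \<mu> + 1 + aq (n1, n2) = 0"
    unfolding aq_def \<mu>_def \<mu>'_def mu_def phi_def tau_minus by (simp add: field_simps)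
qed

section \<open>From binomial sequences to the terms of R_q(m)\<close>

definition kterm where "kterm n1 n2 q k m = (\<Sum>(l1, l2)\<in>{..n1 - fst q} \<times> {..n2 - snd q}.
  mixed_coeff n1 n2 (fst q) (snd q) l1 l2 * (pochhammer (1 + aq q) k / pochhammer (1 + aq q - of_nat m) k)
    * coeff_H D B L \<nu>1 \<nu>2 lam (- \<kappa>) k l1 l2 (fst q) (snd q))"

lemma minus_aq_notin: "- aq q + of_nat m \<notin> \<int>"
proof
  assume "- aq q + of_nat m \<in> \<int>"
  hence "of_nat m - (- aq q + of_nat m) \<in> \<int>" by (intro Ints_diff) auto
  thus False using aq_notin_Ints[of q] by simp
qed

lemma Gamma_aq_nonzero: "Gamma (- aq q + of_nat m) \<noteq> 0"
  by (rule Gamma_nonzero_notin_Ints[OF minus_aq_notin])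

lemma poch_nonzero: "z \<notin> \<int> \<Longrightarrow> pochhammer z k \<noteq> (0::complex)"
  by (auto simp: pochhammer_eq_0_iff)

lemma one_plus_aq_notin: "1 + aq q - of_nat m \<notin> \<int>"
proof
  assume "1 + aq q - of_nat m \<in> \<int>"
  hence "(1 + of_nat m) - (1 + aq q - of_nat m) - of_nat m \<in> \<int>"
    by (intro Ints_diff Ints_add) auto
  hence "- (- aq q) \<in> \<int>" by (simp add: algebra_simps)
  thus False using aq_notin_Ints[of q] by simp
qed

text \<open>The shifts by i and k are both taken out of Gamma relative to Gamma(-aq). This produces
  the Pochhammer ratio of R_q(m), with the dependence on i confined to a factor that belongs to
  H.\<close>

lemma Gamma_quotient:
  "Gamma (- aq q - of_nat i) * pochhammer (- aq q - of_nat k) m =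
    (- 1) ^ i / pochhammer (1 + aq q) i * Gamma (- aq q + of_nat m) * (pochhammer (1 + aq q) k / pochhammer (1 + aq q - of_nat m) k)"
proof -
  have n0: "- aq q \<notin> \<int>" using minus_aq_notin[of q 0] by simp
  have nk: "- aq q - of_nat k \<notin> \<int>\<^sub>\<le>\<^sub>0"
  proof
    assume "- aq q - of_nat k \<in> \<int>\<^sub>\<le>\<^sub>0"
    then obtain n where "- aq q - of_nat k = of_int n" by (auto elim!: nonpos_Ints_cases)
    hence "- aq q = of_int (n + int k)" by (simp add: algebra_simps)
    thus False using n0 by (metis Ints_of_int)
  qed
  have 1: "Gamma (- aq q - of_nat i) = (- 1) ^ i * Gamma (- aq q) / pochhammer (1 + aq q) i" for i
    using Gamma_minus_of_nat[OF n0, of i] by simp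
  have 2: "Gamma (- aq q + of_nat m - of_nat k) = (- 1) ^ k * Gamma (- aq q + of_nat m) / pochhammer (1 + aq q - of_nat m) k"
    using Gamma_minus_of_nat[OF minus_aq_notin, of q m k] by (simp add: algebra_simps)
  have 3: "pochhammer (- aq q - of_nat k) m = Gamma (- aq q + of_nat m - of_nat k) / Gamma (- aq q - of_nat k)"
    using pochhammer_Gamma[OF nk, of m] by (simp add: algebra_simps)
  have nz: "Gamma (- aq q) \<noteq> 0" "pochhammer (1 + aq q) j \<noteq> 0" "pochhammer (1 + aq q - of_nat m) k \<noteq> 0" for j
    using Gamma_aq_nonzero[of q 0] poch_nonzero[OF one_plus_aq_notin] one_plus_aq_notin[of q 0] poch_nonzero[of "1 + aq q"] by auto
  show ?thesis unfolding 3 2 1 using nz by (simp add: field_simps)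
qed

text \<open>The summation may start at 0 since b(i, l1, l2) = 0 for i < l1 + l2. The range no longer
  depends on l1 and l2, so the sums can be exchanged.\<close>

lemma H_eq: "coeff_H D B L \<nu>1 \<nu>2 lam (- \<kappa>) k l1 l2 q1 q2 = (\<Sum>i\<le>k.
    pochhammer \<mu> (k - i) / fact (k - i) * ((- 1) ^ i / pochhammer (1 + aq (q1, q2)) i)
      * of_real ((2 * \<kappa> * s0 B) ^ i) * of_real (coeff_b D B L (- \<kappa>) (int i) (int l1) (int l2)))"
proof -
  have "coeff_H D B L \<nu>1 \<nu>2 lam (- \<kappa>) k l1 l2 q1 q2 = (\<Sum>i = l1 + l2..k.
    pochhammer \<mu> (k - i) / fact (k - i) * ((- 1) ^ i / pochhammer (1 + aq (q1, q2)) i)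
      * of_real ((2 * \<kappa> * s0 B) ^ i) * of_real (coeff_b D B L (- \<kappa>) (int i) (int l1) (int l2)))"
    unfolding coeff_H_def
  proof (rule sum.cong[OF refl])
    fix i
    have "2 * - \<kappa> * s0 B = - (2 * \<kappa> * s0 B)" by simp
    hence "(2 * - \<kappa> * s0 B) ^ i = (- 1) ^ i * (2 * \<kappa> * s0 B) ^ i" by (simp only: power_minus[of "2 * \<kappa> * s0 B"])
    thus "pochhammer (mu B \<nu>1 \<nu>2 lam (- (- \<kappa>))) (k - i) / (fact (k - i) * pochhammer (1 + mu B \<nu>1 \<nu>2 lam (- \<kappa>) + phi q1 q2) i)
      * of_real ((2 * - \<kappa> * s0 B) ^ i) * of_real (coeff_b D B L (- \<kappa>) (int i) (int l1) (int l2)) =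
      pochhammer \<mu> (k - i) / fact (k - i) * ((- 1) ^ i / pochhammer (1 + aq (q1, q2)) i)
      * of_real ((2 * \<kappa> * s0 B) ^ i) * of_real (coeff_b D B L (- \<kappa>) (int i) (int l1) (int l2))"
      by (simp add: \<mu>_def \<mu>'_def aq_def add.assoc)
  qed
  also have "\<dots> = (\<Sum>i\<le>k.
    pochhammer \<mu> (k - i) / fact (k - i) * ((- 1) ^ i / pochhammer (1 + aq (q1, q2)) i)
      * of_real ((2 * \<kappa> * s0 B) ^ i) * of_real (coeff_b D B L (- \<kappa>) (int i) (int l1) (int l2)))"
    by (rule sum.mono_neutral_left) (auto simp: coeff_b_eq_0)
  finally show ?thesis .
qed

text \<open>Multiplied by m!, a term of the prediction becomes a term of R_q(m). The factors
  (\<mu>)_(k-j)/(k-j)! of H are the coefficients of x^(-\<mu>) in powers of 1 - x, contributed by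
  the Cauchy product.\<close>

lemma fcoef_bc: "fcoef n1 n2 q k * bc (aq q + of_nat k) m * fact m = Eq (fst q) (snd q) * Gamma (- aq q + of_nat m) * kterm n1 n2 q k m"
proof -
  obtain q1 q2 where q: "q = (q1, q2)" by (cases q)
  let ?S = "{..n1 - q1} \<times> {..n2 - q2}"
  let ?ratio = "pochhammer (1 + aq q) k / pochhammer (1 + aq q - of_nat m) k"
  let ?h = "\<lambda>i l1 l2. pochhammer \<mu> (k - i) / fact (k - i) * ((- 1) ^ i / pochhammer (1 + aq q) i)
      * of_real ((2 * \<kappa> * s0 B) ^ i) * of_real (coeff_b D B L (- \<kappa>) (int i) (int l1) (int l2)) :: complex"
  have b: "bc (aq q + of_nat k) m * fact m = pochhammer (- aq q - of_nat k) m" by (simp add: bc_def)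
  have t: "bseq q1 q2 l1 l2 i * bc (- \<mu>) (k - i) * (bc (aq q + of_nat k) m * fact m) = Gamma (- aq q + of_nat m) * ?ratio * ?h i l1 l2" for i l1 l2
  proof -
    have "bseq q1 q2 l1 l2 i * bc (- \<mu>) (k - i) * (bc (aq q + of_nat k) m * fact m)
      = (Gamma (- aq q - of_nat i) * pochhammer (- aq q - of_nat k) m) * (pochhammer \<mu> (k - i) / fact (k - i)
      * of_real ((2 * \<kappa> * s0 B) ^ i) * of_real (coeff_b D B L (- \<kappa>) (int i) (int l1) (int l2)))"
      unfolding b bseq_def by (simp add: bc_def aq_def q)
    thus ?thesis unfolding Gamma_quotient by (simp only: mult_ac)
  qed
  have "fcoef n1 n2 q k * bc (aq q + of_nat k) m * fact m
     = (\<Sum>i\<le>k. \<Sum>(l1, l2)\<in>?S. mixed_coeff n1 n2 q1 q2 l1 l2 * Eq q1 q2 * (bseq q1 q2 l1 l2 i * bc (- \<mu>) (k - i) * (bc (aq q + of_nat k) m * fact m)))"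
    by (simp add: fcoef_def phicoef_def q sum_distrib_right case_prod_beta mult.assoc)
  also have "\<dots> = (\<Sum>(l1, l2)\<in>?S. \<Sum>i\<le>k. mixed_coeff n1 n2 q1 q2 l1 l2 * Eq q1 q2 * (Gamma (- aq q + of_nat m) * ?ratio * ?h i l1 l2))"
    unfolding t case_prod_beta by (rule sum.swap)
  also have "\<dots> = (\<Sum>(l1, l2)\<in>?S. mixed_coeff n1 n2 q1 q2 l1 l2 * Eq q1 q2 * (Gamma (- aq q + of_nat m) * ?ratio * coeff_H D B L \<nu>1 \<nu>2 lam (- \<kappa>) k l1 l2 q1 q2))"
    unfolding H_eq q by (simp only: sum_distrib_left)
  also have "\<dots> = Eq (fst q) (snd q) * Gamma (- aq q + of_nat m) * kterm n1 n2 q k m"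
    unfolding kterm_def sum_distrib_left case_prod_beta q fst_conv snd_conv by (rule sum.cong[OF refl]) (simp only: mult_ac)
  finally show ?thesis .
qed

text \<open>The ranges cut off at k and the full ranges give the same sum because H is an empty sum
  for k < l1 + l2.\<close>

lemma R_sum_eq: "R_sum D B L \<nu>1 \<nu>2 lam \<kappa> n1 n2 K q1 q2 m = (\<Sum>k\<le>K. kterm n1 n2 (q1, q2) k m)"
proof -
  have H0: "coeff_H D B L \<nu>1 \<nu>2 lam (- \<kappa>) k l1 l2 q1 q2 = 0" if "\<not> (l1 \<le> k \<and> l2 \<le> k)" for k l1 l2
    using that by (auto simp: coeff_H_def)
  have c: "- 2 * \<kappa> * t10 B = - (2 * \<kappa> * t10 B)" "- 2 * \<kappa> * t20 B = - (2 * \<kappa> * t20 B)" by simp_all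
  have a: "1 + mu B \<nu>1 \<nu>2 lam (- \<kappa>) + phi q1 q2 = 1 + aq (q1, q2)" by (simp add: aq_def \<mu>'_def add.assoc)
  have "(\<Sum>l1 = 0..min k (n1 - q1). \<Sum>l2 = 0..min k (n2 - q2).
      pochhammer (1 + mu B \<nu>1 \<nu>2 lam (- \<kappa>) + phi q1 q2) k
      / pochhammer (1 + mu B \<nu>1 \<nu>2 lam (- \<kappa>) + phi q1 q2 - of_nat m) k
      * coeff_H D B L \<nu>1 \<nu>2 lam (- \<kappa>) k l1 l2 q1 q2
      * (of_real ((- 2 * \<kappa> * t10 B) ^ (n1 - q1 - l1)) / fact (n1 - q1 - l1))
      * (of_real ((- 2 * \<kappa> * t20 B) ^ (n2 - q2 - l2)) / fact (n2 - q2 - l2))) = kterm n1 n2 (q1, q2) k m" for k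
  proof -
    let ?t = "\<lambda>l1 l2. mixed_coeff n1 n2 q1 q2 l1 l2 * (pochhammer (1 + aq (q1, q2)) k / pochhammer (1 + aq (q1, q2) - of_nat m) k)
      * coeff_H D B L \<nu>1 \<nu>2 lam (- \<kappa>) k l1 l2 q1 q2"
    have "(\<Sum>l1 = 0..min k (n1 - q1). \<Sum>l2 = 0..min k (n2 - q2).
      pochhammer (1 + mu B \<nu>1 \<nu>2 lam (- \<kappa>) + phi q1 q2) k
      / pochhammer (1 + mu B \<nu>1 \<nu>2 lam (- \<kappa>) + phi q1 q2 - of_nat m) k
      * coeff_H D B L \<nu>1 \<nu>2 lam (- \<kappa>) k l1 l2 q1 q2
      * (of_real ((- 2 * \<kappa> * t10 B) ^ (n1 - q1 - l1)) / fact (n1 - q1 - l1))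
      * (of_real ((- 2 * \<kappa> * t20 B) ^ (n2 - q2 - l2)) / fact (n2 - q2 - l2)))
      = (\<Sum>l1 = 0..min k (n1 - q1). \<Sum>l2 = 0..min k (n2 - q2). ?t l1 l2)"
      unfolding a c by (intro sum.cong refl) (simp add: mixed_coeff_def c1_def c2_def mult_ac)
    also have "\<dots> = (\<Sum>l\<in>{0..min k (n1 - q1)} \<times> {0..min k (n2 - q2)}. ?t (fst l) (snd l))"
      by (simp add: sum.cartesian_product case_prod_beta)
    also have "\<dots> = (\<Sum>l\<in>{..n1 - q1} \<times> {..n2 - q2}. ?t (fst l) (snd l))"
    proof (rule sum.mono_neutral_left)
      show "\<forall>l\<in>{..n1 - q1} \<times> {..n2 - q2} - {0..min k (n1 - q1)} \<times> {0..min k (n2 - q2)}. ?t (fst l) (snd l) = 0"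
      proof
        fix l assume "l \<in> {..n1 - q1} \<times> {..n2 - q2} - {0..min k (n1 - q1)} \<times> {0..min k (n2 - q2)}"
        hence "\<not> (fst l \<le> k \<and> snd l \<le> k)" by auto
        from H0[OF this] show "?t (fst l) (snd l) = 0" by simp
      qed
    qed auto
    finally show ?thesis by (simp add: kterm_def case_prod_beta)
  qed
  thus ?thesis unfolding R_sum_def by (simp only: atLeast0AtMost)
qed

lemma kterm_diagonal: "kterm n1 n2 (n1, n2) k m = pochhammer (1 + aq (n1, n2)) k / pochhammer (1 + aq (n1, n2) - of_nat m) k
    * coeff_H D B L \<nu>1 \<nu>2 lam (- \<kappa>) k 0 0 n1 n2"
  by (simp add: kterm_def mixed_coeff_def)

lemma kterm_diagonal_0: "kterm n1 n2 (n1, n2) 0 m = 1"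
  by (simp add: kterm_diagonal coeff_H_def coeff_b.simps)

lemma pochhammer_inverse_bigo: "(\<lambda>m. 1 / pochhammer (z - of_nat m) k) \<in> O(ipow k)" for z :: complex
proof (induction k)
  case (Suc k)
  have "(\<lambda>m. (- 1) * ((1 / pochhammer (z - of_nat m) k) / (of_nat m + - (z + of_nat k)))) \<in> O(ipow (Suc k))"
    by (intro bigo_ipow_scale bigo_ipow_div_linear Suc)
  also have "(\<lambda>m. (- 1) * ((1 / pochhammer (z - of_nat m) k) / (of_nat m + - (z + of_nat k)))) = (\<lambda>m. 1 / pochhammer (z - of_nat m) (Suc k))"
  proof
    fix m
    define y where "y = z - of_nat m + of_nat k"
    have y: "of_nat m + - (z + of_nat k) = - y" by (simp add: y_def)
    show "(- 1) * ((1 / pochhammer (z - of_nat m) k) / (of_nat m + - (z + of_nat k))) = 1 / pochhammer (z - of_nat m) (Suc k)"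
      unfolding y pochhammer_Suc y_def[symmetric] by (simp add: divide_inverse)
  qed
  finally show ?case .
qed simp

lemma kterm_bigo: "kterm n1 n2 q k \<in> O(ipow k)"
proof -
  have "(\<lambda>m. \<Sum>l\<in>{..n1 - fst q} \<times> {..n2 - snd q}. (mixed_coeff n1 n2 (fst q) (snd q) (fst l) (snd l)
     * pochhammer (1 + aq q) k * coeff_H D B L \<nu>1 \<nu>2 lam (- \<kappa>) k (fst l) (snd l) (fst q) (snd q)) * (1 / pochhammer (1 + aq q - of_nat m) k)) \<in> O(ipow k)"
    by (intro big_sum_in_bigo bigo_ipow_scale pochhammer_inverse_bigo)
  thus ?thesis by (simp add: kterm_def [abs_def] case_prod_beta mult_ac)
qed

text \<open>Reflection formula for Gamma(-\<mu>-m). Its sign (-1)^m cancels that of (-2 \<kappa>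
  s0)^m, and the sine is the normalising factor in the definition of e.\<close>

lemma leading_eq: "- of_real pi * (Gamma (1 + of_nat m) / (Gamma (1 + \<mu> + of_nat m) * Gamma (- \<mu>' - phi n1 n2 + of_nat m)))
     * of_real ((2 * \<kappa> * s0 B) ^ m) * of_real (coeff_b D B L \<kappa> (int m) (int n1) (int n2))
   = sin (of_real pi * \<mu>) * gseq n1 n2 m * (fact m / Gamma (- aq (n1, n2) + of_nat m))"
proof -
  define z where "z = - \<mu> - of_nat m"
  have zn: "z \<notin> \<int>"
  proof
    assume "z \<in> \<int>"
    hence "- (z + of_nat m) \<in> \<int>" by (intro Ints_minus Ints_add) auto
    thus False using mu_notin_Ints by (simp add: z_def)
  qed
  have refl: "Gamma z * Gamma (1 - z) = of_real pi / sin (of_real pi * z)"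
    by (rule Gamma_reflection_complex)
  have "of_real pi * z = - (of_real pi * \<mu> + of_real (pi * real m))"
    by (simp add: z_def algebra_simps)
  hence "sin (of_real pi * z) = - (sin (of_real pi * \<mu> + of_real (pi * real m)))"
    by (simp only: sin_minus)
  also have "sin (of_real pi * \<mu> + of_real (pi * real m)) = (- 1) ^ m * sin (of_real pi * \<mu>)"
    by (simp only: sin_add sin_of_real cos_of_real cos_npi2 sin_npi2) simp
  finally have sz: "sin (of_real pi * z) = - ((- 1) ^ m * sin (of_real pi * \<mu>))" .
  have s0: "sin (of_real pi * \<mu>) \<noteq> 0"
    using mu_notin_Ints by (auto simp: sin_eq_0 mult_ac)
  have "1 - z \<notin> \<int>"
  proof
    assume "1 - z \<in> \<int>"
    hence "1 - (1 - z) \<in> \<int>" by (intro Ints_diff) auto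
    thus False using zn by simp
  qed
  hence g1: "Gamma (1 - z) \<noteq> 0" by (rule Gamma_nonzero_notin_Ints)
  have "Gamma z = (Gamma z * Gamma (1 - z)) / Gamma (1 - z)" using g1 by simp
  also have "\<dots> = of_real pi / sin (of_real pi * z) / Gamma (1 - z)" unfolding refl ..
  also have "1 - z = 1 + \<mu> + of_nat m" by (simp add: z_def)
  finally have "sin (of_real pi * \<mu>) * Gamma z = - of_real pi * (- 1) ^ m / Gamma (1 + \<mu> + of_nat m)"
    unfolding sz using s0 by (cases "even m") simp_all
  moreover have "(- 2 * \<kappa> * s0 B) ^ m = (- 1) ^ m * (2 * \<kappa> * s0 B) ^ m"
  proof -
    have "- 2 * \<kappa> * s0 B = - (2 * \<kappa> * s0 B)" by simp
    thus ?thesis by (simp only: power_minus[of "2 * \<kappa> * s0 B"])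
  qed
  ultimately have "sin (of_real pi * \<mu>) * gseq n1 n2 m = - of_real pi / Gamma (1 + \<mu> + of_nat m) * of_real ((2 * \<kappa> * s0 B) ^ m) * of_real (coeff_b D B L \<kappa> (int m) (int n1) (int n2))"
    unfolding gseq_def z_def[symmetric] mult.assoc[symmetric] by (cases "even m") simp_all
  moreover have "Gamma (1 + of_nat m) = (fact m :: complex)"
    using Gamma_fact[of m] by (simp add: add.commute)
  moreover have "- \<mu>' - phi n1 n2 + of_nat m = - aq (n1, n2) + of_nat m" by (simp add: aq_def)
  ultimately show ?thesis by (simp add: mult_ac)
qed

text \<open>
  The remainder is smaller than any fixed power of $1/m$. It is absorbed into the error term
  belonging to one nonvanishing $e_q$, if there is one.
\<close>

lemma asymptotics:
  fixes n1 n2 K :: nat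
  defines "Q \<equiv> {..n1} \<times> {..n2}" and "e \<equiv> \<lambda>q. sin (of_real pi * \<mu>) * Eq (fst q) (snd q)"
    and "lead \<equiv> \<lambda>m. - of_real pi * (Gamma (1 + of_nat m) / (Gamma (1 + \<mu> + of_nat m) * Gamma (- \<mu>' - phi n1 n2 + of_nat m)))
     * of_real ((2 * \<kappa> * s0 B) ^ m) * of_real (coeff_b D B L \<kappa> (int m) (int n1) (int n2))"
    and "R \<equiv> \<lambda>q m. R_sum D B L \<nu>1 \<nu>2 lam \<kappa> n1 n2 K (fst q) (snd q) m"
    and "ratio \<equiv> \<lambda>q m. Gamma (- aq q + of_nat m) / Gamma (- aq (n1, n2) + of_nat m)"
  shows "\<exists>\<rho> \<epsilon>. (\<forall>q. \<rho> q \<in> O(ipow (K + 1))) \<and> \<epsilon> \<in> O(ipow (K + 1)) \<and> ((\<exists>q\<in>Q. e q \<noteq> 0) \<longrightarrow> \<epsilon> = (\<lambda>_. 0)) \<and>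
    (\<forall>m. lead m + \<epsilon> m = (\<Sum>q\<in>Q. e q * ratio q m * (R q m + \<rho> q m)))"
proof -
  \<comment> \<open>Covers the exponents of all q in Q at once, since their real parts are largest
    at q = n.\<close>
  define k where "k = nat \<lceil>Re (aq (n1, n2)) + 1\<rceil>"
  obtain M0 where M0: "\<And>M. M \<ge> M0 \<Longrightarrow> (\<lambda>m. gseq n1 n2 m - trunc M n1 n2 m) \<in> O(ipow (K + 1 + k))"
    using error_decay[of n1 n2 "K + 1 + k"] by blast
  \<comment> \<open>At least K + 1, so that the terms beyond K form the error
    \<open>\<rho>0\<close>.\<close>
  define M where "M = max M0 (K + 1)"
  define h where "h = (\<lambda>m. gseq n1 n2 m - trunc M n1 n2 m)"
  have h: "h \<in> O(ipow (K + 1 + k))" unfolding h_def by (rule M0) (simp add: M_def)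
  \<comment> \<open>The remainder normalised by the Gamma factor of q; passing from one q to another
    multiplies it by a quotient of two such factors.\<close>
  define T where "T = (\<lambda>q m. sin (of_real pi * \<mu>) * h m * (fact m / Gamma (- aq q + of_nat m)))"
  have T: "T q \<in> O(ipow (K + 1))" if "q \<in> Q" for q
  proof -
    have "Re (aq q) \<le> Re (aq (n1, n2))" using that by (auto simp: aq_def phi_def Q_def)
    hence "Re (aq q) + 1 \<le> real k" unfolding k_def by linarith
    hence "(\<lambda>m. h m / bc (aq q) m) \<in> O(ipow (K + 1 + k - k))"
      by (intro bigo_ipow_div_bc[OF aq_notin_Ints h]) auto
    hence "(\<lambda>m. (sin (of_real pi * \<mu>) / Gamma (- aq q)) * (h m / bc (aq q) m)) \<in> O(ipow (K + 1))"
      by (intro bigo_ipow_scale) simp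
    moreover have "(sin (of_real pi * \<mu>) / Gamma (- aq q)) * (h m / bc (aq q) m) = T q m" for m
    proof -
      have "- aq q \<notin> \<int>\<^sub>\<le>\<^sub>0" using minus_aq_notin[of q 0] nonpos_Ints_subset_Ints by auto
      hence "bc (aq q) m = Gamma (- aq q + of_nat m) / Gamma (- aq q) / fact m"
        by (simp add: bc_def pochhammer_Gamma)
      thus ?thesis using Gamma_aq_nonzero[of q 0] by (simp add: T_def)
    qed
    ultimately show ?thesis by simp
  qed
  define \<rho>0 where "\<rho>0 = (\<lambda>q m. \<Sum>j\<in>{K + 1..<M}. kterm n1 n2 q j m)"
  have \<rho>0: "\<rho>0 q \<in> O(ipow (K + 1))" for q
    unfolding \<rho>0_def by (intro big_sum_in_bigo bigo_ipow_mono[OF kterm_bigo]) auto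
  have ksum: "(\<Sum>j<M. kterm n1 n2 q j m) = R q m + \<rho>0 q m" for q m
  proof -
    have "(\<Sum>j\<in>{0..<Suc K}. kterm n1 n2 q j m) + (\<Sum>j\<in>{Suc K..<M}. kterm n1 n2 q j m) = (\<Sum>j\<in>{0..<M}. kterm n1 n2 q j m)"
      by (rule sum.atLeastLessThan_concat) (auto simp: M_def)
    thus ?thesis unfolding R_def R_sum_eq \<rho>0_def atLeast0LessThan lessThan_Suc_atMost by simp
  qed
  have main: "lead m = (\<Sum>q\<in>Q. e q * ratio q m * (R q m + \<rho>0 q m)) + T (n1, n2) m" for m
  proof -
    let ?G = "fact m / Gamma (- aq (n1, n2) + of_nat m) :: complex"
    have "sin (of_real pi * \<mu>) * trunc M n1 n2 m * ?G
      = (\<Sum>q\<in>Q. \<Sum>j<M. sin (of_real pi * \<mu>) * (fcoef n1 n2 q j * bc (aq q + of_nat j) m * fact m) / Gamma (- aq (n1, n2) + of_nat m))"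
      by (simp add: trunc_def Q_def sum_distrib_left sum_distrib_right sum_divide_distrib mult_ac)
    also have "\<dots> = (\<Sum>q\<in>Q. e q * ratio q m * (\<Sum>j<M. kterm n1 n2 q j m))"
      unfolding fcoef_bc by (simp add: e_def ratio_def sum_distrib_left sum_divide_distrib mult_ac)
    finally have "sin (of_real pi * \<mu>) * trunc M n1 n2 m * ?G = (\<Sum>q\<in>Q. e q * ratio q m * (R q m + \<rho>0 q m))"
      unfolding ksum .
    moreover have "lead m = sin (of_real pi * \<mu>) * trunc M n1 n2 m * ?G + T (n1, n2) m"
      unfolding lead_def leading_eq by (simp add: T_def h_def left_diff_distrib right_diff_distrib diff_divide_distrib)
    ultimately show ?thesis by simp
  qed
  have nn: "(n1, n2) \<in> Q" by (simp add: Q_def)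
  show ?thesis
  proof (cases "\<exists>q\<in>Q. e q \<noteq> 0")
    case True
    then obtain p where p: "p \<in> Q" "e p \<noteq> 0" by blast
    \<comment> \<open>Multiplied by \<open>e p\<close> and the Gamma ratio of p, the correction
      becomes exactly \<open>T (n1, n2)\<close>, the whole remainder.\<close>
    define \<rho> where "\<rho> = (\<lambda>q m. \<rho>0 q m + (if q = p then (1 / e p) else 0) * T p m)"
    have "\<rho> q \<in> O(ipow (K + 1))" for q
      unfolding \<rho>_def by (intro sum_in_bigo \<rho>0 bigo_ipow_scale T p)
    moreover have "lead m + 0 = (\<Sum>q\<in>Q. e q * ratio q m * (R q m + \<rho> q m))" for m
    proof -
      have "(\<Sum>q\<in>Q. e q * ratio q m * (R q m + \<rho> q m)) = (\<Sum>q\<in>Q. e q * ratio q m * (R q m + \<rho>0 q m))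
          + (\<Sum>q\<in>Q. if q = p then ratio p m * T p m else 0)"
        unfolding sum.distrib[symmetric] using p(2) by (intro sum.cong refl) (auto simp: \<rho>_def algebra_simps)
      also have "(\<Sum>q\<in>Q. if q = p then ratio p m * T p m else 0) = ratio p m * T p m"
        using p(1) by (simp add: Q_def)
      also have "ratio p m * T p m = T (n1, n2) m"
        using Gamma_aq_nonzero[of p m] by (simp add: ratio_def T_def)
      finally show ?thesis using main[of m] by simp
    qed
    ultimately show ?thesis by (intro exI[of _ \<rho>] exI[of _ "\<lambda>_. 0"]) auto
  next
    case False
    have "lead m + (- 1) * T (n1, n2) m = (\<Sum>q\<in>Q. e q * ratio q m * (R q m + \<rho>0 q m))" for m
      using main[of m] by simp
    moreover have "(\<lambda>m. (- 1) * T (n1, n2) m) \<in> O(ipow (K + 1))"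
      by (intro bigo_ipow_scale T nn)
    ultimately show ?thesis using \<rho>0 False by (intro exI[of _ \<rho>0] exI[of _ "\<lambda>m. (- 1) * T (n1, n2) m"]) blast
  qed
qed

text \<open>The term k = 0 equals 1 because b(-\<kappa>; 0, 0, 0) = 1, and everything else is
  O(1/m).\<close>

lemma denominator_eventually_nonzero:
  assumes "\<rho> \<in> O(ipow (K + 1))"
  shows "\<forall>\<^sub>F m in sequentially. R_sum D B L \<nu>1 \<nu>2 lam \<kappa> n1 n2 K n1 n2 m + \<rho> m \<noteq> 0"
proof -
  have "(\<lambda>m. (\<Sum>k\<in>{1..K}. kterm n1 n2 (n1, n2) k m) + \<rho> m) \<in> O(ipow 1)"
    by (intro sum_in_bigo big_sum_in_bigo bigo_ipow_mono[OF kterm_bigo] bigo_ipow_mono[OF assms]) auto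
  moreover have "ipow 1 \<longlonglongrightarrow> 0" by (simp add: lim_inverse_n' divide_inverse lim_inverse_n)
  ultimately have "(\<lambda>m. (\<Sum>k\<in>{1..K}. kterm n1 n2 (n1, n2) k m) + \<rho> m) \<longlonglongrightarrow> 0"
    by (rule bigo_tendsto_0)
  hence "(\<lambda>m. 1 + ((\<Sum>k\<in>{1..K}. kterm n1 n2 (n1, n2) k m) + \<rho> m)) \<longlonglongrightarrow> 1 + 0"
    by (intro tendsto_intros)
  hence "\<forall>\<^sub>F m in sequentially. 1 + ((\<Sum>k\<in>{1..K}. kterm n1 n2 (n1, n2) k m) + \<rho> m) \<noteq> 0"
    by (rule tendsto_imp_eventually_ne) simp
  moreover have "R_sum D B L \<nu>1 \<nu>2 lam \<kappa> n1 n2 K n1 n2 m = 1 + (\<Sum>k\<in>{1..K}. kterm n1 n2 (n1, n2) k m)" for m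
    unfolding R_sum_eq atLeast0AtMost[symmetric] by (simp add: sum.atLeast_Suc_atMost kterm_diagonal_0)
  ultimately show ?thesis by (simp add: add.assoc)
qed

lemma R_sum_diagonal: "R_sum D B L \<nu>1 \<nu>2 lam \<kappa> n1 n2 K n1 n2 m = 1 + (\<Sum>k = 1..K.
    pochhammer (1 + \<mu>' + phi n1 n2) k / pochhammer (1 + \<mu>' + phi n1 n2 - of_nat m) k * coeff_H D B L \<nu>1 \<nu>2 lam (- \<kappa>) k 0 0 n1 n2)"
  unfolding R_sum_eq atLeast0AtMost[symmetric]
  by (simp add: sum.atLeast_Suc_atMost kterm_diagonal_0) (simp add: kterm_diagonal aq_def add.assoc)

end

text \<open>If all e(q) with q \<le> n vanish, no product with a coefficient can carry an error.
  Without the separate term the formula would then assert that the leading expression is exactly 0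
  for large m, whereas the asymptotics only bound it.\<close>

theorem theorem1:
  fixes D B :: "nat \<Rightarrow> real" and L \<kappa> :: real and lam :: complex
    and \<nu>1 \<nu>2 n1 n2 K :: nat
    and E :: "real \<Rightarrow> nat \<Rightarrow> nat \<Rightarrow> nat \<Rightarrow> nat \<Rightarrow> complex"
  assumes "B 6 > 0" and "L \<ge> 0" and "\<kappa> \<in> {1, -1}" and "\<nu>1 > 0" and "\<nu>2 > 0"
    and "\<forall>\<sigma>\<in>{1, -1}. \<forall>r1 r2. mu B \<nu>1 \<nu>2 lam \<sigma> + phi r1 r2 \<notin> \<int>"
    and "continuation_coeffs D B L \<nu>1 \<nu>2 lam \<kappa> 0 0 (E (- \<kappa>) 0 0)"
  shows "let e = coeff_e B \<nu>1 \<nu>2 lam E (- \<kappa>);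
             \<mu> = mu B \<nu>1 \<nu>2 lam \<kappa>;
             \<mu>' = mu B \<nu>1 \<nu>2 lam (- \<kappa>)
         in \<exists>(\<rho> :: nat \<Rightarrow> complex) (\<rho>R :: nat \<Rightarrow> nat \<Rightarrow> nat \<Rightarrow> complex) (\<epsilon> :: nat \<Rightarrow> complex).
           \<rho> \<in> O(\<lambda>m. 1 / of_nat m ^ (K + 1)) \<and>
           (\<forall>q1\<le>n1. \<forall>q2\<le>n2. \<rho>R q1 q2 \<in> O(\<lambda>m. 1 / of_nat m ^ (K + 1))) \<and>
           \<comment> \<open>an error term outside the coefficients e is present only if all of these vanish\<close>
           \<epsilon> \<in> O(\<lambda>m. 1 / of_nat m ^ (K + 1)) \<and>
           ((\<exists>q1\<le>n1. \<exists>q2\<le>n2. e q1 q2 \<noteq> 0) \<longrightarrow> \<epsilon> = (\<lambda>m. 0)) \<and>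
           (\<forall>\<^sub>F m in sequentially.
             (let den = 1
                    + (\<Sum>k = 1..K. pochhammer (1 + \<mu>' + phi n1 n2) k
                        / pochhammer (1 + \<mu>' + phi n1 n2 - of_nat m) k
                        * coeff_H D B L \<nu>1 \<nu>2 lam (- \<kappa>) k 0 0 n1 n2)
                    + \<rho> m
              in den \<noteq> 0 \<and>
                 e n1 n2 =
                   (- of_real pi
                      * (Gamma (1 + of_nat m)
                         / (Gamma (1 + \<mu> + of_nat m) * Gamma (- \<mu>' - phi n1 n2 + of_nat m)))
                      * of_real ((2 * \<kappa> * s0 B) ^ m)
                      * of_real (coeff_b D B L \<kappa> (int m) (int n1) (int n2))
                    - (\<Sum>(q1, q2)\<in>({0..n1} \<times> {0..n2}) - {(n1, n2)}.
                        e q1 q2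
                        * (Gamma (- \<mu>' - phi q1 q2 + of_nat m)
                           / Gamma (- \<mu>' - phi n1 n2 + of_nat m))
                        * (R_sum D B L \<nu>1 \<nu>2 lam \<kappa> n1 n2 K q1 q2 m + \<rho>R q1 q2 m))
                    + \<epsilon> m)
                   * inverse den))"
proof -
  interpret continuation D B L \<kappa> lam \<nu>1 \<nu>2 "E (- \<kappa>) 0 0"
    using assms by unfold_locales auto
  let ?e = "coeff_e B \<nu>1 \<nu>2 lam E (- \<kappa>)"
  let ?R = "\<lambda>q1 q2 m. R_sum D B L \<nu>1 \<nu>2 lam \<kappa> n1 n2 K q1 q2 m"
  define lead where "lead = (\<lambda>m. - of_real pi * (Gamma (1 + of_nat m) / (Gamma (1 + \<mu> + of_nat m) * Gamma (- \<mu>' - phi n1 n2 + of_nat m)))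
     * of_real ((2 * \<kappa> * s0 B) ^ m) * of_real (coeff_b D B L \<kappa> (int m) (int n1) (int n2)))"
  define ratio where "ratio = (\<lambda>q1 q2 m. Gamma (- \<mu>' - phi q1 q2 + of_nat m) / Gamma (- \<mu>' - phi n1 n2 + of_nat m))"
  have e: "?e q1 q2 = sin (of_real pi * \<mu>) * E (- \<kappa>) 0 0 q1 q2" for q1 q2
    by (simp add: coeff_e_def \<mu>_def)
  have aq: "- aq q + of_nat m = - \<mu>' - phi (fst q) (snd q) + of_nat m" for q m
    by (simp add: aq_def)
  obtain \<rho> \<epsilon> where \<rho>: "\<And>q. \<rho> q \<in> O(ipow (K + 1))" and \<epsilon>: "\<epsilon> \<in> O(ipow (K + 1))"
    and \<epsilon>0: "(\<exists>q\<in>{..n1} \<times> {..n2}. ?e (fst q) (snd q) \<noteq> 0) \<longrightarrow> \<epsilon> = (\<lambda>_. 0)"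
    and main: "\<And>m. lead m + \<epsilon> m = (\<Sum>q\<in>{..n1} \<times> {..n2}. ?e (fst q) (snd q) * ratio (fst q) (snd q) m * (?R (fst q) (snd q) m + \<rho> q m))"
    using asymptotics[where ?n1.0 = n1 and ?n2.0 = n2 and K = K] unfolding e lead_def ratio_def aq fst_conv snd_conv by blast
  have "\<forall>\<^sub>F m in sequentially. ?R n1 n2 m + \<rho> (n1, n2) m \<noteq> 0 \<and>
    ?e n1 n2 = (lead m - (\<Sum>(q1, q2)\<in>({0..n1} \<times> {0..n2}) - {(n1, n2)}. ?e q1 q2 * ratio q1 q2 m * (?R q1 q2 m + \<rho> (q1, q2) m)) + \<epsilon> m)
      * inverse (?R n1 n2 m + \<rho> (n1, n2) m)"
    using denominator_eventually_nonzero[OF \<rho>, of n1 n2 "(n1, n2)"]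
  proof eventually_elim
    case (elim m)
    have "ratio n1 n2 m = 1"
      using Gamma_aq_nonzero[of "(n1, n2)" m] unfolding aq by (simp add: ratio_def)
    \<comment> \<open>The summand q = n isolates e(n1, n2), multiplied by the denominator; the
      formula results from solving for it.\<close>
    hence "lead m + \<epsilon> m = ?e n1 n2 * (?R n1 n2 m + \<rho> (n1, n2) m)
        + (\<Sum>(q1, q2)\<in>({0..n1} \<times> {0..n2}) - {(n1, n2)}. ?e q1 q2 * ratio q1 q2 m * (?R q1 q2 m + \<rho> (q1, q2) m))"
      unfolding main[of m] atLeast0AtMost
      by (subst sum.remove[of _ "(n1, n2)"]) (auto simp: case_prod_beta)
    thus ?case using elim by (simp add: field_simps)
  qed
  thus ?thesis
    unfolding Let_def \<mu>_def[symmetric] \<mu>'_def[symmetric] R_sum_diagonal lead_def ratio_def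
    using \<rho> \<epsilon> \<epsilon>0 
    by (intro exI[of _ "\<rho> (n1, n2)"] exI[of _ "\<lambda>q1 q2. \<rho> (q1, q2)"] exI[of _ \<epsilon>] conjI) auto
qed

end
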